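(* Let $\ast$ and $\tilde\ast$ be two natural star products on a Poisson manifold $(M,\pi_0)$ having the same formal symplectic groupoid, that is, $\sigma(L_f)=\sigma(\tilde L_f)$ and $\sigma(R_f)=\sigma(\tilde R_f)$ for all $f\in C^\infty(M)$. Define, for $f\in C^\infty(M)$, \[ S_0f=\sigma(L_f),\quad T_0f=\sigma(R_f),\quad S_1f=\sigma\Big(\tfrac1\nu(L_f-\tilde L_f)\Big),\quad T_1f=\sigma\Big(\tfrac1\nu(R_f-\tilde R_f)\Big). \] Let $\{\cdot,\cdot\}_0$ be the Poisson bracket of $\pi_0$ and let $\{f,g\}_1=\big(C_2(f,g)-C_2(g,f)\big)-\big(\tilde C_2(f,g)-\tilde C_2(g,f)\big)$. Then for all $f,g\in C^\infty(M)$: (i) $E(S_1f)=0$ and $E(T_1f)=0$; (ii) $S_1(fg)=S_0f\,S_1g+S_1f\,S_0g$ and $T_1(fg)=T_0f\,T_1g+T_1f\,T_0g$; (iii) \begin{align*} S_1\{f,g\}_0+S_0\{f,g\}_1&=\{S_0f,S_1g\}_{T^*M}+\{S_1f,S_0g\}_{T^*M},\\ T_1\{f,g\}_0+T_0\{f,g\}_1&=-\{T_0f,T_1g\}_{T^*M}-\{T_1f,T_0g\}_{T^*M},\\ \{S_0f,T_1g\}_{T^*M}+\{S_1f,T_0g\}_{T^*M}&=0. \end{align*}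
   Context: $\nu$ is a formal parameter. A star product on a Poisson manifold $(M,\pi)$ with Poisson bracket $\{\cdot,\cdot\}$ is an associative $\nu$-linear product on $C^\infty(M)[[\nu]]$ of the form $f\ast g=\sum_{r\ge0}\nu^rC_r(f,g)$ with $C_r$ bidifferential operators, $C_0(f,g)=fg$, $C_1(f,g)-C_1(g,f)=\{f,g\}$, and with the constant $1$ as unity. It is natural if $C_r$ is of order at most $r$ in each argument for all $r$. The bidifferential operators of $\ast$ and $\tilde\ast$ are denoted $C_r$ and $\tilde C_r$. Left and right multiplication operators are defined by $L_fg=f\ast g=R_gf$ and $\tilde L_fg=f\,\tilde\ast\,g=\tilde R_gf$. A formal differential operator $A=A_0+\nu A_1+\nu^2A_2+\cdots$ on $M$ is natural if $A_r$ has order at most $r$ for every $r\ge0$; natural operators form an algebra $\mathcal N$. For a natural star product, $L_f,R_f\in\mathcal N$. Let $Z$ be the zero section of $T^*M$ and $C^\infty(T^*M,Z)=C^\infty(T^*M)/\bigcap_{l\ge1}I_Z^l$, where $I_Z$ is the ideal of functions vanishing on $Z$ (functions on the formal neighborhood of $Z$; elements are formal series of fibrewise homogeneous polynomials). The $\sigma$-symbol of $A\in\mathcal N$ is $\sigma(A)=\sum_{r\ge0}\mathrm{Symb}_r(A_r)\in C^\infty(T^*M,Z)$, where $\mathrm{Symb}_r(A_r)$ is the principal symbol of order $r$ ($\partial/\partial x^i\mapsto\xi_i$; zero if $A_r$ has order $<r$). The map $\sigma:\mathcal N\to C^\infty(T^*M,Z)$ is an algebra homomorphism with kernel $\nu\mathcal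 N$, so under the hypotheses $L_f-\tilde L_f$ and $R_f-\tilde R_f$ lie in $\nu\mathcal N$ and $S_1,T_1$ are well defined. $\{\cdot,\cdot\}_{T^*M}$ is the Poisson bracket of the standard symplectic structure on $T^*M$, with sign normalized so that $\sigma(\frac1\nu[A,B])=\{\sigma(A),\sigma(B)\}_{T^*M}$ for $A,B\in\mathcal N$ (i.e. $\{\xi_i,x^j\}_{T^*M}=\delta_i^j$). $E:C^\infty(T^*M,Z)\to C^\infty(M)$ is restriction to $Z\cong M$. The source and target mappings of the formal symplectic groupoid of a natural star product are $f\mapsto\sigma(L_f)$ and $f\mapsto\sigma(R_f)$; "the same formal symplectic groupoid" means that these mappings coincide. In this situation $\{\cdot,\cdot\}_1$ is given by a bivector field $\pi_1$ on $M$ which is a Poisson 2-cocycle: $[\pi_0,\pi_1]=0$. *)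

theory Defs
  imports
    "HOL-Analysis.Analysis"
    "HOL-Library.Function_Algebras"
    "HOL-Computational_Algebra.Formal_Power_Series"
begin

section \<open>Iterated partial derivatives and smooth maps\<close>

text \<open>A multi-index of order \<open>r\<close> is a word of length \<open>r\<close> of basis vectors; the word
  \<open>[b\<^sub>1, \<dots>, b\<^sub>r]\<close> stands for the partial derivatives in these directions.\<close>

primrec partial_deriv ::
  "'e::euclidean_space list \<Rightarrow> ('e \<Rightarrow> 'b::real_normed_vector) \<Rightarrow> 'e \<Rightarrow> 'b" where
  "partial_deriv [] f = f"
| "partial_deriv (b # w) f = (\<lambda>y. frechet_derivative (partial_deriv w f) (at y) b)"

definition words :: "nat \<Rightarrow> 'e::euclidean_space list set" where
  "words r = {w. set w \<subseteq> Basis \<and> length w \<le> r}"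

definition smooth_on :: "'e::euclidean_space set \<Rightarrow> ('e \<Rightarrow> 'b::real_normed_vector) \<Rightarrow> bool" where
  \<comment> \<open>used for open sets only\<close>
  "smooth_on S f \<longleftrightarrow> (\<forall>w. set w \<subseteq> Basis \<longrightarrow> partial_deriv w f differentiable_on S)"


section \<open>Smooth manifolds\<close>

text \<open>The manifold is the whole type \<open>'m\<close>. A chart is a pair of a domain and a
  coordinate map whose values outside the domain are irrelevant.\<close>

type_synonym ('m, 'e) chart = "'m set \<times> ('m \<Rightarrow> 'e)"

definition smooth_atlas ::
  "('m::{t2_space,second_countable_topology}, 'e::euclidean_space) chart set \<Rightarrow> bool" where
  "smooth_atlas \<A> \<longleftrightarrow>
     (\<forall>(U, \<phi>)\<in>\<A>. open U \<and> open (\<phi> ` U) \<and> homeomorphism U (\<phi> ` U) \<phi> (inv_into U \<phi>)) \<and>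
     (\<Union>(U, \<phi>)\<in>\<A>. U) = UNIV \<and>
     (\<forall>(U, \<phi>)\<in>\<A>. \<forall>(V, \<psi>)\<in>\<A>. smooth_on (\<phi> ` (U \<inter> V)) (\<psi> \<circ> inv_into U \<phi>))"

definition chart_at :: "('m, 'e) chart set \<Rightarrow> 'm \<Rightarrow> ('m, 'e) chart" where
  "chart_at \<A> x = (SOME c. c \<in> \<A> \<and> x \<in> fst c)"

definition smooth_functions :: "('m, 'e::euclidean_space) chart set \<Rightarrow> ('m \<Rightarrow> real) set" where
  "smooth_functions \<A> = {f. \<forall>(U, \<phi>)\<in>\<A>. smooth_on (\<phi> ` U) (f \<circ> inv_into U \<phi>)}"


section \<open>The cotangent bundle\<close>

text \<open>Tangent vectors are directional derivatives, set to 0 on functions that are not smooth,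
  and covectors are linear functionals on the tangent space, set to 0 outside of it, so that
  equality of functions is the intended equality.\<close>

type_synonym 'm tvector = "('m \<Rightarrow> real) \<Rightarrow> real"
type_synonym 'm covector = "'m tvector \<Rightarrow> real"

definition coord_vector ::
  "('m, 'e::euclidean_space) chart set \<Rightarrow> ('m, 'e) chart \<Rightarrow> 'm \<Rightarrow> 'e \<Rightarrow> 'm tvector" where
  "coord_vector \<A> = (\<lambda>(U, \<phi>) x u f.
     if f \<in> smooth_functions \<A>
     then frechet_derivative (f \<circ> inv_into U \<phi>) (at (\<phi> x)) u else 0)"

definition tangent_space ::
  "('m, 'e::euclidean_space) chart set \<Rightarrow> 'm \<Rightarrow> 'm tvector set" where
  "tangent_space \<A> x = {coord_vector \<A> c x u | c u. c \<in> \<A> \<and> x \<in> fst c}"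

definition cotangent_space ::
  "('m, 'e::euclidean_space) chart set \<Rightarrow> 'm \<Rightarrow> 'm covector set" where
  "cotangent_space \<A> x =
     {p. (\<forall>v\<in>tangent_space \<A> x. \<forall>w\<in>tangent_space \<A> x. p (v + w) = p v + p w) \<and>
         (\<forall>a. \<forall>v\<in>tangent_space \<A> x. p (\<lambda>f. a * v f) = a * p v) \<and>
         (\<forall>v. v \<notin> tangent_space \<A> x \<longrightarrow> p v = 0)}"

definition cotangent_bundle ::
  "('m, 'e::euclidean_space) chart set \<Rightarrow> ('m \<times> 'm covector) set" where
  "cotangent_bundle \<A> = (SIGMA x:UNIV. cotangent_space \<A> x)"

definition differential ::
  "('m, 'e::euclidean_space) chart set \<Rightarrow> ('m \<Rightarrow> real) \<Rightarrow> 'm \<Rightarrow> 'm covector" where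
  "differential \<A> f x = (\<lambda>v. if v \<in> tangent_space \<A> x then v f else 0)"

text \<open>Canonical coordinates on the cotangent bundle induced by a chart: the \<open>b\<close>-component of
  the second entry is the fibre coordinate \<open>\<xi>\<^sub>b\<close>, the value of the covector
  on \<open>\<partial>/\<partial>x\<^sup>b\<close>.\<close>

definition cot_chart ::
  "('m, 'e::euclidean_space) chart set \<Rightarrow> ('m, 'e) chart \<Rightarrow> 'm \<times> 'm covector \<Rightarrow> 'e \<times> 'e" where
  "cot_chart \<A> c = (\<lambda>(x, p). (snd c x, \<Sum>b\<in>Basis. p (coord_vector \<A> c x b) *\<^sub>R b))"

definition cot_chart_inv ::
  "('m, 'e::euclidean_space) chart set \<Rightarrow> ('m, 'e) chart \<Rightarrow> 'e \<times> 'e \<Rightarrow> 'm \<times> 'm covector" where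
  "cot_chart_inv \<A> c = inv_into (SIGMA x:fst c. cotangent_space \<A> x) (cot_chart \<A> c)"

text \<open>The Poisson bracket normalized by \<open>{\<xi>\<^sub>i, x\<^sup>j} = \<delta>\<^sub>i\<^sup>j\<close>. On smooth functions it does
  not depend on the canonical coordinates used.\<close>

definition cot_bracket ::
  "('m, 'e::euclidean_space) chart set \<Rightarrow> ('m \<times> 'm covector \<Rightarrow> real) \<Rightarrow>
   ('m \<times> 'm covector \<Rightarrow> real) \<Rightarrow> 'm \<times> 'm covector \<Rightarrow> real" where
  "cot_bracket \<A> P Q \<omega> =
     (if \<omega> \<in> cotangent_bundle \<A> then
        let c = chart_at \<A> (fst \<omega>);
            D = (\<lambda>F. frechet_derivative (F \<circ> cot_chart_inv \<A> c) (at (cot_chart \<A> c \<omega>)))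
        in \<Sum>b\<in>Basis. D P (0, b) * D Q (b, 0) - D P (b, 0) * D Q (0, b)
      else 0)"


section \<open>Functions on the formal neighbourhood of the zero section\<close>

text \<open>An element of \<open>C\<^sup>\<infinity>(T\<^sup>*M, Z)\<close> is a formal series of fibrewise homogeneous
  polynomials. It is represented by the formal power series whose coefficient of degree \<open>r\<close> is
  the component of fibre degree \<open>r\<close>, a function on the cotangent bundle (set to 0 outside of
  it). The product is then the product of power series with pointwise multiplication of
  coefficients.\<close>

type_synonym 'm formal_function = "('m \<times> 'm covector \<Rightarrow> real) fps"

text \<open>The bracket of components of degrees \<open>i\<close> and \<open>j\<close> has degree \<open>i + j - 1\<close>.\<close>

definition formal_bracket ::
  "('m, 'e::euclidean_space) chart set \<Rightarrow> 'm formal_function \<Rightarrow> 'm formal_function \<Rightarrow>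
   'm formal_function" where
  "formal_bracket \<A> P Q =
     Abs_fps (\<lambda>r. \<Sum>i\<le>Suc r. cot_bracket \<A> (fps_nth P i) (fps_nth Q (Suc r - i)))"

text \<open>Components of positive degree vanish on the zero section.\<close>

definition restrict_zero_section :: "'m formal_function \<Rightarrow> 'm \<Rightarrow> real" where
  "restrict_zero_section P x = fps_nth P 0 (x, \<lambda>_. 0)"


section \<open>Differential operators and their symbols\<close>

type_synonym 'm operator = "('m \<Rightarrow> real) \<Rightarrow> 'm \<Rightarrow> real"

text \<open>\<open>a\<close> is a family of smooth coefficients for \<open>D\<close> as a differential operator of order at
  most \<open>r\<close> in the given chart. Since partial derivatives commute, \<open>a\<close> is unique only up to
  symmetrization.\<close>

definition local_coeffs ::
  "('m, 'e::euclidean_space) chart set \<Rightarrow> ('m, 'e) chart \<Rightarrow> nat \<Rightarrow> 'm operator \<Rightarrow>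
   ('e list \<Rightarrow> 'e \<Rightarrow> real) \<Rightarrow> bool" where
  "local_coeffs \<A> = (\<lambda>(U, \<phi>) r D a.
     (\<forall>w\<in>words r. smooth_on (\<phi> ` U) (a w)) \<and>
     (\<forall>f\<in>smooth_functions \<A>. \<forall>x\<in>U.
        D f x = (\<Sum>w\<in>words r. a w (\<phi> x) * partial_deriv w (f \<circ> inv_into U \<phi>) (\<phi> x))))"

text \<open>The principal symbol of order \<open>r\<close> of an operator of order at most \<open>r\<close>.\<close>

definition principal_symbol ::
  "('m, 'e::euclidean_space) chart set \<Rightarrow> nat \<Rightarrow> 'm operator \<Rightarrow> 'm \<times> 'm covector \<Rightarrow> real" where
  "principal_symbol \<A> r D = (\<lambda>(x, p).
     if (x, p) \<in> cotangent_bundle \<A> then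
       let c = chart_at \<A> x; a = (SOME a. local_coeffs \<A> c r D a)
       in \<Sum>w | w \<in> words r \<and> length w = r.
            a w (snd c x) * prod_list (map (\<lambda>b. p (coord_vector \<A> c x b)) w)
     else 0)"

text \<open>A formal differential operator \<open>D\<^sub>0 + \<nu> D\<^sub>1 + \<nu>\<^sup>2 D\<^sub>2 + \<dots>\<close> is given by the sequence of
  its coefficients; the following is the \<open>\<sigma>\<close>-symbol of a natural one.\<close>

definition sigma_symbol ::
  "('m, 'e::euclidean_space) chart set \<Rightarrow> (nat \<Rightarrow> 'm operator) \<Rightarrow> 'm formal_function" where
  "sigma_symbol \<A> D = Abs_fps (\<lambda>r. principal_symbol \<A> r (D r))"

text \<open>Multiplication by \<open>1/\<nu>\<close>, applied only to operators whose coefficient of \<open>\<nu>\<^sup>0\<close> is zero.\<close>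

definition div_nu :: "(nat \<Rightarrow> 'm operator) \<Rightarrow> nat \<Rightarrow> 'm operator" where
  "div_nu D = (\<lambda>r. D (Suc r))"

type_synonym 'm bioperator = "('m \<Rightarrow> real) \<Rightarrow> ('m \<Rightarrow> real) \<Rightarrow> 'm \<Rightarrow> real"

text \<open>Bidifferential operators of order at most \<open>N\<close> in each argument.\<close>

definition bidiff_op ::
  "('m, 'e::euclidean_space) chart set \<Rightarrow> nat \<Rightarrow> 'm bioperator \<Rightarrow> bool" where
  "bidiff_op \<A> N B \<longleftrightarrow>
     (\<forall>f\<in>smooth_functions \<A>. \<forall>g\<in>smooth_functions \<A>. B f g \<in> smooth_functions \<A>) \<and>
     (\<forall>(U, \<phi>)\<in>\<A>. \<exists>a. (\<forall>v\<in>words N. \<forall>w\<in>words N. smooth_on (\<phi> ` U) (a v w)) \<and>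
        (\<forall>f\<in>smooth_functions \<A>. \<forall>g\<in>smooth_functions \<A>. \<forall>x\<in>U.
           B f g x = (\<Sum>v\<in>words N. \<Sum>w\<in>words N.
             a v w (\<phi> x) * partial_deriv v (f \<circ> inv_into U \<phi>) (\<phi> x)
                         * partial_deriv w (g \<circ> inv_into U \<phi>) (\<phi> x))))"


section \<open>Poisson manifolds\<close>

type_synonym 'm bivector = "'m \<Rightarrow> 'm covector \<Rightarrow> 'm covector \<Rightarrow> real"

text \<open>Smoothness of a bivector field refers to its components \<open>\<pi>(dx\<^sup>b, dx\<^sup>d)\<close>; the covector
  \<open>dx\<^sup>b\<close> at the point with coordinates \<open>y\<close> has canonical coordinates \<open>(y, b)\<close>.\<close>

definition bivector_field ::
  "('m, 'e::euclidean_space) chart set \<Rightarrow> 'm bivector \<Rightarrow> bool" where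
  "bivector_field \<A> \<pi> \<longleftrightarrow>
     (\<forall>x. \<forall>p\<in>cotangent_space \<A> x. \<forall>q\<in>cotangent_space \<A> x.
        \<pi> x p q = - \<pi> x q p \<and>
        (\<forall>p'\<in>cotangent_space \<A> x. \<pi> x (p + p') q = \<pi> x p q + \<pi> x p' q) \<and>
        (\<forall>a. \<pi> x (\<lambda>v. a * p v) q = a * \<pi> x p q)) \<and>
     (\<forall>(U, \<phi>)\<in>\<A>. \<forall>b\<in>Basis. \<forall>d\<in>Basis. smooth_on (\<phi> ` U) (\<lambda>y.
        \<pi> (inv_into U \<phi> y) (snd (cot_chart_inv \<A> (U, \<phi>) (y, b)))
                           (snd (cot_chart_inv \<A> (U, \<phi>) (y, d)))))"

definition poisson_bracket ::
  "('m, 'e::euclidean_space) chart set \<Rightarrow> 'm bivector \<Rightarrow> 'm bioperator" where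
  "poisson_bracket \<A> \<pi> f g = (\<lambda>x. \<pi> x (differential \<A> f x) (differential \<A> g x))"

text \<open>The condition \<open>[\<pi>, \<pi>] = 0\<close> is the Jacobi identity of the bracket.\<close>

definition poisson_manifold ::
  "('m::{t2_space,second_countable_topology}, 'e::euclidean_space) chart set \<Rightarrow>
   'm bivector \<Rightarrow> bool" where
  "poisson_manifold \<A> \<pi> \<longleftrightarrow> smooth_atlas \<A> \<and> bivector_field \<A> \<pi> \<and>
     (\<forall>f\<in>smooth_functions \<A>. \<forall>g\<in>smooth_functions \<A>. \<forall>h\<in>smooth_functions \<A>.
        poisson_bracket \<A> \<pi> f (poisson_bracket \<A> \<pi> g h) +
        poisson_bracket \<A> \<pi> g (poisson_bracket \<A> \<pi> h f) +
        poisson_bracket \<A> \<pi> h (poisson_bracket \<A> \<pi> f g) = 0)"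


section \<open>Star products\<close>

text \<open>A star product is given by its sequence of bidifferential operators; the induced
  \<open>\<nu>\<close>-linear product of formal functions in \<open>\<nu>\<close> is the following.\<close>

definition star_mult ::
  "(nat \<Rightarrow> 'm bioperator) \<Rightarrow> ('m \<Rightarrow> real) fps \<Rightarrow> ('m \<Rightarrow> real) fps \<Rightarrow> ('m \<Rightarrow> real) fps" where
  "star_mult C F G =
     Abs_fps (\<lambda>n. \<Sum>r\<le>n. \<Sum>i\<le>n - r. C r (fps_nth F i) (fps_nth G (n - r - i)))"

definition formal_smooth ::
  "('m, 'e::euclidean_space) chart set \<Rightarrow> ('m \<Rightarrow> real) fps set" where
  "formal_smooth \<A> = {F. \<forall>n. fps_nth F n \<in> smooth_functions \<A>}"

definition star_product ::
  "('m, 'e::euclidean_space) chart set \<Rightarrow> 'm bivector \<Rightarrow> (nat \<Rightarrow> 'm bioperator) \<Rightarrow> bool" where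
  "star_product \<A> \<pi> C \<longleftrightarrow>
     (\<forall>r. \<exists>N. bidiff_op \<A> N (C r)) \<and>
     (\<forall>f\<in>smooth_functions \<A>. \<forall>g\<in>smooth_functions \<A>. C 0 f g = f * g) \<and>
     (\<forall>f\<in>smooth_functions \<A>. \<forall>g\<in>smooth_functions \<A>.
        C 1 f g - C 1 g f = poisson_bracket \<A> \<pi> f g) \<and>
     (\<forall>F\<in>formal_smooth \<A>. \<forall>G\<in>formal_smooth \<A>. \<forall>H\<in>formal_smooth \<A>.
        star_mult C (star_mult C F G) H = star_mult C F (star_mult C G H)) \<and>
     (\<forall>F\<in>formal_smooth \<A>. star_mult C 1 F = F \<and> star_mult C F 1 = F)"

definition natural_star_product ::
  "('m, 'e::euclidean_space) chart set \<Rightarrow> 'm bivector \<Rightarrow> (nat \<Rightarrow> 'm bioperator) \<Rightarrow> bool" where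
  "natural_star_product \<A> \<pi> C \<longleftrightarrow> star_product \<A> \<pi> C \<and> (\<forall>r. bidiff_op \<A> r (C r))"

text \<open>The formal differential operators \<open>L\<^sub>f g = f \<star> g\<close> and \<open>R\<^sub>f g = g \<star> f\<close>.\<close>

definition left_mult :: "(nat \<Rightarrow> 'm bioperator) \<Rightarrow> ('m \<Rightarrow> real) \<Rightarrow> nat \<Rightarrow> 'm operator" where
  "left_mult C f = (\<lambda>r g. C r f g)"

definition right_mult :: "(nat \<Rightarrow> 'm bioperator) \<Rightarrow> ('m \<Rightarrow> real) \<Rightarrow> nat \<Rightarrow> 'm operator" where
  "right_mult C f = (\<lambda>r g. C r g f)"

definition source_map ::
  "('m, 'e::euclidean_space) chart set \<Rightarrow> (nat \<Rightarrow> 'm bioperator) \<Rightarrow> ('m \<Rightarrow> real) \<Rightarrow>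
   'm formal_function" where
  "source_map \<A> C f = sigma_symbol \<A> (left_mult C f)"

definition target_map ::
  "('m, 'e::euclidean_space) chart set \<Rightarrow> (nat \<Rightarrow> 'm bioperator) \<Rightarrow> ('m \<Rightarrow> real) \<Rightarrow>
   'm formal_function" where
  "target_map \<A> C f = sigma_symbol \<A> (right_mult C f)"

definition same_formal_groupoid ::
  "('m, 'e::euclidean_space) chart set \<Rightarrow> (nat \<Rightarrow> 'm bioperator) \<Rightarrow> (nat \<Rightarrow> 'm bioperator) \<Rightarrow>
   bool" where
  "same_formal_groupoid \<A> C C' \<longleftrightarrow> (\<forall>f\<in>smooth_functions \<A>.
     source_map \<A> C f = source_map \<A> C' f \<and> target_map \<A> C f = target_map \<A> C' f)"

definition source_deformation ::
  "('m, 'e::euclidean_space) chart set \<Rightarrow> (nat \<Rightarrow> 'm bioperator) \<Rightarrow> (nat \<Rightarrow> 'm bioperator) \<Rightarrow>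
   ('m \<Rightarrow> real) \<Rightarrow> 'm formal_function" where
  "source_deformation \<A> C C' f = sigma_symbol \<A> (div_nu (left_mult C f - left_mult C' f))"

definition target_deformation ::
  "('m, 'e::euclidean_space) chart set \<Rightarrow> (nat \<Rightarrow> 'm bioperator) \<Rightarrow> (nat \<Rightarrow> 'm bioperator) \<Rightarrow>
   ('m \<Rightarrow> real) \<Rightarrow> 'm formal_function" where
  "target_deformation \<A> C C' f = sigma_symbol \<A> (div_nu (right_mult C f - right_mult C' f))"

definition bracket_deformation ::
  "(nat \<Rightarrow> 'm bioperator) \<Rightarrow> (nat \<Rightarrow> 'm bioperator) \<Rightarrow> 'm bioperator" where
  "bracket_deformation C C' f g = (C 2 f g - C 2 g f) - (C' 2 f g - C' 2 g f)"

end

theory Submission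
  imports Defs
begin

text \<open>If \<open>p = dh\<close> at \<open>x\<close> and \<open>k = h - h(x)\<close>, the symbol of order \<open>r\<close> of an operator \<open>D\<close> of order
  at most \<open>r\<close> is \<open>D(k\<^sup>r)(x) / r!\<close> at \<open>(x, p)\<close>. Expanding \<open>B(k\<^sup>n)\<close> in powers of \<open>k\<close>, this shows that
  symbols are multiplicative and, if \<open>h\<close> is linear in the coordinates near \<open>x\<close>, that
  \<open>[A, B](k\<^sup>n)(x) / n!\<close> is the Poisson bracket of the symbols of \<open>A\<close> and \<open>B\<close> when their orders add up
  to \<open>n + 1\<close>. Two natural operators with the same symbol of order \<open>r + 1\<close> differ by an operator of
  order \<open>r\<close>; applied to the operators of order 1 this gives \<open>C\<^sub>1 = C'\<^sub>1\<close>, since these agree on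
  constants. The identities follow from associativity
  \<open>L\<^bsub>f \<star> g\<^esub> = L\<^sub>f L\<^sub>g\<close> and \<open>[L\<^sub>f, R\<^sub>g] = 0\<close>, applied to \<open>k\<^sup>n\<close> at \<open>x\<close>, by subtracting the corresponding
  identities of the other star product.\<close>


section \<open>Smooth functions on open sets\<close>

text \<open>Coefficients of an operator are neither unique nor tied to one chart, whereas its value
  on \<open>k^n\<close> at \<open>x\<close> is a number that depends on the operator alone. Every
  covector is the differential of a global smooth function, so such values reach the whole cotangent
  bundle. The index shifts come from division by \<open>\<nu>\<close>: degree \<open>n\<close> of a
  product is read off at \<open>\<nu>^(n+1)\<close>, degree \<open>n\<close> of a bracket at
  \<open>\<nu>^(n+2)\<close>, each time applied to \<open>k^n\<close>. Operators of order below
  \<open>n\<close> annihilate \<open>k^n\<close> at \<open>x\<close>, so the side of associativity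
  that contains \<open>f \<star> g\<close> keeps only two or three terms. Where an operator of order
  \<open>n\<close> meets \<open>k^n\<close>, it may be exchanged for that of the other star product,
  because the symbols agree; this is how \<open>{f, g}_1\<close> is isolated. Linearity of
  \<open>h\<close> keeps the components of \<open>dh\<close> constant near \<open>x\<close>. Moving
  the base point along \<open>dh\<close> is then the partial derivative of the symbol in the base
  direction, and no second derivatives of \<open>h\<close> interfere. The unit axiom gives the
  vanishing on the zero section as well as \<open>C\<^sub>1 = C'\<^sub>1\<close>. The identities for
  \<open>T\<close> are those for \<open>S\<close> of the opposite product.\<close>

lemma partial_deriv_append: "partial_deriv (v @ w) f = partial_deriv v (partial_deriv w f)"
  by (induction v) simp_all

text \<open>\<open>frechet_derivative\<close> chooses among all derivatives, so it depends only on
  which maps are derivatives at \<open>y\<close>; the equality also holds where none exists.\<close>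

lemma frechet_derivative_cong_open:
  assumes "open S" "y \<in> S" "\<And>z. z \<in> S \<Longrightarrow> f z = g z"
  shows "frechet_derivative f (at y) = frechet_derivative g (at y)"
proof -
  have "(f has_derivative D) (at y) \<longleftrightarrow> (g has_derivative D) (at y)" for D
    using assms by (metis has_derivative_transform_within_open)
  then show ?thesis
    unfolding frechet_derivative_def by simp
qed

lemma frechet_derivative_eqI: "(f has_derivative D) (at y) \<Longrightarrow> frechet_derivative f (at y) b = D b"
  using frechet_derivative_at by metis

lemma partial_deriv_cong_open:
  assumes "open S" "y \<in> S" "\<And>z. z \<in> S \<Longrightarrow> f z = g z"
  shows "partial_deriv w f y = partial_deriv w g y"
  using assms(2)
proof (induction w arbitrary: y)
  case (Cons b w)
  then show ?case
    using frechet_derivative_cong_open[OF assms(1) Cons.prems, of "partial_deriv w f" "partial_deriv w g"]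
    by simp
qed (use assms in simp)

lemma smooth_on_differentiable_at:
  assumes "open S" "smooth_on S f" "y \<in> S"
  shows "f differentiable at y"
proof -
  have "partial_deriv [] f differentiable_on S"
    using assms(2) unfolding smooth_on_def by (metis empty_set empty_subsetI)
  then show ?thesis
    using assms(1,3) by (simp add: differentiable_on_eq_differentiable_at)
qed

lemma smooth_on_has_derivative:
  assumes "open S" "smooth_on S f" "y \<in> S"
  shows "(f has_derivative frechet_derivative f (at y)) (at y)"
  using smooth_on_differentiable_at[OF assms] unfolding frechet_derivative_works .

lemma smooth_on_partial_deriv:
  assumes "smooth_on S f" "set w \<subseteq> Basis"
  shows "smooth_on S (partial_deriv w f)"
  unfolding smooth_on_def
proof (intro allI impI)
  fix v :: "'a list"
  assume "set v \<subseteq> Basis"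
  then have "partial_deriv (v @ w) f differentiable_on S"
    using assms unfolding smooth_on_def by simp
  then show "partial_deriv v (partial_deriv w f) differentiable_on S"
    unfolding partial_deriv_append .
qed

lemma smooth_on_frechet:
  assumes "smooth_on S f" "b \<in> Basis"
  shows "smooth_on S (\<lambda>y. frechet_derivative f (at y) b)"
proof -
  have "smooth_on S (partial_deriv [b] f)"
    using assms by (intro smooth_on_partial_deriv) auto
  then show ?thesis by simp
qed

text \<open>Coinduction up to finite sums, which lets the Leibniz and chain rules
  be applied only once.\<close>

lemma smooth_on_coinduct:
  assumes S: "open S" and "P f"
    and diff: "\<And>f y. P f \<Longrightarrow> y \<in> S \<Longrightarrow> f differentiable at y"
    and step: "\<And>f b. P f \<Longrightarrow> b \<in> Basis \<Longrightarrow>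
      \<exists>gs. (\<forall>g\<in>set gs. P g) \<and> (\<forall>y\<in>S. frechet_derivative f (at y) b = (\<Sum>g\<leftarrow>gs. g y))"
  shows "smooth_on S f"
proof -
  have "\<exists>gs. (\<forall>g\<in>set gs. P g) \<and> (\<forall>y\<in>S. partial_deriv w f y = (\<Sum>g\<leftarrow>gs. g y))"
    if "set w \<subseteq> Basis" for w
    using that
  proof (induction w)
    case Nil
    then show ?case using \<open>P f\<close> by (auto intro!: exI[of _ "[f]"])
  next
    case (Cons b w)
    then obtain gs where gs: "\<forall>g\<in>set gs. P g"
      "\<And>y. y \<in> S \<Longrightarrow> partial_deriv w f y = (\<Sum>g\<leftarrow>gs. g y)" and b: "b \<in> Basis"
      by auto
    obtain F where F: "\<And>g. g \<in> set gs \<Longrightarrow> (\<forall>h\<in>set (F g). P h) \<and>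
        (\<forall>y\<in>S. frechet_derivative g (at y) b = (\<Sum>h\<leftarrow>F g. h y))"
      using step[OF _ b] gs(1) by metis
    have D: "((\<lambda>z. \<Sum>g\<leftarrow>gs. g z) has_derivative (\<lambda>v. \<Sum>g\<leftarrow>gs. frechet_derivative g (at y) v)) (at y)"
      if "y \<in> S" for y
      using gs(1)
    proof (induction gs)
      case (Cons g gs)
      have "(g has_derivative frechet_derivative g (at y)) (at y)"
        using diff[of g y] Cons.prems that frechet_derivative_works by auto
      then show ?case
        using Cons by (auto intro!: has_derivative_add)
    qed simp
    have "partial_deriv (b # w) f y = (\<Sum>h\<leftarrow>concat (map F gs). h y)" if y: "y \<in> S" for y
    proof -
      have "partial_deriv (b # w) f y = frechet_derivative (\<lambda>z. \<Sum>g\<leftarrow>gs. g z) (at y) b"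
        using frechet_derivative_cong_open[OF S y gs(2)] by simp
      also have "\<dots> = (\<Sum>g\<leftarrow>gs. frechet_derivative g (at y) b)"
        using frechet_derivative_at[OF D[OF y]] by metis
      also have "\<dots> = (\<Sum>g\<leftarrow>gs. \<Sum>h\<leftarrow>F g. h y)"
        using F y by (intro arg_cong[where f = sum_list] map_cong) auto
      also have "\<dots> = (\<Sum>h\<leftarrow>concat (map F gs). h y)"
        by (induction gs) auto
      finally show ?thesis .
    qed
    moreover have "\<forall>h\<in>set (concat (map F gs)). P h"
      using F by auto
    ultimately show ?case by blast
  qed note rep = this
  show ?thesis
    unfolding smooth_on_def
  proof (intro allI impI)
    fix w :: "'a list"
    assume w: "set w \<subseteq> Basis"
    obtain gs where gs: "\<forall>g\<in>set gs. P g"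
      "\<And>y. y \<in> S \<Longrightarrow> partial_deriv w f y = (\<Sum>g\<leftarrow>gs. g y)"
      using rep[OF w] by blast
    have "(\<lambda>z. \<Sum>g\<leftarrow>gs. g z) differentiable at y" if "y \<in> S" for y
      using gs(1)
    proof (induction gs)
      case (Cons g gs)
      then show ?case using diff[OF _ that] by simp
    qed simp
    note sum_diff = this
    have "partial_deriv w f differentiable at y" if y: "y \<in> S" for y
    proof -
      from sum_diff[OF y] obtain D where "((\<lambda>z. \<Sum>g\<leftarrow>gs. g z) has_derivative D) (at y)"
        unfolding differentiable_def by blast
      then have "(partial_deriv w f has_derivative D) (at y)"
        by (rule has_derivative_transform_within_open[OF _ S y]) (simp add: gs(2))
      then show ?thesis
        unfolding differentiable_def by blast
    qed
    then show "partial_deriv w f differentiable_on S"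
      using differentiable_at_imp_differentiable_on by blast
  qed
qed

lemma smooth_on_cong:
  assumes "open S" "smooth_on S f" "\<And>y. y \<in> S \<Longrightarrow> f y = g y"
  shows "smooth_on S g"
  unfolding smooth_on_def
proof (intro allI impI)
  fix w :: "'a list"
  assume "set w \<subseteq> Basis"
  then have "partial_deriv w f differentiable_on S"
    using assms unfolding smooth_on_def by blast
  moreover have "partial_deriv w f y = partial_deriv w g y" if "y \<in> S" for y
    using partial_deriv_cong_open[of S y f g] assms(1,3) that by blast
  ultimately show "partial_deriv w g differentiable_on S"
    unfolding differentiable_on_def
    by (meson differentiable_transform_within zero_less_one)
qed

text \<open>Differentiability of each iterated derivative is a condition at single points. This
  glues functions given by different formulas on different open sets, such as a cut-off function
  extended by 0.\<close>

lemma smooth_on_locally: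
  assumes "\<And>y. y \<in> S \<Longrightarrow> \<exists>T. open T \<and> y \<in> T \<and> smooth_on T f"
  shows "smooth_on S f"
  unfolding smooth_on_def differentiable_on_def
proof (intro allI impI ballI)
  fix w :: "'a list" and y
  assume w: "set w \<subseteq> Basis" and "y \<in> S"
  then obtain T where "open T" "y \<in> T" "smooth_on T f"
    using assms by blast
  then have "partial_deriv w f differentiable at y"
    using smooth_on_differentiable_at smooth_on_partial_deriv w by blast
  then show "partial_deriv w f differentiable at y within S"
    using differentiable_at_withinI by blast
qed

lemma smooth_on_const [simp]: "open S \<Longrightarrow> smooth_on S (\<lambda>_. c)"
  by (rule smooth_on_coinduct[where P = "\<lambda>f. \<exists>c. f = (\<lambda>_. c)"]) (auto intro!: exI[of _ "[]"])

lemma smooth_on_affine: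
  assumes "open S"
  shows "smooth_on S (\<lambda>y. y \<bullet> \<xi> + c)"
proof (rule smooth_on_coinduct[where P = "\<lambda>f. \<exists>\<xi> c. f = (\<lambda>y. y \<bullet> \<xi> + c)", OF assms])
  fix f :: "'a \<Rightarrow> real" and b
  assume "\<exists>\<xi> c. f = (\<lambda>y. y \<bullet> \<xi> + c)"
  then obtain \<xi> c where f: "f = (\<lambda>y. y \<bullet> \<xi> + c)" by blast
  have "(f has_derivative (\<lambda>v. v \<bullet> \<xi>)) (at y)" for y
    unfolding f by (auto intro!: derivative_eq_intros)
  \<comment> \<open>The summand is a constant, written with zero slope so that it stays in the class
    of affine functions.\<close>
  then have "frechet_derivative f (at y) b = (\<Sum>g\<leftarrow>[\<lambda>y. y \<bullet> 0 + b \<bullet> \<xi>]. g y)" for y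
    using frechet_derivative_eqI by fastforce
  then show "\<exists>gs. (\<forall>g\<in>set gs. \<exists>\<xi> c. g = (\<lambda>y. y \<bullet> \<xi> + c)) \<and>
      (\<forall>y\<in>S. frechet_derivative f (at y) b = (\<Sum>g\<leftarrow>gs. g y))"
    by (intro exI[of _ "[\<lambda>y. y \<bullet> 0 + b \<bullet> \<xi>]"] conjI ballI) (auto simp only: list.set empty_iff insert_iff)
qed auto

lemma smooth_on_add:
  assumes S: "open S" and "smooth_on S f" "smooth_on S g"
  shows "smooth_on S (\<lambda>y. f y + g y)"
proof (rule smooth_on_coinduct[where P = "\<lambda>h. \<exists>f g. smooth_on S f \<and> smooth_on S g \<and> h = (\<lambda>y. f y + g y)",
      OF assms(1)])
  fix h :: "'a \<Rightarrow> 'b" and b :: 'a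
  assume "\<exists>f g. smooth_on S f \<and> smooth_on S g \<and> h = (\<lambda>y. f y + g y)" and b: "b \<in> Basis"
  then obtain f g where h: "smooth_on S f" "smooth_on S g" "h = (\<lambda>y. f y + g y)" by blast
  have "(h has_derivative (\<lambda>v. frechet_derivative f (at y) v + frechet_derivative g (at y) v)) (at y)"
    if "y \<in> S" for y
    unfolding h(3) using h that assms(1)
    by (intro has_derivative_add smooth_on_has_derivative[where S = S])
  then have "frechet_derivative h (at y) b =
      (\<Sum>g\<leftarrow>[\<lambda>y. frechet_derivative f (at y) b + frechet_derivative g (at y) b]. g y)" if "y \<in> S" for y
    using frechet_derivative_eqI[of h _ y b] that by fastforce
  then show "\<exists>gs. (\<forall>k\<in>set gs. \<exists>f g. smooth_on S f \<and> smooth_on S g \<and> k = (\<lambda>y. f y + g y)) \<and>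
      (\<forall>y\<in>S. frechet_derivative h (at y) b = (\<Sum>g\<leftarrow>gs. g y))"
    using smooth_on_frechet[OF h(1) b] smooth_on_frechet[OF h(2) b]
    by (intro exI[of _ "[\<lambda>y. frechet_derivative f (at y) b + frechet_derivative g (at y) b]"]) auto
qed (use assms smooth_on_differentiable_at[OF S] in \<open>auto intro!: differentiable_add\<close>)

lemma frechet_derivative_mult:
  fixes f g :: "'a::euclidean_space \<Rightarrow> real"
  assumes "f differentiable at y" "g differentiable at y"
  shows "frechet_derivative (\<lambda>y. f y * g y) (at y) b =
    frechet_derivative f (at y) b * g y + f y * frechet_derivative g (at y) b"
proof -
  have "((\<lambda>y. f y * g y) has_derivative
      (\<lambda>v. f y * frechet_derivative g (at y) v + frechet_derivative f (at y) v * g y)) (at y)"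
    using assms frechet_derivative_works by (intro has_derivative_mult) blast+
  then show ?thesis
    using frechet_derivative_eqI by fastforce
qed

lemma smooth_on_mult:
  fixes f g :: "'a::euclidean_space \<Rightarrow> real"
  assumes S: "open S" and "smooth_on S f" "smooth_on S g"
  shows "smooth_on S (\<lambda>y. f y * g y)"
proof (rule smooth_on_coinduct[where P = "\<lambda>h. \<exists>f g. smooth_on S f \<and> smooth_on S g \<and> h = (\<lambda>y. f y * g y)",
      OF S])
  fix h :: "'a \<Rightarrow> real" and b :: 'a
  assume "\<exists>f g. smooth_on S f \<and> smooth_on S g \<and> h = (\<lambda>y. f y * g y)" and b: "b \<in> Basis"
  then obtain f g where h: "smooth_on S f" "smooth_on S g" "h = (\<lambda>y. f y * g y)" by blast
  have "frechet_derivative h (at y) b =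
      (\<Sum>g\<leftarrow>[\<lambda>y. frechet_derivative f (at y) b * g y, \<lambda>y. f y * frechet_derivative g (at y) b]. g y)"
    if "y \<in> S" for y
    unfolding h(3) using smooth_on_differentiable_at[OF S] h that
    by (subst frechet_derivative_mult) auto
  then show "\<exists>gs. (\<forall>k\<in>set gs. \<exists>f g. smooth_on S f \<and> smooth_on S g \<and> k = (\<lambda>y. f y * g y)) \<and>
      (\<forall>y\<in>S. frechet_derivative h (at y) b = (\<Sum>g\<leftarrow>gs. g y))"
    using smooth_on_frechet[OF h(1) b] smooth_on_frechet[OF h(2) b] h(1,2)
    by (intro exI[of _ "[\<lambda>y. frechet_derivative f (at y) b * g y, \<lambda>y. f y * frechet_derivative g (at y) b]"]) auto
qed (use assms smooth_on_differentiable_at[OF S] in \<open>auto intro!: differentiable_mult\<close>)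

lemma smooth_on_cmult:
  fixes f :: "'a::euclidean_space \<Rightarrow> real"
  assumes "open S" "smooth_on S f"
  shows "smooth_on S (\<lambda>y. c * f y)"
  using smooth_on_mult[OF assms(1) smooth_on_const[OF assms(1)] assms(2)] .

lemma smooth_on_sum:
  fixes f :: "'i \<Rightarrow> 'a::euclidean_space \<Rightarrow> 'b::real_normed_vector"
  assumes "open S" "\<And>i. i \<in> I \<Longrightarrow> smooth_on S (f i)"
  shows "smooth_on S (\<lambda>y. \<Sum>i\<in>I. f i y)"
  using assms(2)
proof (induction I rule: infinite_finite_induct)
  case (insert i I)
  then show ?case using smooth_on_add[OF assms(1), of "f i"] by simp
qed (use assms in simp_all)

lemma smooth_on_power:
  fixes f :: "'a::euclidean_space \<Rightarrow> real"
  assumes "open S" "smooth_on S f"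
  shows "smooth_on S (\<lambda>y. f y ^ n)"
proof (induction n)
  case (Suc n)
  then show ?case
    using smooth_on_mult[OF assms Suc] by simp
qed (simp add: assms)

lemma smooth_on_inner:
  assumes S: "open S" and "smooth_on S \<tau>"
  shows "smooth_on S (\<lambda>y. \<tau> y \<bullet> d)"
proof (rule smooth_on_coinduct[where P = "\<lambda>h. \<exists>\<tau>. smooth_on S \<tau> \<and> h = (\<lambda>y. \<tau> y \<bullet> d)", OF S])
  fix h :: "'a \<Rightarrow> real" and b :: 'a
  assume "\<exists>\<tau>. smooth_on S \<tau> \<and> h = (\<lambda>y. \<tau> y \<bullet> d)" and b: "b \<in> Basis"
  then obtain \<tau> where h: "smooth_on S \<tau>" "h = (\<lambda>y. \<tau> y \<bullet> d)" by blast
  have "(h has_derivative (\<lambda>v. frechet_derivative \<tau> (at y) v \<bullet> d)) (at y)" if "y \<in> S" for y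
    unfolding h(2) using smooth_on_has_derivative[OF S h(1) that]
    by (rule has_derivative_inner_left)
  then have "frechet_derivative h (at y) b = (\<Sum>g\<leftarrow>[\<lambda>y. frechet_derivative \<tau> (at y) b \<bullet> d]. g y)"
    if "y \<in> S" for y
    using frechet_derivative_eqI[of h _ y b] that by fastforce
  then show "\<exists>gs. (\<forall>k\<in>set gs. \<exists>\<tau>. smooth_on S \<tau> \<and> k = (\<lambda>y. \<tau> y \<bullet> d)) \<and>
      (\<forall>y\<in>S. frechet_derivative h (at y) b = (\<Sum>g\<leftarrow>gs. g y))"
    using smooth_on_frechet[OF h(1) b]
    by (intro exI[of _ "[\<lambda>y. frechet_derivative \<tau> (at y) b \<bullet> d]"]) auto
qed (use assms smooth_on_differentiable_at[OF S] in \<open>auto intro!: differentiable_inner\<close>)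

lemma linear_euclidean_expand:
  assumes "linear L"
  shows "L v = (\<Sum>d\<in>Basis. (v \<bullet> d) *\<^sub>R L d)"
proof -
  have "L v = L (\<Sum>d\<in>Basis. (v \<bullet> d) *\<^sub>R d)"
    by (simp add: euclidean_representation)
  also have "\<dots> = (\<Sum>d\<in>Basis. (v \<bullet> d) *\<^sub>R L d)"
    by (simp add: linear_sum[OF assms] linear_cmul[OF assms] del: euclidean_representation)
  finally show ?thesis .
qed

lemma frechet_derivative_compose_basis:
  fixes H :: "'d::euclidean_space \<Rightarrow> real" and \<tau> :: "'a::euclidean_space \<Rightarrow> 'd"
  assumes "H differentiable at (\<tau> y)" "\<tau> differentiable at y"
  shows "frechet_derivative (\<lambda>y. H (\<tau> y)) (at y) b =
    (\<Sum>d\<in>Basis. (frechet_derivative \<tau> (at y) b \<bullet> d) * frechet_derivative H (at (\<tau> y)) d)"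
proof -
  have "frechet_derivative (\<lambda>y. H (\<tau> y)) (at y) b =
      frechet_derivative H (at (\<tau> y)) (frechet_derivative \<tau> (at y) b)"
    using frechet_derivative_compose[of \<tau> y H] assms by (simp add: o_def)
  also have "\<dots> = (\<Sum>d\<in>Basis. (frechet_derivative \<tau> (at y) b \<bullet> d) * frechet_derivative H (at (\<tau> y)) d)"
    by (subst linear_euclidean_expand[OF linear_frechet_derivative[OF assms(1)]]) simp
  finally show ?thesis .
qed

text \<open>Products \<open>u * (H \<circ> \<tau>)\<close> with \<open>u\<close> smooth are closed
  under differentiation up to sums: the chain rule produces components of the derivative of
  \<open>\<tau>\<close>, which are absorbed into \<open>u\<close>, and a derivative of
  \<open>H\<close>. The bare composition is the case \<open>u = 1\<close>.\<close>

lemma smooth_on_compose: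
  fixes H :: "'d::euclidean_space \<Rightarrow> real" and \<tau> :: "'a::euclidean_space \<Rightarrow> 'd"
  assumes S: "open S" and T: "open T" and \<tau>: "smooth_on S \<tau>" and "smooth_on T H" and sub: "\<tau> ` S \<subseteq> T"
  shows "smooth_on S (\<lambda>y. H (\<tau> y))"
proof (rule smooth_on_coinduct[where
      P = "\<lambda>h. \<exists>u H. smooth_on S u \<and> smooth_on T H \<and> h = (\<lambda>y. u y * H (\<tau> y))", OF S])
  show "\<exists>u H'. smooth_on S u \<and> smooth_on T H' \<and> (\<lambda>y. H (\<tau> y)) = (\<lambda>y. u y * H' (\<tau> y))"
    using S assms(4) by (intro exI[of _ "\<lambda>_. 1"] exI[of _ H]) auto
next
  fix h :: "'a \<Rightarrow> real" and b :: 'a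
  assume "\<exists>u H. smooth_on S u \<and> smooth_on T H \<and> h = (\<lambda>y. u y * H (\<tau> y))" and b: "b \<in> Basis"
  then obtain u H where h: "smooth_on S u" "smooth_on T H" "h = (\<lambda>y. u y * H (\<tau> y))" by blast
  obtain ds :: "'d list" where ds: "set ds = Basis" "distinct ds"
    using finite_distinct_list[OF finite_Basis] by blast
  let ?gs = "(\<lambda>y. frechet_derivative u (at y) b * H (\<tau> y)) #
    map (\<lambda>d y. (u y * (frechet_derivative \<tau> (at y) b \<bullet> d)) * frechet_derivative H (at (\<tau> y)) d) ds"
  have "frechet_derivative h (at y) b = (\<Sum>g\<leftarrow>?gs. g y)" if y: "y \<in> S" for y
  proof -
    have diff: "u differentiable at y" "\<tau> differentiable at y" "H differentiable at (\<tau> y)"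
      using smooth_on_differentiable_at S T h \<tau> y sub by blast+
    moreover have "(\<lambda>y. H (\<tau> y)) differentiable at y"
      using differentiable_compose[of H \<tau> y UNIV] diff by (simp add: differentiable_at_withinI)
    ultimately have "frechet_derivative h (at y) b = frechet_derivative u (at y) b * H (\<tau> y) +
        u y * (\<Sum>d\<in>Basis. (frechet_derivative \<tau> (at y) b \<bullet> d) * frechet_derivative H (at (\<tau> y)) d)"
      unfolding h(3) by (simp add: frechet_derivative_mult frechet_derivative_compose_basis)
    also have "\<dots> = (\<Sum>g\<leftarrow>?gs. g y)"
      by (simp add: sum_list_distinct_conv_sum_set[OF ds(2)] ds(1) o_def sum_distrib_left mult.assoc)
    finally show ?thesis .
  qed
  moreover have "\<forall>k\<in>set ?gs. \<exists>u H. smooth_on S u \<and> smooth_on T H \<and> k = (\<lambda>y. u y * H (\<tau> y))"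
  proof -
    have "smooth_on S (\<lambda>y. u y * (frechet_derivative \<tau> (at y) b \<bullet> d))" for d
      using smooth_on_mult[OF S h(1) smooth_on_inner[OF S smooth_on_frechet[OF \<tau> b]]] .
    moreover have "smooth_on T (\<lambda>z. frechet_derivative H (at z) d)" if "d \<in> Basis" for d
      using smooth_on_frechet[OF h(2) that] .
    ultimately have "\<exists>u' H'. smooth_on S u' \<and> smooth_on T H' \<and>
        (\<lambda>y. (u y * (frechet_derivative \<tau> (at y) b \<bullet> d)) * frechet_derivative H (at (\<tau> y)) d) =
        (\<lambda>y. u' y * H' (\<tau> y))" if "d \<in> Basis" for d
      using that by (intro exI[of _ "\<lambda>y. u y * (frechet_derivative \<tau> (at y) b \<bullet> d)"]
        exI[of _ "\<lambda>z. frechet_derivative H (at z) d"]) simp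
    moreover have "\<exists>u' H'. smooth_on S u' \<and> smooth_on T H' \<and>
        (\<lambda>y. frechet_derivative u (at y) b * H (\<tau> y)) = (\<lambda>y. u' y * H' (\<tau> y))"
      using smooth_on_frechet[OF h(1) b] h(2)
      by (intro exI[of _ "\<lambda>y. frechet_derivative u (at y) b"] exI[of _ H]) simp
    ultimately show ?thesis
      by (simp add: ds(1))
  qed
  ultimately show "\<exists>gs. (\<forall>k\<in>set gs. \<exists>u H. smooth_on S u \<and> smooth_on T H \<and> k = (\<lambda>y. u y * H (\<tau> y))) \<and>
      (\<forall>y\<in>S. frechet_derivative h (at y) b = (\<Sum>g\<leftarrow>gs. g y))"
    by blast
next
  fix h :: "'a \<Rightarrow> real" and y
  assume "\<exists>u H. smooth_on S u \<and> smooth_on T H \<and> h = (\<lambda>y. u y * H (\<tau> y))" and y: "y \<in> S"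
  then obtain u H where h: "smooth_on S u" "smooth_on T H" "h = (\<lambda>y. u y * H (\<tau> y))" by blast
  have diff: "u differentiable at y" "\<tau> differentiable at y" "H differentiable at (\<tau> y)"
    using smooth_on_differentiable_at S T h \<tau> y sub by blast+
  then have "(\<lambda>y. H (\<tau> y)) differentiable at y"
    using differentiable_compose[of H \<tau> y UNIV] by (simp add: differentiable_at_withinI)
  then show "h differentiable at y"
    unfolding h(3) using diff by (intro differentiable_mult)
qed

section \<open>Symmetry of second derivatives\<close>

text \<open>The second difference is an increment of
  \<open>t \<mapsto> f (y + t a + s b) - f (y + t a)\<close>. By the mean value theorem it is
  \<open>s\<close> times a difference of two values of the derivative in direction \<open>a\<close>.
  Each value differs from its linear approximation at \<open>y\<close> by at most
  \<open>\<epsilon> s (norm a + norm b)\<close>, which accounts for the factor 2.\<close>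

lemma second_difference_estimate:
  fixes f :: "'a::euclidean_space \<Rightarrow> real"
  assumes f: "\<And>z. z \<in> S \<Longrightarrow> f differentiable at z" and A: "linear A"
    and est: "\<And>h. norm h < \<delta> \<Longrightarrow> y + h \<in> S \<and>
      \<bar>frechet_derivative f (at (y + h)) a - frechet_derivative f (at y) a - A h\<bar> \<le> \<epsilon> * norm h"
    and s: "0 < s" "s * (norm a + norm b) < \<delta>" and \<epsilon>: "0 \<le> \<epsilon>"
  shows "\<bar>f (y + s *\<^sub>R a + s *\<^sub>R b) - f (y + s *\<^sub>R a) - f (y + s *\<^sub>R b) + f y - s\<^sup>2 * A b\<bar>
    \<le> 2 * \<epsilon> * s\<^sup>2 * (norm a + norm b)"
proof -
  define g where "g z = frechet_derivative f (at z) a" for z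
  have bound: "norm (t *\<^sub>R a + r *\<^sub>R b) \<le> s * (norm a + norm b)"
    if "0 \<le> t" "t \<le> s" "0 \<le> r" "r \<le> s" for t r
  proof -
    have "norm (t *\<^sub>R a + r *\<^sub>R b) \<le> t * norm a + r * norm b"
      using norm_triangle_ineq[of "t *\<^sub>R a" "r *\<^sub>R b"] that by simp
    also have "\<dots> \<le> s * norm a + s * norm b"
      using that by (intro add_mono mult_right_mono) auto
    finally show ?thesis by (simp add: algebra_simps)
  qed
  have der: "((\<lambda>t. f (y + t *\<^sub>R a + r *\<^sub>R b)) has_real_derivative g (y + t *\<^sub>R a + r *\<^sub>R b)) (at t)"
    if "0 \<le> t" "t \<le> s" "0 \<le> r" "r \<le> s" for t r
  proof -
    have "y + (t *\<^sub>R a + r *\<^sub>R b) \<in> S"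
      using est[of "t *\<^sub>R a + r *\<^sub>R b"] bound[OF that] s by auto
    then have D: "(f has_derivative frechet_derivative f (at (y + t *\<^sub>R a + r *\<^sub>R b))) (at (y + t *\<^sub>R a + r *\<^sub>R b))"
      using f frechet_derivative_works by (metis add.assoc)
    have "((\<lambda>t. y + t *\<^sub>R a + r *\<^sub>R b) has_derivative (\<lambda>h. h *\<^sub>R a)) (at t)"
      by (auto intro!: derivative_eq_intros)
    from has_derivative_compose[OF this D]
    have "((\<lambda>t. f (y + t *\<^sub>R a + r *\<^sub>R b)) has_derivative
        (\<lambda>h. frechet_derivative f (at (y + t *\<^sub>R a + r *\<^sub>R b)) (h *\<^sub>R a))) (at t)" .
    moreover have "frechet_derivative f (at (y + t *\<^sub>R a + r *\<^sub>R b)) (h *\<^sub>R a) =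
        g (y + t *\<^sub>R a + r *\<^sub>R b) * h" for h
      using has_derivative_linear[OF D] unfolding g_def by (simp add: linear_cmul)
    ultimately show ?thesis
      by (simp add: has_field_derivative_def)
  qed
  define \<phi> where "\<phi> t = f (y + t *\<^sub>R a + s *\<^sub>R b) - f (y + t *\<^sub>R a + 0 *\<^sub>R b)" for t
  have "\<exists>\<theta>. 0 < \<theta> \<and> \<theta> < s \<and>
      \<phi> s - \<phi> 0 = (s - 0) * (g (y + \<theta> *\<^sub>R a + s *\<^sub>R b) - g (y + \<theta> *\<^sub>R a + 0 *\<^sub>R b))"
    unfolding \<phi>_def using s
    by (intro MVT2 DERIV_diff der) auto
  then obtain \<theta> where \<theta>: "0 < \<theta>" "\<theta> < s"
    "\<phi> s - \<phi> 0 = s * (g (y + (\<theta> *\<^sub>R a + s *\<^sub>R b)) - g (y + \<theta> *\<^sub>R a))"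
    by (auto simp: add.assoc)
  have "norm (\<theta> *\<^sub>R a + s *\<^sub>R b) \<le> s * (norm a + norm b)" "norm (\<theta> *\<^sub>R a) \<le> s * (norm a + norm b)"
    using bound[of \<theta> s] bound[of \<theta> 0] \<theta> s(1) by auto
  then have e1: "\<bar>g (y + (\<theta> *\<^sub>R a + s *\<^sub>R b)) - g y - A (\<theta> *\<^sub>R a + s *\<^sub>R b)\<bar> \<le> \<epsilon> * (s * (norm a + norm b))"
    and e2: "\<bar>g (y + \<theta> *\<^sub>R a) - g y - A (\<theta> *\<^sub>R a)\<bar> \<le> \<epsilon> * (s * (norm a + norm b))"
    using est[of "\<theta> *\<^sub>R a + s *\<^sub>R b"] est[of "\<theta> *\<^sub>R a"] s mult_left_mono[OF _ \<epsilon>] unfolding g_def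
    by (meson order.strict_trans1 order_trans)+
  have Ab: "A (\<theta> *\<^sub>R a + s *\<^sub>R b) - A (\<theta> *\<^sub>R a) = s * A b"
    by (simp add: linear_add[OF A] linear_cmul[OF A])
  have "\<bar>g (y + (\<theta> *\<^sub>R a + s *\<^sub>R b)) - g (y + \<theta> *\<^sub>R a) - s * A b\<bar> \<le> 2 * (\<epsilon> * (s * (norm a + norm b)))"
    using e1 e2 Ab by linarith
  then have "s * \<bar>g (y + (\<theta> *\<^sub>R a + s *\<^sub>R b)) - g (y + \<theta> *\<^sub>R a) - s * A b\<bar>
      \<le> s * (2 * (\<epsilon> * (s * (norm a + norm b))))"
    using s(1) by (intro mult_left_mono) auto
  moreover have "s * \<bar>g (y + (\<theta> *\<^sub>R a + s *\<^sub>R b)) - g (y + \<theta> *\<^sub>R a) - s * A b\<bar> =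
      \<bar>\<phi> s - \<phi> 0 - s\<^sup>2 * A b\<bar>"
    unfolding \<theta>(3) using s(1) by (simp add: abs_mult_pos' algebra_simps power2_eq_square)
  ultimately show ?thesis
    by (simp add: \<phi>_def power2_eq_square algebra_simps)
qed

lemma has_derivative_remainder:
  fixes g :: "'a::euclidean_space \<Rightarrow> real"
  assumes "(g has_derivative A) (at y)" "0 < \<epsilon>"
  obtains \<delta> where "0 < \<delta>" "\<And>h. norm h < \<delta> \<Longrightarrow> \<bar>g (y + h) - g y - A h\<bar> \<le> \<epsilon> * norm h"
proof -
  obtain \<delta> where "0 < \<delta>" "\<And>z. norm (z - y) < \<delta> \<Longrightarrow> norm (g z - g y - A (z - y)) \<le> \<epsilon> * norm (z - y)"
    using assms unfolding has_derivative_at_alt by blast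
  then show thesis
    using that[of \<delta>] by (metis add_diff_cancel_left' real_norm_def)
qed

text \<open>The second difference is unchanged when \<open>a\<close> and \<open>b\<close> are
  exchanged, so \<open>s\<^sup>2 * A b\<close> and \<open>s\<^sup>2 * B a\<close> approximate the
  same number; dividing by \<open>s\<^sup>2\<close> leaves an arbitrarily small bound.\<close>

lemma frechet_derivative_commute:
  fixes f :: "'a::euclidean_space \<Rightarrow> real"
  assumes S: "open S" "y \<in> S" and f: "\<And>z. z \<in> S \<Longrightarrow> f differentiable at z"
    and ga: "(\<lambda>z. frechet_derivative f (at z) a) differentiable at y"
    and gb: "(\<lambda>z. frechet_derivative f (at z) b) differentiable at y"
  shows "frechet_derivative (\<lambda>z. frechet_derivative f (at z) a) (at y) b =
    frechet_derivative (\<lambda>z. frechet_derivative f (at z) b) (at y) a"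
proof -
  define A where "A = frechet_derivative (\<lambda>z. frechet_derivative f (at z) a) (at y)"
  define B where "B = frechet_derivative (\<lambda>z. frechet_derivative f (at z) b) (at y)"
  have A: "((\<lambda>z. frechet_derivative f (at z) a) has_derivative A) (at y)"
    and B: "((\<lambda>z. frechet_derivative f (at z) b) has_derivative B) (at y)"
    using ga gb frechet_derivative_works A_def B_def by auto
  define N where "N = norm a + norm b"
  have est: "\<bar>A b - B a\<bar> \<le> 4 * \<epsilon> * N" if \<epsilon>: "0 < \<epsilon>" for \<epsilon>
  proof -
    obtain \<delta>1 where \<delta>1: "0 < \<delta>1" "\<And>h. norm h < \<delta>1 \<Longrightarrow>
        \<bar>frechet_derivative f (at (y + h)) a - frechet_derivative f (at y) a - A h\<bar> \<le> \<epsilon> * norm h"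
      using has_derivative_remainder[OF A \<epsilon>] by blast
    obtain \<delta>2 where \<delta>2: "0 < \<delta>2" "\<And>h. norm h < \<delta>2 \<Longrightarrow>
        \<bar>frechet_derivative f (at (y + h)) b - frechet_derivative f (at y) b - B h\<bar> \<le> \<epsilon> * norm h"
      using has_derivative_remainder[OF B \<epsilon>] by blast
    obtain \<delta>3 where \<delta>3: "0 < \<delta>3" "\<And>z. dist z y < \<delta>3 \<Longrightarrow> z \<in> S"
      using S unfolding open_dist by blast
    define \<delta> where "\<delta> = min \<delta>1 (min \<delta>2 \<delta>3)"
    \<comment> \<open>The factor 2 makes \<open>s * N < \<delta>\<close> strict, and the summand 1
      covers \<open>N = 0\<close>.\<close>
    define s where "s = \<delta> / (2 * (N + 1))"
    have N: "0 \<le> N" and \<delta>: "0 < \<delta>" unfolding N_def \<delta>_def using \<delta>1 \<delta>2 \<delta>3 by auto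
    have s: "0 < s" unfolding s_def using N \<delta> by auto
    have "s * N \<le> \<delta> / 2"
      unfolding s_def using N \<delta> by (simp add: field_simps)
    then have sN: "s * N < \<delta>" using \<delta> by linarith
    have inS: "y + h \<in> S" if "norm h < \<delta>" for h
      using \<delta>3(2)[of "y + h"] that by (simp add: \<delta>_def dist_norm)
    have "\<bar>f (y + s *\<^sub>R a + s *\<^sub>R b) - f (y + s *\<^sub>R a) - f (y + s *\<^sub>R b) + f y - s\<^sup>2 * A b\<bar>
        \<le> 2 * \<epsilon> * s\<^sup>2 * (norm a + norm b)"
      using \<delta>1 inS has_derivative_linear[OF A] f s sN \<epsilon>
      by (intro second_difference_estimate[where S = S and \<delta> = \<delta>]) (auto simp: N_def \<delta>_def)
    moreover have "\<bar>f (y + s *\<^sub>R b + s *\<^sub>R a) - f (y + s *\<^sub>R b) - f (y + s *\<^sub>R a) + f y - s\<^sup>2 * B a\<bar>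
        \<le> 2 * \<epsilon> * s\<^sup>2 * (norm b + norm a)"
      using \<delta>2 inS has_derivative_linear[OF B] f s sN \<epsilon>
      by (intro second_difference_estimate[where S = S and \<delta> = \<delta>]) (auto simp: N_def \<delta>_def add.commute)
    moreover have "y + s *\<^sub>R b + s *\<^sub>R a = y + s *\<^sub>R a + s *\<^sub>R b" by (simp add: algebra_simps)
    ultimately have "\<bar>s\<^sup>2 * A b - s\<^sup>2 * B a\<bar> \<le> 4 * \<epsilon> * s\<^sup>2 * N"
      unfolding N_def by (simp add: algebra_simps)
    moreover have "\<bar>s\<^sup>2 * A b - s\<^sup>2 * B a\<bar> = s\<^sup>2 * \<bar>A b - B a\<bar>"
      by (simp add: abs_mult flip: right_diff_distrib)
    ultimately have "s\<^sup>2 * \<bar>A b - B a\<bar> \<le> s\<^sup>2 * (4 * \<epsilon> * N)"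
      by (simp add: mult_ac)
    then show ?thesis using s by simp
  qed
  have "\<bar>A b - B a\<bar> \<le> 0 + e" if "0 < e" for e
  proof -
    have N: "0 \<le> N" unfolding N_def by simp
    have "\<bar>A b - B a\<bar> \<le> 4 * (e / (4 * (N + 1))) * N"
      using N that by (intro est) auto
    also have "\<dots> \<le> e" using N that by (simp add: field_simps)
    finally show ?thesis by simp
  qed
  then have "\<bar>A b - B a\<bar> \<le> 0"
    by (rule field_le_epsilon)
  then show ?thesis unfolding A_def B_def by simp
qed

lemma partial_deriv_move:
  fixes f :: "'a::euclidean_space \<Rightarrow> real"
  assumes S: "open S" and f: "smooth_on S f" and "set u \<subseteq> Basis" "b \<in> Basis" "set v \<subseteq> Basis"
    and "y \<in> S"
  shows "partial_deriv (u @ b # v) f y = partial_deriv (b # u @ v) f y"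
  using assms(3,6)
proof (induction u arbitrary: y)
  case (Cons c u)
  define g where "g = partial_deriv (u @ v) f"
  have g: "smooth_on S g"
    unfolding g_def using f Cons.prems assms by (intro smooth_on_partial_deriv) auto
  have "partial_deriv ((c # u) @ b # v) f y = frechet_derivative (partial_deriv (b # u @ v) f) (at y) c"
    using frechet_derivative_cong_open[OF S Cons.prems(2), of "partial_deriv (u @ b # v) f"
        "partial_deriv (b # u @ v) f"] Cons by simp
  also have "\<dots> = frechet_derivative (\<lambda>z. frechet_derivative g (at z) b) (at y) c"
    by (simp add: g_def)
  also have "\<dots> = frechet_derivative (\<lambda>z. frechet_derivative g (at z) c) (at y) b"
    using Cons.prems assms(4) smooth_on_differentiable_at[OF S] g smooth_on_frechet[OF g]
    by (intro frechet_derivative_commute[OF S]) auto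
  also have "\<dots> = partial_deriv (b # (c # u) @ v) f y"
    by (simp add: g_def)
  finally show ?case .
qed simp

text \<open>The head of \<open>w\<close> occurs somewhere in \<open>w'\<close> and can be moved to
  its front; the words that remain have equal multisets.\<close>

lemma partial_deriv_mset_cong:
  fixes f :: "'a::euclidean_space \<Rightarrow> real"
  assumes S: "open S" and f: "smooth_on S f" and "mset w = mset w'" "set w \<subseteq> Basis" "y \<in> S"
  shows "partial_deriv w f y = partial_deriv w' f y"
  using assms(3-5)
proof (induction w arbitrary: w' y)
  case (Cons b w)
  then have "b \<in> set w'"
    by (metis list.set_intros(1) mset_eq_setD)
  then obtain u v where w': "w' = u @ b # v"
    by (meson split_list)
  have "mset w = mset (u @ v)"
    using Cons.prems(1) by (simp add: w')
  moreover have "set w' = set (b # w)"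
    using Cons.prems(1) by (metis mset_eq_setD)
  ultimately have "partial_deriv (b # w) f y = partial_deriv (b # u @ v) f y"
    using frechet_derivative_cong_open[OF S Cons.prems(3), of "partial_deriv w f"
        "partial_deriv (u @ v) f"] Cons.IH[of "u @ v"] Cons.prems(2) by simp
  also have "\<dots> = partial_deriv w' f y"
    unfolding w' using \<open>set w' = set (b # w)\<close> Cons.prems(2,3) w'
    by (intro partial_deriv_move[OF S f, symmetric]) auto
  finally show ?case .
qed simp

section \<open>Linear independence of monomials\<close>

text \<open>Induction on the set of variables. Grouping the monomials by their exponent of the new
  variable \<open>d\<close> gives a polynomial in the value at \<open>d\<close>, whose coefficients
  vanish for every choice of the other variables. Within one group the exponents of the other
  variables still separate the monomials.\<close>

lemma monomials_independent:
  fixes A :: "'i \<Rightarrow> real" and e :: "'i \<Rightarrow> 'b \<Rightarrow> nat"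
  assumes "finite B" "finite M"
    and "\<And>i j. i \<in> M \<Longrightarrow> j \<in> M \<Longrightarrow> (\<And>b. b \<in> B \<Longrightarrow> e i b = e j b) \<Longrightarrow> i = j"
    and "\<And>x. (\<Sum>i\<in>M. A i * (\<Prod>b\<in>B. x b ^ e i b)) = 0"
    and "i \<in> M"
  shows "A i = 0"
  using assms
proof (induction B arbitrary: M i rule: finite_induct)
  case empty
  then have "M = {i}" by auto
  then show ?case using empty.prems(3) by simp
next
  case (insert d B)
  define n where "n = Max ((\<lambda>i. e i d) ` M)"
  have n: "e j d \<le> n" if "j \<in> M" for j
    unfolding n_def using insert.prems(1) that by (intro Max_ge) auto
  define M' where "M' k = {j \<in> M. e j d = k}" for k
  have "(\<Sum>j\<in>M' k. A j * (\<Prod>b\<in>B. x b ^ e j b)) = 0" if k: "k \<le> n" for x k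
  proof -
    have "(\<Sum>k\<le>n. (\<Sum>j\<in>M' k. A j * (\<Prod>b\<in>B. x b ^ e j b)) * t ^ k) = 0" for t
    proof -
      have "(\<Sum>k\<le>n. (\<Sum>j\<in>M' k. A j * (\<Prod>b\<in>B. x b ^ e j b)) * t ^ k) =
          (\<Sum>k\<le>n. \<Sum>j\<in>M' k. A j * (\<Prod>b\<in>insert d B. (x(d := t)) b ^ e j b))"
      proof (intro sum.cong refl)
        fix k
        have "(\<Prod>b\<in>B. (x(d := t)) b ^ e j b) = (\<Prod>b\<in>B. x b ^ e j b)" for j
          using insert.hyps(2) by (intro prod.cong) auto
        then show "(\<Sum>j\<in>M' k. A j * (\<Prod>b\<in>B. x b ^ e j b)) * t ^ k =
            (\<Sum>j\<in>M' k. A j * (\<Prod>b\<in>insert d B. (x(d := t)) b ^ e j b))"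
          using insert.hyps by (simp add: sum_distrib_left M'_def mult_ac)
      qed
      also have "\<dots> = (\<Sum>j\<in>M. A j * (\<Prod>b\<in>insert d B. (x(d := t)) b ^ e j b))"
        unfolding M'_def using insert.prems(1) n by (intro sum.group) auto
      also have "\<dots> = 0"
        by (rule insert.prems(3))
      finally show ?thesis .
    qed
    then show ?thesis
      using polyfun_eq_0[of "\<lambda>k. \<Sum>j\<in>M' k. A j * (\<Prod>b\<in>B. x b ^ e j b)" n] k by blast
  qed
  note vanish = this[OF n[OF insert.prems(4)]]
  show ?case
  proof (rule insert.IH[of "M' (e i d)" i, OF _ _ vanish])
    show "i' = j'" if "i' \<in> M' (e i d)" "j' \<in> M' (e i d)" "\<And>b. b \<in> B \<Longrightarrow> e i' b = e j' b" for i' j'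
      using that by (intro insert.prems(2)) (auto simp: M'_def)
  qed (use insert.prems in \<open>auto simp: M'_def\<close>)
qed

section \<open>Derivatives of powers at a zero of the base\<close>

lemma frechet_derivative_power:
  fixes k :: "'a::euclidean_space \<Rightarrow> real"
  assumes "k differentiable at y"
  shows "frechet_derivative (\<lambda>z. k z ^ m) (at y) b = real m * k y ^ (m - 1) * frechet_derivative k (at y) b"
proof -
  have "((\<lambda>z. k z ^ m) has_derivative (\<lambda>h. real m * (frechet_derivative k (at y) h) * k y ^ (m - 1))) (at y)"
    using assms has_derivative_power[of k "frechet_derivative k (at y)" y UNIV m]
    unfolding frechet_derivative_works by (simp add: mult.assoc mult.commute)
  from frechet_derivative_eqI[OF this] show ?thesis by (simp add: mult_ac)
qed

lemma smooth_on_gradient_product: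
  fixes k :: "'a::euclidean_space \<Rightarrow> real"
  assumes "open S" "smooth_on S k" "set w \<subseteq> Basis"
  shows "smooth_on S (\<lambda>z. \<Prod>b\<leftarrow>w. frechet_derivative k (at z) b)"
  using assms(3)
proof (induction w)
  case (Cons b w)
  then show ?case
    using smooth_on_mult[OF assms(1) smooth_on_frechet[OF assms(2)], of b] by simp
qed (use assms(1) in simp)

text \<open>The extra factor \<open>k\<close> of the remainder makes the induction work.\<close>

lemma partial_deriv_power_mult:
  fixes k u :: "'a::euclidean_space \<Rightarrow> real"
  assumes S: "open S" and k: "smooth_on S k" and u: "smooth_on S u"
    and "set w \<subseteq> Basis" "length w \<le> n"
  shows "\<exists>v. smooth_on S v \<and> (\<forall>z\<in>S. partial_deriv w (\<lambda>y. k y ^ n * u y) z =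
    k z ^ (n - length w) *
      (fact n / fact (n - length w) * (\<Prod>b\<leftarrow>w. frechet_derivative k (at z) b) * u z) +
    k z ^ (n - length w + 1) * v z)"
  using assms(4,5)
proof (induction w)
  case Nil
  then show ?case using S by (intro exI[of _ "\<lambda>_. 0"]) auto
next
  case (Cons b w)
  define m where "m = n - length w - 1"
  have m: "n - length w = Suc m" "n - length (b # w) = m"
    using Cons.prems unfolding m_def by auto
  define q where "q z = fact n / fact (Suc m) * (\<Prod>b\<leftarrow>w. frechet_derivative k (at z) b) * u z" for z
  obtain v where v: "smooth_on S v" "\<And>z. z \<in> S \<Longrightarrow> partial_deriv w (\<lambda>y. k y ^ n * u y) z =
      k z ^ Suc m * q z + k z ^ (Suc m + 1) * v z"
    using Cons unfolding m(1) q_def by auto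
  have q: "smooth_on S q"
    unfolding q_def using Cons.prems smooth_on_gradient_product[OF S k, of w] u S
    by (intro smooth_on_mult smooth_on_const) auto
  \<comment> \<open>Differentiating \<open>k^(m+1) q + k^(m+2) v\<close> gives one term with only
    \<open>k^m\<close>, the one in which the first power is differentiated. The other three contain
    \<open>k^(m+1)\<close> and are collected here.\<close>
  define v' where "v' z = frechet_derivative q (at z) b +
    (real (m + 2) * frechet_derivative k (at z) b * v z + k z * frechet_derivative v (at z) b)" for z
  have "smooth_on S v'"
    unfolding v'_def using Cons.prems k q v(1) S
    by (intro smooth_on_add smooth_on_mult smooth_on_frechet smooth_on_const) auto
  moreover have "partial_deriv (b # w) (\<lambda>y. k y ^ n * u y) z =
      k z ^ m * (fact n / fact m * (\<Prod>b\<leftarrow>b # w. frechet_derivative k (at z) b) * u z) +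
      k z ^ (m + 1) * v' z" if z: "z \<in> S" for z
  proof -
    note d = smooth_on_has_derivative[OF S _ z]
    note D = smooth_on_differentiable_at[OF S _ z]
    have dk: "k differentiable at z" "q differentiable at z" "v differentiable at z"
      using D k q v(1) by auto
    have "((\<lambda>z. k z ^ Suc m * q z + k z ^ (Suc m + 1) * v z) has_derivative
       (\<lambda>h. frechet_derivative (\<lambda>z. k z ^ Suc m * q z) (at z) h +
            frechet_derivative (\<lambda>z. k z ^ (Suc m + 1) * v z) (at z) h)) (at z)"
      using S k q v(1) by (intro has_derivative_add d smooth_on_mult smooth_on_power)
    then have "partial_deriv (b # w) (\<lambda>y. k y ^ n * u y) z =
        frechet_derivative (\<lambda>z. k z ^ Suc m * q z) (at z) b +
        frechet_derivative (\<lambda>z. k z ^ (Suc m + 1) * v z) (at z) b"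
      using frechet_derivative_cong_open[OF S z v(2)] frechet_derivative_eqI by fastforce
    also have "\<dots> = (real (Suc m) * k z ^ m * frechet_derivative k (at z) b * q z +
          k z ^ Suc m * frechet_derivative q (at z) b) +
        (real (m + 2) * k z ^ Suc m * frechet_derivative k (at z) b * v z +
          k z ^ (m + 2) * frechet_derivative v (at z) b)"
    proof -
      have "(\<lambda>z. k z ^ j) differentiable at z" for j
        using D smooth_on_power[OF S k] by blast
      then show ?thesis
        using dk by (simp add: frechet_derivative_mult frechet_derivative_power del: power_Suc)
    qed
    also have "\<dots> = k z ^ m * (real (Suc m) * frechet_derivative k (at z) b * q z) + k z ^ (m + 1) * v' z"
      by (simp add: v'_def algebra_simps)
    also have "real (Suc m) * frechet_derivative k (at z) b * q z =
        fact n / fact m * (\<Prod>b\<leftarrow>b # w. frechet_derivative k (at z) b) * u z"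
      unfolding q_def fact_Suc by (simp add: field_simps del: of_nat_Suc)
    finally show ?thesis .
  qed
  ultimately show ?case
    unfolding m(2) by blast
qed

text \<open>A word shorter than \<open>n\<close> leaves a positive power of \<open>k\<close> in the
  leading term, and the remainder always contains one. The factorials in the later formulas for
  symbols originate here.\<close>

lemma partial_deriv_power_mult_zero:
  fixes k u :: "'a::euclidean_space \<Rightarrow> real"
  assumes "open S" "smooth_on S k" "smooth_on S u" "set w \<subseteq> Basis" "length w \<le> n" "z \<in> S" "k z = 0"
  shows "partial_deriv w (\<lambda>y. k y ^ n * u y) z =
    (if length w = n then fact n * (\<Prod>b\<leftarrow>w. frechet_derivative k (at z) b) * u z else 0)"
proof -
  obtain v where "partial_deriv w (\<lambda>y. k y ^ n * u y) z =
    k z ^ (n - length w) *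
      (fact n / fact (n - length w) * (\<Prod>b\<leftarrow>w. frechet_derivative k (at z) b) * u z) +
    k z ^ (n - length w + 1) * v z"
    using partial_deriv_power_mult[OF assms(1-5)] assms(6) by blast
  then show ?thesis
    using assms(5,7) by auto
qed

section \<open>Flat functions and bump functions\<close>

text \<open>The classical flat function is the case \<open>p = 1\<close>. A polynomial in
  \<open>1 / t\<close> is carried along so that the family is closed under differentiation.\<close>

definition flat_poly :: "real poly \<Rightarrow> real \<Rightarrow> real" where
  "flat_poly p t = (if t > 0 then poly p (1 / t) * exp (- 1 / t) else 0)"

lemma poly_exp_tendsto_0: "((\<lambda>s::real. poly p s * exp (- s)) \<longlongrightarrow> 0) at_top"
proof -
  have "((\<lambda>s. \<Sum>i\<le>degree p. coeff p i * (s ^ i / exp s)) \<longlongrightarrow> (\<Sum>i\<le>degree p. coeff p i * 0)) at_top"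
    by (intro tendsto_sum tendsto_mult tendsto_const tendsto_power_div_exp_0)
  then show ?thesis
    by (simp add: poly_altdef exp_minus sum_distrib_right divide_inverse mult.assoc)
qed

text \<open>With \<open>s = 1 / t\<close> one has \<open>d/dt = - s\<^sup>2 d/ds\<close>, which
  turns \<open>p(s) exp(-s)\<close> into \<open>s\<^sup>2 (p - p')(s) exp(-s)\<close>; the
  polynomial \<open>[:0, 0, 1:]\<close> is \<open>s\<^sup>2\<close>. At 0 the right difference
  quotient is \<open>s p(s) exp(-s)\<close>, which tends to 0 as \<open>s\<close> grows.\<close>

lemma flat_poly_has_derivative:
  "(flat_poly p has_real_derivative flat_poly ([:0, 0, 1:] * (p - pderiv p)) t) (at t)"
proof -
  consider "t > 0" | "t < 0" | "t = 0" by linarith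
  then show ?thesis
  proof cases
    case 1
    have "((\<lambda>t. poly p (1 / t) * exp (- 1 / t)) has_real_derivative
        poly (pderiv p) (1 / t) * (- 1 / t\<^sup>2) * exp (- 1 / t) +
        poly p (1 / t) * (exp (- 1 / t) * (1 / t\<^sup>2))) (at t)"
      using 1
      by (auto intro!: derivative_eq_intros DERIV_chain'[OF _ poly_DERIV] simp: field_simps power2_eq_square)
    moreover have "poly (pderiv p) (1 / t) * (- 1 / t\<^sup>2) * exp (- 1 / t) +
        poly p (1 / t) * (exp (- 1 / t) * (1 / t\<^sup>2)) = flat_poly ([:0, 0, 1:] * (p - pderiv p)) t"
      using 1 by (simp add: flat_poly_def field_simps power2_eq_square)
    ultimately have "((\<lambda>t. poly p (1 / t) * exp (- 1 / t)) has_real_derivative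
        flat_poly ([:0, 0, 1:] * (p - pderiv p)) t) (at t)" by simp
    then show ?thesis
      by (rule has_field_derivative_transform_within_open[where S = "{0<..}"])
        (use 1 in \<open>auto simp: flat_poly_def\<close>)
  next
    case 2
    have "((\<lambda>_. 0) has_real_derivative 0) (at t)" by simp
    then have "(flat_poly p has_real_derivative 0) (at t)"
      by (rule has_field_derivative_transform_within_open[where S = "{..<0}"])
        (use 2 in \<open>auto simp: flat_poly_def\<close>)
    then show ?thesis using 2 by (simp add: flat_poly_def)
  next
    case 3
    have "((\<lambda>h. poly (pCons 0 p) (inverse h) * exp (- inverse h)) \<longlongrightarrow> 0) (at_right 0)"
      using filterlim_compose[OF poly_exp_tendsto_0 filterlim_inverse_at_top_right] .
    moreover have "\<forall>\<^sub>F h in at_right 0. poly (pCons 0 p) (inverse h) * exp (- inverse h) =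
        (flat_poly p (0 + h) - flat_poly p 0) / h"
      using eventually_at_right_less[of "0::real"]
      by eventually_elim (simp add: flat_poly_def field_simps)
    ultimately have "((\<lambda>h. (flat_poly p (0 + h) - flat_poly p 0) / h) \<longlongrightarrow> 0) (at_right 0)"
      using tendsto_cong by fast
    moreover have "((\<lambda>h. (flat_poly p (0 + h) - flat_poly p 0) / h) \<longlongrightarrow> 0) (at_left 0)"
    proof (rule tendsto_eventually)
      have "\<forall>\<^sub>F h in at_left (0::real). h < 0"
        by (simp add: eventually_at_filter)
      then show "\<forall>\<^sub>F h in at_left 0. (flat_poly p (0 + h) - flat_poly p 0) / h = 0"
        by eventually_elim (simp add: flat_poly_def)
    qed
    ultimately have "(flat_poly p has_real_derivative 0) (at 0)"
      unfolding DERIV_def by (simp only: filterlim_split_at)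
    then show ?thesis using 3 by (simp add: flat_poly_def)
  qed
qed

lemma smooth_on_flat_poly: "smooth_on UNIV (flat_poly p)"
proof (rule smooth_on_coinduct[where P = "\<lambda>f. \<exists>p. f = flat_poly p"])
  fix f :: "real \<Rightarrow> real" and b :: real
  assume "\<exists>p. f = flat_poly p" "b \<in> Basis"
  then obtain p where f: "f = flat_poly p" and b: "b = 1" by auto
  have "frechet_derivative f (at y) b = (\<Sum>g\<leftarrow>[flat_poly ([:0, 0, 1:] * (p - pderiv p))]. g y)" for y
    using frechet_derivative_eqI[OF flat_poly_has_derivative[of p y, unfolded has_field_derivative_def]]
    unfolding f b by simp
  then show "\<exists>gs. (\<forall>g\<in>set gs. \<exists>p. g = flat_poly p) \<and>
      (\<forall>y\<in>UNIV. frechet_derivative f (at y) b = (\<Sum>g\<leftarrow>gs. g y))"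
    by (intro exI[of _ "[flat_poly ([:0, 0, 1:] * (p - pderiv p))]"] conjI ballI) (auto simp only: list.set empty_iff insert_iff)
next
  fix f :: "real \<Rightarrow> real" and y
  assume "\<exists>p. f = flat_poly p"
  then show "f differentiable at y"
    using flat_poly_has_derivative unfolding has_field_derivative_def differentiable_def by blast
qed auto

lemma flat_poly_1_mono: "s \<le> t \<Longrightarrow> flat_poly 1 s \<le> flat_poly 1 t"
  by (simp add: flat_poly_def frac_le)

text \<open>The flat function is applied twice. \<open>flat_poly 1 (Q z)\<close> is 0 for
  \<open>dist x z \<le> \<delta>\<close> and at least \<open>c\<close> for
  \<open>dist x z \<ge> \<epsilon>\<close>, so \<open>R\<close> equals \<open>c\<close> in the first
  region and is nonpositive in the second. Another flat function sends these to a positive constant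
  and to 0, and division by that constant normalizes.\<close>

lemma bump_function:
  fixes x :: "'e::euclidean_space"
  assumes "0 < \<delta>" "\<delta> < \<epsilon>"
  obtains \<beta> :: "'e \<Rightarrow> real" where "smooth_on UNIV \<beta>"
    "\<And>z. dist x z \<le> \<delta> \<Longrightarrow> \<beta> z = 1" "\<And>z. \<epsilon> \<le> dist x z \<Longrightarrow> \<beta> z = 0"
proof -
  define Q where "Q z = (\<Sum>b\<in>Basis. (z \<bullet> b + - (x \<bullet> b)) * (z \<bullet> b + - (x \<bullet> b))) + - \<delta>\<^sup>2" for z
  have Q: "Q z = (dist x z)\<^sup>2 - \<delta>\<^sup>2" for z
    unfolding Q_def dist_norm power2_norm_eq_inner euclidean_inner[of "x - z" "x - z"]
    by (simp add: inner_diff_left algebra_simps)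
  have smQ: "smooth_on UNIV Q"
    unfolding Q_def by (intro smooth_on_affine smooth_on_add smooth_on_sum smooth_on_mult smooth_on_const) auto
  define c where "c = flat_poly 1 (\<epsilon>\<^sup>2 - \<delta>\<^sup>2)"
  have "\<delta>\<^sup>2 < \<epsilon>\<^sup>2"
    using assms by (simp add: power_strict_mono)
  then have c: "c > 0"
    unfolding c_def flat_poly_def by simp
  define R where "R z = c + (-1) * flat_poly 1 (Q z)" for z
  have smR: "smooth_on UNIV R"
    unfolding R_def
    by (intro smooth_on_add smooth_on_cmult smooth_on_const smooth_on_compose[OF _ _ smQ smooth_on_flat_poly]) auto
  define \<beta> where "\<beta> z = inverse (flat_poly 1 c) * flat_poly 1 (R z)" for z
  have "smooth_on UNIV \<beta>"
    unfolding \<beta>_def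
    by (intro smooth_on_cmult smooth_on_compose[OF _ _ smR smooth_on_flat_poly]) auto
  moreover have "\<beta> z = 1" if "dist x z \<le> \<delta>" for z
  proof -
    have "Q z \<le> 0"
      unfolding Q using that by (simp add: power_mono)
    then show ?thesis
      unfolding \<beta>_def R_def using c by (simp add: flat_poly_def)
  qed
  moreover have "\<beta> z = 0" if "\<epsilon> \<le> dist x z" for z
  proof -
    have "\<epsilon>\<^sup>2 - \<delta>\<^sup>2 \<le> Q z"
      unfolding Q using that assms by (simp add: power_mono)
    then have "R z \<le> 0"
      unfolding R_def c_def using flat_poly_1_mono by simp
    then show ?thesis
      unfolding \<beta>_def by (simp add: flat_poly_def)
  qed
  ultimately show thesis using that by blast
qed

section \<open>Linear combinations of derivatives indexed by words\<close>

lemma partial_deriv_linear: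
  fixes f g :: "'a::euclidean_space \<Rightarrow> real"
  assumes S: "open S" and f: "smooth_on S f" and g: "smooth_on S g" and "set w \<subseteq> Basis" "y \<in> S"
  shows "partial_deriv w (\<lambda>z. c * f z + g z) y = c * partial_deriv w f y + partial_deriv w g y"
  using assms(4,5)
proof (induction w arbitrary: y)
  case (Cons b w)
  have "((\<lambda>z. c * partial_deriv w f z + partial_deriv w g z) has_derivative
      (\<lambda>h. c * frechet_derivative (partial_deriv w f) (at y) h + frechet_derivative (partial_deriv w g) (at y) h)) (at y)"
    using Cons.prems smooth_on_partial_deriv[OF f, of w] smooth_on_partial_deriv[OF g, of w]
    by (intro has_derivative_add has_derivative_mult_right smooth_on_has_derivative[OF S]) auto
  from frechet_derivative_eqI[OF this] show ?case
    using frechet_derivative_cong_open[OF S Cons.prems(2), of "partial_deriv w (\<lambda>z. c * f z + g z)"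
        "\<lambda>z. c * partial_deriv w f z + partial_deriv w g z"] Cons by simp
qed simp

lemma finite_words [simp]: "finite (words r)"
  unfolding words_def by (intro finite_lists_length_le) simp

lemma prod_list_eq_prod_count:
  fixes x :: "'b \<Rightarrow> real"
  assumes "finite B" "set w \<subseteq> B"
  shows "(\<Prod>b\<leftarrow>w. x b) = (\<Prod>b\<in>B. x b ^ count (mset w) b)"
  using assms(2)
proof (induction w)
  case (Cons c w)
  have "(\<Prod>b\<in>B. x b ^ count (mset (c # w)) b) =
      (\<Prod>b\<in>B. (if b = c then x b else 1) * x b ^ count (mset w) b)"
    by (intro prod.cong) auto
  also have "\<dots> = x c * (\<Prod>b\<in>B. x b ^ count (mset w) b)"
    using Cons.prems assms(1) by (simp add: prod.distrib)
  finally show ?case using Cons by simp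
qed simp

text \<open>Words with the same multiset give the same monomial in \<open>\<xi>\<close>, so a
  vanishing polynomial only says that the sum \<open>A m\<close> of the coefficients over each such
  class is 0. This suffices because \<open>T\<close> is constant on the classes. In the application
  \<open>T\<close> is the family of partial derivatives of a function at a point.\<close>

lemma symmetric_contraction_eq_0:
  fixes \<alpha> T :: "'e::euclidean_space list \<Rightarrow> real"
  assumes W: "finite W" "\<And>w. w \<in> W \<Longrightarrow> set w \<subseteq> Basis"
    and zero: "\<And>\<xi>. (\<Sum>w\<in>W. \<alpha> w * (\<Prod>b\<leftarrow>w. \<xi> \<bullet> b)) = 0"
    and T: "\<And>w w'. w \<in> W \<Longrightarrow> w' \<in> W \<Longrightarrow> mset w = mset w' \<Longrightarrow> T w = T w'"
  shows "(\<Sum>w\<in>W. \<alpha> w * T w) = 0"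
proof -
  define A where "A m = (\<Sum>w | w \<in> W \<and> mset w = m. \<alpha> w)" for m
  have "A m = 0" if "m \<in> mset ` W" for m
  proof (rule monomials_independent[where A = A and B = Basis and M = "mset ` W" and e = count and i = m])
    show "i = j" if "i \<in> mset ` W" "j \<in> mset ` W" "\<And>b. b \<in> Basis \<Longrightarrow> count i b = count j b" for i j
    proof (rule multiset_eqI)
      fix b
      show "count i b = count j b"
      proof (cases "b \<in> Basis")
        case False
        then have "b \<notin># i" "b \<notin># j"
          using that(1,2) W(2) by force+
        then show ?thesis by (simp add: not_in_iff)
      qed (use that(3) in simp)
    qed
    show "(\<Sum>m\<in>mset ` W. A m * (\<Prod>b\<in>Basis. x b ^ count m b)) = 0" for x
    proof -
      define \<xi> :: 'e where "\<xi> = (\<Sum>b\<in>Basis. x b *\<^sub>R b)"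
      have \<xi>: "\<xi> \<bullet> b = x b" if "b \<in> Basis" for b
        unfolding \<xi>_def using that by simp
      have "(\<Sum>m\<in>mset ` W. A m * (\<Prod>b\<in>Basis. x b ^ count m b)) =
          (\<Sum>m\<in>mset ` W. \<Sum>w | w \<in> W \<and> mset w = m. \<alpha> w * (\<Prod>b\<leftarrow>w. \<xi> \<bullet> b))"
      proof (intro sum.cong refl)
        fix m
        have "(\<Prod>b\<leftarrow>w. \<xi> \<bullet> b) = (\<Prod>b\<in>Basis. x b ^ count (mset w) b)" if "w \<in> W" for w
          using prod_list_eq_prod_count[OF finite_Basis W(2)[OF that], of "\<lambda>b. \<xi> \<bullet> b"] \<xi> by simp
        then show "A m * (\<Prod>b\<in>Basis. x b ^ count m b) =
            (\<Sum>w | w \<in> W \<and> mset w = m. \<alpha> w * (\<Prod>b\<leftarrow>w. \<xi> \<bullet> b))"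
          unfolding A_def sum_distrib_right by (intro sum.cong) auto
      qed
      also have "\<dots> = 0"
        using zero W(1) by (subst sum.group) auto
      finally show ?thesis .
    qed
  qed (use W that in auto)
  note A0 = this
  have "(\<Sum>w\<in>W. \<alpha> w * T w) = (\<Sum>m\<in>mset ` W. \<Sum>w | w \<in> W \<and> mset w = m. \<alpha> w * T w)"
    using W(1) by (subst sum.group) auto
  also have "\<dots> = 0"
  proof (rule sum.neutral, rule ballI)
    fix m assume m: "m \<in> mset ` W"
    then obtain v where v: "v \<in> W" "m = mset v" by blast
    have Tv: "T w = T v" if "w \<in> W" "mset w = m" for w
      using T[OF that(1) v(1)] that(2) v(2) by simp
    have "(\<Sum>w | w \<in> W \<and> mset w = m. \<alpha> w * T w) = A m * T v"
      unfolding A_def sum_distrib_right by (intro sum.cong) (auto simp: Tv)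
    then show "(\<Sum>w | w \<in> W \<and> mset w = m. \<alpha> w * T w) = 0"
      using A0[OF m] by simp
  qed
  finally show ?thesis .
qed

section \<open>Elementary derivatives of linear and polynomial expressions\<close>

lemma frechet_derivative_linear_on:
  assumes "open W" "y \<in> W" "\<And>z. z \<in> W \<Longrightarrow> F z = z \<bullet> \<xi>"
  shows "frechet_derivative F (at y) b = b \<bullet> (\<xi> :: 'a::euclidean_space)"
proof -
  have "frechet_derivative F (at y) = frechet_derivative (\<lambda>z. z \<bullet> \<xi>) (at y)"
    by (rule frechet_derivative_cong_open[OF assms])
  moreover have "((\<lambda>z. z \<bullet> \<xi>) has_derivative (\<lambda>z. z \<bullet> \<xi>)) (at y)"
    by (auto intro!: derivative_eq_intros)
  ultimately show ?thesis
    using frechet_derivative_eqI by fastforce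
qed

text \<open>Existence is enough: the derivative of a symbol is later identified by restricting the
  symbol to the base and to lines in the fibre.\<close>

lemma prod_list_has_derivative:
  fixes w :: "'e::euclidean_space list"
  shows "\<exists>D. ((\<lambda>q::'e \<times> 'e. \<Prod>b\<leftarrow>w. snd q \<bullet> b) has_derivative D) (at q)"
proof (induction w)
  case Nil
  then show ?case by (auto intro: has_derivative_const)
next
  case (Cons b w)
  then obtain D where "((\<lambda>q::'e \<times> 'e. \<Prod>b\<leftarrow>w. snd q \<bullet> b) has_derivative D) (at q)" by blast
  moreover have "((\<lambda>q::'e \<times> 'e. snd q \<bullet> b) has_derivative (\<lambda>v. snd v \<bullet> b)) (at q)"
    by (auto intro!: derivative_eq_intros)
  ultimately show ?case
    using has_derivative_mult by fastforce
qed

lemma polynomial_has_derivative_at_0: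
  fixes c :: "nat \<Rightarrow> real"
  shows "((\<lambda>t. \<Sum>i\<le>r. c i * t ^ i) has_real_derivative (if r = 0 then 0 else c 1)) (at 0)"
proof -
  have "((\<lambda>t. \<Sum>i\<le>r. c i * t ^ i) has_real_derivative (\<Sum>i\<le>r. c i * (real i * 0 ^ (i - 1)))) (at 0)"
    by (auto intro!: derivative_eq_intros sum.cong)
  \<comment> \<open>Only \<open>i = 1\<close> survives: the factor \<open>real i\<close> removes
    \<open>i = 0\<close>, where \<open>0 ^ (i - 1)\<close> is 1, and the power is 0 for
    \<open>i > 1\<close>. If \<open>r = 0\<close>, the index 1 is out of range.\<close>
  moreover have "(\<Sum>i\<le>r. c i * (real i * 0 ^ (i - 1))) = (\<Sum>i\<in>{..r} \<inter> {1}. c i)"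
  proof (rule sum.mono_neutral_cong_right)
    show "\<forall>i\<in>{..r} - {..r} \<inter> {1}. c i * (real i * 0 ^ (i - 1)) = 0"
      by (auto simp: power_0_left) 
  qed auto
  moreover have "(\<Sum>i\<in>{..r} \<inter> {1}. c i) = (if r = 0 then 0 else c 1)"
    by auto
  ultimately show ?thesis by simp
qed

section \<open>Reindexing of finite sums\<close>

lemma sum_atMost_Suc_shift0:
  fixes F :: "nat \<Rightarrow> real"
  assumes "F 0 = 0"
  shows "(\<Sum>i\<le>Suc n. F i) = (\<Sum>i\<le>n. F (Suc i))"
  using assms by (simp add: sum.atMost_Suc_shift del: sum.atMost_Suc)

lemma sum_atMost_rev: "(\<Sum>i\<le>n. F i (n - i)) = (\<Sum>i\<le>n. F (n - i) i)" for F :: "nat \<Rightarrow> nat \<Rightarrow> real"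
proof -
  have "(\<Sum>i\<le>n. F i (n - i)) = (\<Sum>i\<le>n. F (n - i) (n - (n - i)))"
    using sum.nat_diff_reindex[of "\<lambda>i. F i (n - i)" "Suc n"] by (simp add: lessThan_Suc_atMost)
  then show ?thesis by simp
qed

lemma sum_atMost_last:
  fixes F :: "nat \<Rightarrow> 'a::comm_monoid_add"
  assumes "\<And>i. i < n \<Longrightarrow> F i = 0"
  shows "(\<Sum>i\<le>n. F i) = F n"
proof -
  have "(\<Sum>i\<le>n. F i) = (\<Sum>i\<in>{n}. F i)"
    by (rule sum.mono_neutral_right) (use assms in auto)
  then show ?thesis by simp
qed

lemma sum_atMost_first:
  fixes F :: "nat \<Rightarrow> 'a::comm_monoid_add"
  assumes "\<And>i. 0 < i \<Longrightarrow> F i = 0"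
  shows "(\<Sum>i\<le>n. F i) = F 0"
proof -
  have "(\<Sum>i\<le>n. F i) = (\<Sum>i\<in>{0}. F i)"
    by (rule sum.mono_neutral_right) (use assms in auto)
  then show ?thesis by simp
qed

lemma sum_fun_apply: "(\<Sum>i\<in>I. F i) x = (\<Sum>i\<in>I. F i x)" for F :: "'i \<Rightarrow> 'b \<Rightarrow> 'c::comm_monoid_add"
  by (induction I rule: infinite_finite_induct) auto


section \<open>Smooth manifolds\<close>

locale smooth_manifold =
  fixes \<A> :: "('m::{t2_space,second_countable_topology}, 'e::euclidean_space) chart set"
  assumes atlas: "smooth_atlas \<A>"
begin

lemma chart_homeomorphism:
  assumes "(U, \<phi>) \<in> \<A>"
  shows "open U" "open (\<phi> ` U)" "homeomorphism U (\<phi> ` U) \<phi> (inv_into U \<phi>)"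
  using atlas assms unfolding smooth_atlas_def by blast+

lemma chart_inv [simp]:
  assumes "(U, \<phi>) \<in> \<A>" "x \<in> U"
  shows "inv_into U \<phi> (\<phi> x) = x"
  using homeomorphism_apply1[OF chart_homeomorphism(3)[OF assms(1)] assms(2)] .

lemma open_chart_image:
  assumes "(U, \<phi>) \<in> \<A>" "open V" "V \<subseteq> U"
  shows "open (\<phi> ` V)"
proof -
  have "openin (top_of_set U) V"
    using assms by (simp add: open_subset)
  then have "openin (top_of_set (\<phi> ` U)) (\<phi> ` V)"
    using homeomorphism_imp_open_map[OF chart_homeomorphism(3)[OF assms(1)]] by blast
  then show ?thesis
    using chart_homeomorphism(2)[OF assms(1)] openin_open_trans by blast
qed

lemma transition_smooth:
  assumes "(U, \<phi>) \<in> \<A>" "(V, \<psi>) \<in> \<A>"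
  shows "smooth_on (\<phi> ` (U \<inter> V)) (\<psi> \<circ> inv_into U \<phi>)"
  using atlas assms unfolding smooth_atlas_def by blast

lemma ex_chart: obtains U \<phi> where "(U, \<phi>) \<in> \<A>" "x \<in> U"
  using atlas unfolding smooth_atlas_def by blast

lemma chart_at:
  obtains U \<phi> where "chart_at \<A> x = (U, \<phi>)" "(U, \<phi>) \<in> \<A>" "x \<in> U"
proof -
  have "chart_at \<A> x \<in> \<A> \<and> x \<in> fst (chart_at \<A> x)"
    unfolding chart_at_def by (rule someI_ex) (metis ex_chart fst_conv)
  then show thesis using that by (metis prod.collapse)
qed

lemma smooth_rep:
  assumes "f \<in> smooth_functions \<A>" "(U, \<phi>) \<in> \<A>"
  shows "smooth_on (\<phi> ` U) (\<lambda>z. f (inv_into U \<phi> z))"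
  using assms unfolding smooth_functions_def by (auto simp: o_def)

lemma smooth_functionsI:
  assumes "\<And>U \<phi>. (U, \<phi>) \<in> \<A> \<Longrightarrow> smooth_on (\<phi> ` U) (\<lambda>z. f (inv_into U \<phi> z))"
  shows "f \<in> smooth_functions \<A>"
  using assms unfolding smooth_functions_def by (auto simp: o_def)

lemma smooth_functions_const: "(\<lambda>_. c) \<in> smooth_functions \<A>"
  by (rule smooth_functionsI) (intro smooth_on_const chart_homeomorphism(2))

lemma smooth_functions_add:
  assumes "f \<in> smooth_functions \<A>" "g \<in> smooth_functions \<A>"
  shows "(\<lambda>x. f x + g x) \<in> smooth_functions \<A>"
  by (rule smooth_functionsI) (intro smooth_on_add chart_homeomorphism(2) smooth_rep assms)

lemma smooth_functions_mult:
  assumes "f \<in> smooth_functions \<A>" "g \<in> smooth_functions \<A>"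
  shows "(\<lambda>x. f x * g x) \<in> smooth_functions \<A>"
  by (rule smooth_functionsI) (intro smooth_on_mult chart_homeomorphism(2) smooth_rep assms)

lemma smooth_functions_cmult:
  "f \<in> smooth_functions \<A> \<Longrightarrow> (\<lambda>x. c * f x) \<in> smooth_functions \<A>"
  using smooth_functions_mult[OF smooth_functions_const] .

lemma smooth_functions_diff:
  assumes "f \<in> smooth_functions \<A>" "g \<in> smooth_functions \<A>"
  shows "(\<lambda>x. f x - g x) \<in> smooth_functions \<A>"
  using smooth_functions_add[OF assms(1) smooth_functions_cmult[OF assms(2), of "-1"]] by simp

lemma smooth_functions_power:
  assumes "f \<in> smooth_functions \<A>"
  shows "(\<lambda>x. f x ^ n) \<in> smooth_functions \<A>"
  by (rule smooth_functionsI) (intro smooth_on_power chart_homeomorphism(2) smooth_rep assms)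

lemma smooth_functions_sum:
  assumes "\<And>i. i \<in> I \<Longrightarrow> f i \<in> smooth_functions \<A>"
  shows "(\<lambda>x. \<Sum>i\<in>I. f i x) \<in> smooth_functions \<A>"
  by (rule smooth_functionsI) (intro smooth_on_sum chart_homeomorphism(2) smooth_rep assms)

lemmas smooth_functions_intros =
  smooth_functions_const smooth_functions_add smooth_functions_mult smooth_functions_cmult
  smooth_functions_diff smooth_functions_power smooth_functions_sum

section \<open>Global functions that are linear in a chart near a point\<close>

text \<open>Operators act on global functions, so the linear function of the coordinates is
  multiplied by a bump function and extended by 0. The extension vanishes off \<open>K\<close>, a
  compact subset of \<open>U\<close>, which is closed because the manifold is Hausdorff.\<close>

lemma ex_linear_extension:
  assumes c: "(U, \<phi>) \<in> \<A>" and x: "x \<in> U"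
  obtains h W where "h \<in> smooth_functions \<A>" "open W" "\<phi> x \<in> W" "W \<subseteq> \<phi> ` U"
    "\<And>z. z \<in> W \<Longrightarrow> h (inv_into U \<phi> z) = z \<bullet> \<xi>"
proof -
  obtain \<epsilon> where \<epsilon>: "0 < \<epsilon>" "cball (\<phi> x) \<epsilon> \<subseteq> \<phi> ` U"
    using chart_homeomorphism(2)[OF c] x open_contains_cball by blast
  obtain \<beta> :: "'e \<Rightarrow> real" where \<beta>: "smooth_on UNIV \<beta>"
    "\<And>z. dist (\<phi> x) z \<le> \<epsilon> / 2 \<Longrightarrow> \<beta> z = 1" "\<And>z. \<epsilon> \<le> dist (\<phi> x) z \<Longrightarrow> \<beta> z = 0"
    using bump_function[of "\<epsilon> / 2" \<epsilon> "\<phi> x"] \<epsilon>(1) by auto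
  define F where "F z = \<beta> z * (z \<bullet> \<xi> + 0)" for z
  have F: "smooth_on UNIV F"
    unfolding F_def by (intro smooth_on_mult \<beta> smooth_on_affine) auto
  define h where "h y = (if y \<in> U then F (\<phi> y) else 0)" for y
  define K where "K = inv_into U \<phi> ` cball (\<phi> x) \<epsilon>"
  have "continuous_on (cball (\<phi> x) \<epsilon>) (inv_into U \<phi>)"
    using homeomorphism_cont2[OF chart_homeomorphism(3)[OF c]] continuous_on_subset \<epsilon>(2) by blast
  then have K: "closed K"
    unfolding K_def by (intro compact_imp_closed compact_continuous_image) auto
  have KU: "K \<subseteq> U"
    unfolding K_def using \<epsilon>(2) by (metis image_mono homeomorphism_image2 chart_homeomorphism(3)[OF c])
  have h0: "h y = 0" if "y \<notin> K" for y
  proof (cases "y \<in> U")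
    case True
    then have "\<phi> y \<notin> cball (\<phi> x) \<epsilon>"
      using that c unfolding K_def by (metis chart_inv image_eqI)
    then show ?thesis using True \<beta>(3) by (simp add: h_def F_def)
  qed (simp add: h_def)
  have "h \<in> smooth_functions \<A>"
  proof (rule smooth_functionsI)
    fix V \<psi> assume d: "(V, \<psi>) \<in> \<A>"
    have inv: "inv_into V \<psi> (\<psi> y) = y" if "y \<in> V" for y
      using chart_inv[OF d that] .
    show "smooth_on (\<psi> ` V) (\<lambda>z. h (inv_into V \<psi> z))"
    proof (rule smooth_on_locally)
      fix z assume "z \<in> \<psi> ` V"
      then obtain y where y: "y \<in> V" "z = \<psi> y" by blast
      \<comment> \<open>Near a point of \<open>U\<close> smoothness comes from the transition map;
        any other point has the neighbourhood \<open>V - K\<close>, where \<open>h\<close> is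
        0.\<close>
      show "\<exists>T. open T \<and> z \<in> T \<and> smooth_on T (\<lambda>z. h (inv_into V \<psi> z))"
      proof (cases "y \<in> U")
        case True
        have T: "open (\<psi> ` (V \<inter> U))"
          using chart_homeomorphism(1) c d by (intro open_chart_image[OF d]) auto
        have "smooth_on (\<psi> ` (V \<inter> U)) (\<lambda>z. F ((\<phi> \<circ> inv_into V \<psi>) z))"
          by (rule smooth_on_compose[OF T open_UNIV transition_smooth[OF d c] F]) auto
        then have "smooth_on (\<psi> ` (V \<inter> U)) (\<lambda>z. h (inv_into V \<psi> z))"
          by (rule smooth_on_cong[OF T]) (auto simp: h_def inv)
        then show ?thesis using T True y by blast
      next
        case False
        have T: "open (\<psi> ` (V - K))"
          using chart_homeomorphism(1)[OF d] K by (intro open_chart_image[OF d]) auto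
        have "smooth_on (\<psi> ` (V - K)) (\<lambda>z. h (inv_into V \<psi> z))"
          by (rule smooth_on_cong[OF T smooth_on_const[OF T, of 0]]) (auto simp: inv h0)
        then show ?thesis using T False y KU by blast
      qed
    qed
  qed
  moreover have "h (inv_into U \<phi> z) = z \<bullet> \<xi>" if "z \<in> ball (\<phi> x) (\<epsilon> / 2)" for z
  proof -
    have "z \<in> \<phi> ` U" using that \<epsilon> by auto
    then show ?thesis using that \<beta>(2) c by (auto simp: h_def F_def)
  qed
  moreover have "ball (\<phi> x) (\<epsilon> / 2) \<subseteq> \<phi> ` U"
    using \<epsilon> by auto
  ultimately show thesis
    using that[of h "ball (\<phi> x) (\<epsilon> / 2)"] \<epsilon>(1) by auto
qed

section \<open>Tangent vectors and covectors in charts\<close>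

lemma coord_vector_apply:
  "f \<in> smooth_functions \<A> \<Longrightarrow> coord_vector \<A> (U, \<phi>) x u f =
    frechet_derivative (\<lambda>z. f (inv_into U \<phi> z)) (at (\<phi> x)) u"
  by (simp add: coord_vector_def o_def)

lemma rep_differentiable:
  assumes "(U, \<phi>) \<in> \<A>" "x \<in> U" "f \<in> smooth_functions \<A>"
  shows "(\<lambda>z. f (inv_into U \<phi> z)) differentiable at (\<phi> x)"
  using smooth_on_differentiable_at[OF chart_homeomorphism(2) smooth_rep] assms by blast

lemma coord_vector_linear:
  assumes "(U, \<phi>) \<in> \<A>" "x \<in> U"
  shows "coord_vector \<A> (U, \<phi>) x (a *\<^sub>R u + v) =
    (\<lambda>f. a * coord_vector \<A> (U, \<phi>) x u f + coord_vector \<A> (U, \<phi>) x v f)"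
proof
  fix f
  show "coord_vector \<A> (U, \<phi>) x (a *\<^sub>R u + v) f =
    a * coord_vector \<A> (U, \<phi>) x u f + coord_vector \<A> (U, \<phi>) x v f"
  proof (cases "f \<in> smooth_functions \<A>")
    case True
    have "linear (frechet_derivative (\<lambda>z. f (inv_into U \<phi> z)) (at (\<phi> x)))"
      using linear_frechet_derivative[OF rep_differentiable[OF assms True]] .
    then show ?thesis
      by (simp add: coord_vector_apply[OF True] linear_add linear_cmul)
  qed (simp add: coord_vector_def)
qed

lemma coord_vector_scale:
  assumes "(U, \<phi>) \<in> \<A>" "x \<in> U"
  shows "coord_vector \<A> (U, \<phi>) x (a *\<^sub>R u) = (\<lambda>f. a * coord_vector \<A> (U, \<phi>) x u f)"
proof -
  \<comment> \<open>This instance of linearity reads \<open>X 0 = X 0 + X 0\<close>.\<close>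
  have "coord_vector \<A> (U, \<phi>) x 0 f = 0" for f
    using fun_cong[OF coord_vector_linear[OF assms, of 1 0 0], of f] by simp
  then show ?thesis
    using coord_vector_linear[OF assms, of a u 0] by simp
qed

text \<open>The vector \<open>v\<close> is the image of \<open>u\<close> under the derivative of the
  transition map. The tangent space collects coordinate vectors of all charts around
  \<open>x\<close>; this is why a single chart yields all of them.\<close>

lemma coord_vector_change:
  assumes c: "(U, \<phi>) \<in> \<A>" "x \<in> U" and d: "(V, \<psi>) \<in> \<A>" "x \<in> V"
  shows "\<exists>v. coord_vector \<A> (V, \<psi>) x u = coord_vector \<A> (U, \<phi>) x v"
proof -
  let ?\<tau> = "\<phi> \<circ> inv_into V \<psi>"
  define T where "T = \<psi> ` (V \<inter> U)"
  have T: "open T"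
    unfolding T_def using chart_homeomorphism(1) c d by (intro open_chart_image[OF d(1)]) auto
  have xT: "\<psi> x \<in> T" using c d by (auto simp: T_def)
  have \<tau>: "?\<tau> differentiable at (\<psi> x)"
    using smooth_on_differentiable_at[OF T _ xT] transition_smooth[OF d(1) c(1)] by (simp add: T_def)
  have \<tau>x: "?\<tau> (\<psi> x) = \<phi> x" using d by simp
  have "coord_vector \<A> (V, \<psi>) x u f = coord_vector \<A> (U, \<phi>) x (frechet_derivative ?\<tau> (at (\<psi> x)) u) f" for f
  proof (cases "f \<in> smooth_functions \<A>")
    case True
    have "frechet_derivative (\<lambda>z. f (inv_into V \<psi> z)) (at (\<psi> x)) =
        frechet_derivative ((\<lambda>z. f (inv_into U \<phi> z)) \<circ> ?\<tau>) (at (\<psi> x))"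
      by (rule frechet_derivative_cong_open[OF T xT]) (use c d in \<open>auto simp: T_def\<close>)
    also have "\<dots> = frechet_derivative (\<lambda>z. f (inv_into U \<phi> z)) (at (?\<tau> (\<psi> x))) \<circ>
        frechet_derivative ?\<tau> (at (\<psi> x))"
      using rep_differentiable[OF c True] \<tau>x by (intro frechet_derivative_compose \<tau>) simp
    finally show ?thesis
      by (simp add: coord_vector_apply[OF True] \<tau>x del: o_apply) (simp add: o_def)
  qed (simp add: coord_vector_def)
  then show ?thesis by blast
qed

lemma tangent_space_chart:
  assumes "(U, \<phi>) \<in> \<A>" "x \<in> U"
  shows "tangent_space \<A> x = range (coord_vector \<A> (U, \<phi>) x)"
proof
  show "tangent_space \<A> x \<subseteq> range (coord_vector \<A> (U, \<phi>) x)"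
    unfolding tangent_space_def using coord_vector_change[OF assms] by fastforce
qed (use assms in \<open>force simp: tangent_space_def\<close>)

lemma cotangent_coord_vector:
  assumes c: "(U, \<phi>) \<in> \<A>" "x \<in> U" and p: "p \<in> cotangent_space \<A> x"
  shows "p (coord_vector \<A> (U, \<phi>) x u) = (\<Sum>b\<in>Basis. (u \<bullet> b) * p (coord_vector \<A> (U, \<phi>) x b))"
proof -
  let ?X = "coord_vector \<A> (U, \<phi>) x"
  have T: "?X u \<in> tangent_space \<A> x" for u
    unfolding tangent_space_chart[OF c] by blast
  have scale: "?X (a *\<^sub>R u) = (\<lambda>f. a * ?X u f)" for a u
    using coord_vector_scale[OF c, of a u] by simp
  have "linear (\<lambda>u. p (?X u))"
  proof
    show "p (?X (u + v)) = p (?X u) + p (?X v)" for u v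
      using p T coord_vector_linear[OF c, of 1 u v] by (simp add: cotangent_space_def plus_fun_def)
    show "p (?X (a *\<^sub>R u)) = a *\<^sub>R p (?X u)" for a u
      using p T[of u] scale[of a u] by (simp add: cotangent_space_def)
  qed
  from linear_euclidean_expand[OF this, of u] show ?thesis by simp
qed

lemma differential_coord_vector:
  assumes "(U, \<phi>) \<in> \<A>" "x \<in> U" "h \<in> smooth_functions \<A>"
  shows "differential \<A> h x (coord_vector \<A> (U, \<phi>) x u) =
    frechet_derivative (\<lambda>z. h (inv_into U \<phi> z)) (at (\<phi> x)) u"
  unfolding differential_def using assms by (simp add: tangent_space_chart coord_vector_apply)

lemma differential_in_cotangent_space:
  assumes "h \<in> smooth_functions \<A>"
  shows "differential \<A> h x \<in> cotangent_space \<A> x"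
proof -
  obtain U \<phi> where c: "(U, \<phi>) \<in> \<A>" "x \<in> U" using ex_chart .
  let ?X = "coord_vector \<A> (U, \<phi>) x"
  have T: "v \<in> tangent_space \<A> x \<longleftrightarrow> (\<exists>u. v = ?X u)" for v
    unfolding tangent_space_chart[OF c] by blast
  have "?X u + ?X v = ?X (u + v)" for u v
    using coord_vector_linear[OF c, of 1 u v] by (simp add: plus_fun_def)
  moreover have "(\<lambda>f. a * ?X u f) = ?X (a *\<^sub>R u)" for a u
    using coord_vector_scale[OF c, of a u] by simp
  ultimately have "v + w \<in> tangent_space \<A> x" "(\<lambda>f. a * v f) \<in> tangent_space \<A> x"
    if "v \<in> tangent_space \<A> x" "w \<in> tangent_space \<A> x" for a v w
    using that unfolding T by metis+
  then show ?thesis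
    unfolding cotangent_space_def differential_def by auto
qed

lemma cotangent_eqI:
  assumes c: "(U, \<phi>) \<in> \<A>" "x \<in> U" and "p \<in> cotangent_space \<A> x" "q \<in> cotangent_space \<A> x"
    and "\<And>b. b \<in> Basis \<Longrightarrow> p (coord_vector \<A> (U, \<phi>) x b) = q (coord_vector \<A> (U, \<phi>) x b)"
  shows "p = q"
proof
  fix v
  show "p v = q v"
  proof (cases "v \<in> tangent_space \<A> x")
    case True
    then obtain u where "v = coord_vector \<A> (U, \<phi>) x u"
      unfolding tangent_space_chart[OF c] by blast
    then show ?thesis
      using cotangent_coord_vector[OF c assms(3), of u] cotangent_coord_vector[OF c assms(4), of u]
        assms(5) by simp
  next
    case False
    then show ?thesis using assms by (simp add: cotangent_space_def)
  qed
qed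

lemma cotangent_eq_differential:
  assumes c: "(U, \<phi>) \<in> \<A>" "x \<in> U" and p: "p \<in> cotangent_space \<A> x"
    and h: "h \<in> smooth_functions \<A>"
    and W: "open W" "\<phi> x \<in> W" "\<And>z. z \<in> W \<Longrightarrow> h (inv_into U \<phi> z) = z \<bullet> \<xi>"
    and "\<And>b. b \<in> Basis \<Longrightarrow> p (coord_vector \<A> (U, \<phi>) x b) = \<xi> \<bullet> b"
  shows "p = differential \<A> h x"
  using assms frechet_derivative_linear_on[OF W]
  by (intro cotangent_eqI[OF c p differential_in_cotangent_space[OF h]])
    (simp add: differential_coord_vector inner_commute)

lemma ex_cotangent:
  assumes c: "(U, \<phi>) \<in> \<A>" "x \<in> U"
  obtains p where "p \<in> cotangent_space \<A> x"
    "\<And>b. b \<in> Basis \<Longrightarrow> p (coord_vector \<A> (U, \<phi>) x b) = \<xi> \<bullet> b"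
proof -
  obtain h W where h: "h \<in> smooth_functions \<A>"
    and W: "open W" "\<phi> x \<in> W" "\<And>z. z \<in> W \<Longrightarrow> h (inv_into U \<phi> z) = z \<bullet> \<xi>"
    using ex_linear_extension[OF c, of \<xi>] by metis
  show thesis
    using that[of "differential \<A> h x"] differential_in_cotangent_space[OF h]
      frechet_derivative_linear_on[OF W] differential_coord_vector[OF c h] by (simp add: inner_commute)
qed

text \<open>The value of \<open>inv_into\<close> is under control only on the image of the
  coordinate map. That \<open>(z, \<xi>)\<close> lies there requires a covector with prescribed
  components, which \<open>ex_cotangent\<close> supplies as the differential of a smooth
  function.\<close>

lemma cot_chart_inv:
  assumes c: "(U, \<phi>) \<in> \<A>" and z: "z \<in> \<phi> ` U"
  obtains p where "cot_chart_inv \<A> (U, \<phi>) (z, \<xi>) = (inv_into U \<phi> z, p)"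
    "p \<in> cotangent_space \<A> (inv_into U \<phi> z)"
    "\<And>b. b \<in> Basis \<Longrightarrow> p (coord_vector \<A> (U, \<phi>) (inv_into U \<phi> z) b) = \<xi> \<bullet> b"
proof -
  define y where "y = inv_into U \<phi> z"
  have y: "y \<in> U" "\<phi> y = z"
    using z c by (auto simp: y_def)
  obtain q where q: "q \<in> cotangent_space \<A> y"
    "\<And>b. b \<in> Basis \<Longrightarrow> q (coord_vector \<A> (U, \<phi>) y b) = \<xi> \<bullet> b"
    using ex_cotangent[OF c y(1)] by blast
  let ?B = "SIGMA x:U. cotangent_space \<A> x"
  have "cot_chart \<A> (U, \<phi>) (y, q) = (z, \<xi>)"
    unfolding cot_chart_def using y q(2) by (simp add: euclidean_representation)
  then have im: "(z, \<xi>) \<in> cot_chart \<A> (U, \<phi>) ` ?B"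
    using y(1) q(1) by force
  obtain y' p where yp: "cot_chart_inv \<A> (U, \<phi>) (z, \<xi>) = (y', p)"
    by fastforce
  have B: "y' \<in> U" "p \<in> cotangent_space \<A> y'"
    using inv_into_into[OF im] yp unfolding cot_chart_inv_def by auto
  have "cot_chart \<A> (U, \<phi>) (y', p) = (z, \<xi>)"
    using f_inv_into_f[OF im] yp unfolding cot_chart_inv_def by simp
  then have z': "\<phi> y' = z" and \<xi>: "(\<Sum>b\<in>Basis. p (coord_vector \<A> (U, \<phi>) y' b) *\<^sub>R b) = \<xi>"
    unfolding cot_chart_def by auto
  have "y' = y"
    using z' c B by (auto simp: y_def)
  moreover have "p (coord_vector \<A> (U, \<phi>) y' b) = \<xi> \<bullet> b" if "b \<in> Basis" for b
    using that by (simp flip: \<xi>)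
  ultimately show thesis using that yp B by (simp add: y_def)
qed


section \<open>Differential operators and their symbols\<close>

text \<open>An operator is a map on all functions, of which only the values on smooth functions are
  constrained. Linearity is not part of the definition; it follows from the local formula, for
  smooth arguments.\<close>

definition diff_op :: "nat \<Rightarrow> 'm operator \<Rightarrow> bool" where
  "diff_op r D \<longleftrightarrow> (\<forall>f\<in>smooth_functions \<A>. D f \<in> smooth_functions \<A>) \<and>
     (\<forall>c\<in>\<A>. \<exists>a. local_coeffs \<A> c r D a)"

lemma diff_op_smooth: "diff_op r D \<Longrightarrow> f \<in> smooth_functions \<A> \<Longrightarrow> D f \<in> smooth_functions \<A>"
  by (simp add: diff_op_def)

lemma diff_op_coeffs:
  assumes "diff_op r D" "c \<in> \<A>"
  obtains a where "local_coeffs \<A> c r D a"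
  using assms unfolding diff_op_def by blast

lemma local_coeffs_apply:
  assumes "local_coeffs \<A> (U, \<phi>) r D a" "f \<in> smooth_functions \<A>" "x \<in> U"
  shows "D f x = (\<Sum>w\<in>words r. a w (\<phi> x) * partial_deriv w (\<lambda>z. f (inv_into U \<phi> z)) (\<phi> x))"
  using assms unfolding local_coeffs_def by (simp add: o_def)

lemma diff_op_linear:
  assumes D: "diff_op r D" and f: "f \<in> smooth_functions \<A>" and g: "g \<in> smooth_functions \<A>"
  shows "D (\<lambda>y. c * f y + g y) x = c * D f x + D g x"
proof -
  obtain U \<phi> where ch: "(U, \<phi>) \<in> \<A>" "x \<in> U" using ex_chart .
  obtain a where a: "local_coeffs \<A> (U, \<phi>) r D a" using diff_op_coeffs[OF D ch(1)] .
  have h: "(\<lambda>y. c * f y + g y) \<in> smooth_functions \<A>"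
    using f g by (intro smooth_functions_intros)
  have pd: "partial_deriv w (\<lambda>z. c * f (inv_into U \<phi> z) + g (inv_into U \<phi> z)) (\<phi> x) =
      c * partial_deriv w (\<lambda>z. f (inv_into U \<phi> z)) (\<phi> x) +
      partial_deriv w (\<lambda>z. g (inv_into U \<phi> z)) (\<phi> x)" if "w \<in> words r" for w
    using that ch
    by (intro partial_deriv_linear[OF chart_homeomorphism(2)[OF ch(1)]
          smooth_rep[OF f ch(1)] smooth_rep[OF g ch(1)]]) (auto simp: words_def)
  show ?thesis
    unfolding local_coeffs_apply[OF a h ch(2)] local_coeffs_apply[OF a f ch(2)]
      local_coeffs_apply[OF a g ch(2)]
    by (simp add: pd distrib_left sum.distrib sum_distrib_left mult.left_commute)
qed

lemma diff_op_zero: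
  assumes "diff_op r D"
  shows "D (\<lambda>_. 0) x = 0"
  using diff_op_linear[OF assms smooth_functions_const smooth_functions_const, of 1 0 0 x] by simp

lemma diff_op_sum:
  assumes D: "diff_op r D" and "\<And>i. i \<in> I \<Longrightarrow> u i \<in> smooth_functions \<A>"
  shows "D (\<lambda>y. \<Sum>i\<in>I. c i * u i y) x = (\<Sum>i\<in>I. c i * D (u i) x)"
  using assms(2)
proof (induction I rule: infinite_finite_induct)
  case (insert i I)
  then have "D (\<lambda>y. c i * u i y + (\<Sum>i\<in>I. c i * u i y)) x =
      c i * D (u i) x + D (\<lambda>y. \<Sum>i\<in>I. c i * u i y) x"
    by (intro diff_op_linear[OF D] smooth_functions_intros) auto
  then show ?case using insert by simp
qed (simp_all add: diff_op_zero[OF D])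

lemma diff_op_cmult:
  assumes D: "diff_op r D" and "f \<in> smooth_functions \<A>"
  shows "D (\<lambda>y. c * f y) x = c * D f x"
  using diff_op_linear[OF assms smooth_functions_const, of c 0 x] diff_op_zero[OF D] by simp

section \<open>Values of operators on powers, and principal symbols\<close>

text \<open>All words in the local formula have length at most \<open>r \<le> n\<close>, and at a
  zero of \<open>k\<close> only words of length \<open>n\<close> contribute. For
  \<open>n = r\<close> they form \<open>r!\<close> times the top-degree polynomial at
  \<open>dk\<close>, and \<open>u\<close> enters through its value at \<open>x\<close> alone. The
  consequences \<open>diff_op_vanish\<close> and \<open>diff_op_top\<close> are free of
  charts.\<close>

lemma diff_op_power_mult:
  assumes a: "local_coeffs \<A> (U, \<phi>) r D a" and ch: "(U, \<phi>) \<in> \<A>" "x \<in> U"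
    and k: "k \<in> smooth_functions \<A>" and u: "u \<in> smooth_functions \<A>" and "k x = 0" "r \<le> n"
  shows "D (\<lambda>y. k y ^ n * u y) x =
    (if n = r then fact r * (\<Sum>w | w \<in> words r \<and> length w = r. a w (\<phi> x) *
       (\<Prod>b\<leftarrow>w. frechet_derivative (\<lambda>z. k (inv_into U \<phi> z)) (at (\<phi> x)) b)) * u x else 0)"
proof -
  define K where "K z = k (inv_into U \<phi> z)" for z
  have "(\<lambda>y. k y ^ n * u y) \<in> smooth_functions \<A>"
    by (intro smooth_functions_intros k u)
  from local_coeffs_apply[OF a this ch(2)]
  have "D (\<lambda>y. k y ^ n * u y) x =
      (\<Sum>w\<in>words r. a w (\<phi> x) * partial_deriv w (\<lambda>z. K z ^ n * u (inv_into U \<phi> z)) (\<phi> x))"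
    by (simp add: K_def)
  also have "\<dots> = (\<Sum>w\<in>words r. if length w = n
      then a w (\<phi> x) * (fact n * (\<Prod>b\<leftarrow>w. frechet_derivative K (at (\<phi> x)) b) * u x) else 0)"
  proof (rule sum.cong[OF refl])
    fix w :: "'e list" assume "w \<in> words r"
    then have "set w \<subseteq> Basis" "length w \<le> n"
      using \<open>r \<le> n\<close> by (auto simp: words_def)
    from partial_deriv_power_mult_zero[OF chart_homeomorphism(2)[OF ch(1)]
        smooth_rep[OF k ch(1)] smooth_rep[OF u ch(1)] this, of "\<phi> x"]
    show "a w (\<phi> x) * partial_deriv w (\<lambda>z. K z ^ n * u (inv_into U \<phi> z)) (\<phi> x) =
        (if length w = n then a w (\<phi> x) * (fact n * (\<Prod>b\<leftarrow>w. frechet_derivative K (at (\<phi> x)) b) * u x) else 0)"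
      using ch \<open>k x = 0\<close> by (simp add: K_def[abs_def])
  qed
  also have "\<dots> = (\<Sum>w | w \<in> words r \<and> length w = n.
      a w (\<phi> x) * (fact n * (\<Prod>b\<leftarrow>w. frechet_derivative K (at (\<phi> x)) b) * u x))"
    by (intro sum.inter_filter[symmetric]) simp
  also have "\<dots> = (if n = r then fact r * (\<Sum>w | w \<in> words r \<and> length w = r. a w (\<phi> x) *
       (\<Prod>b\<leftarrow>w. frechet_derivative K (at (\<phi> x)) b)) * u x else 0)"
  proof (cases "n = r")
    case True
    then show ?thesis by (simp add: sum_distrib_left sum_distrib_right mult_ac)
  next
    case False
    then have "{w :: 'e list. w \<in> words r \<and> length w = n} = {}"
      using \<open>r \<le> n\<close> by (auto simp: words_def)
    then show ?thesis using False by (simp only: sum.empty if_False)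
  qed
  finally show ?thesis unfolding K_def[abs_def] .
qed

lemma diff_op_vanish:
  assumes D: "diff_op r D" and k: "k \<in> smooth_functions \<A>" "k x = 0" and "u \<in> smooth_functions \<A>" "r < n"
  shows "D (\<lambda>y. k y ^ n * u y) x = 0"
proof -
  obtain U \<phi> where ch: "(U, \<phi>) \<in> \<A>" "x \<in> U" using ex_chart .
  obtain a where a: "local_coeffs \<A> (U, \<phi>) r D a" using diff_op_coeffs[OF D ch(1)] .
  show ?thesis
    using diff_op_power_mult[OF a ch k(1) assms(4) k(2), of n] \<open>r < n\<close> by simp
qed

lemma diff_op_top:
  assumes D: "diff_op r D" and k: "k \<in> smooth_functions \<A>" "k x = 0" and u: "u \<in> smooth_functions \<A>"
  shows "D (\<lambda>y. k y ^ r * u y) x = D (\<lambda>y. k y ^ r) x * u x"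
proof -
  obtain U \<phi> where ch: "(U, \<phi>) \<in> \<A>" "x \<in> U" using ex_chart .
  obtain a where a: "local_coeffs \<A> (U, \<phi>) r D a" using diff_op_coeffs[OF D ch(1)] .
  show ?thesis
    using diff_op_power_mult[OF a ch k(1) u k(2), of r]
      diff_op_power_mult[OF a ch k(1) smooth_functions_const[of 1] k(2), of r] by simp
qed

text \<open>The right-hand side does not mention the coefficients, so the polynomial on the left is
  independent of their choice and of the chart, although the coefficients themselves are
  not.\<close>

lemma local_symbol_eq:
  assumes a: "local_coeffs \<A> (U, \<phi>) r D a" and ch: "(U, \<phi>) \<in> \<A>" "x \<in> U"
    and h: "h \<in> smooth_functions \<A>"
  shows "(\<Sum>w | w \<in> words r \<and> length w = r. a w (\<phi> x) *
      (\<Prod>b\<leftarrow>w. frechet_derivative (\<lambda>z. h (inv_into U \<phi> z)) (at (\<phi> x)) b)) =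
    D (\<lambda>y. (h y - h x) ^ r) x / fact r"
proof -
  have k: "(\<lambda>y. h y - h x) \<in> smooth_functions \<A>"
    by (intro smooth_functions_intros h)
  have d: "frechet_derivative (\<lambda>z. h (inv_into U \<phi> z) - h x) (at (\<phi> x)) =
      frechet_derivative (\<lambda>z. h (inv_into U \<phi> z)) (at (\<phi> x))"
    using has_derivative_diff[OF rep_differentiable[OF ch h, unfolded frechet_derivative_works]
        has_derivative_const[of "h x"]] frechet_derivative_at by fastforce
  show ?thesis
    using diff_op_power_mult[OF a ch k smooth_functions_const[of 1], of r] by (simp add: d)
qed

lemma principal_symbol_eq:
  assumes D: "diff_op r D" and h: "h \<in> smooth_functions \<A>"
  shows "principal_symbol \<A> r D (x, differential \<A> h x) = D (\<lambda>y. (h y - h x) ^ r) x / fact r"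
proof -
  obtain U \<phi> where c: "chart_at \<A> x = (U, \<phi>)" and ch: "(U, \<phi>) \<in> \<A>" "x \<in> U" using chart_at .
  obtain a0 where a0: "local_coeffs \<A> (U, \<phi>) r D a0" using diff_op_coeffs[OF D ch(1)] .
  define a where "a = (SOME a. local_coeffs \<A> (U, \<phi>) r D a)"
  have a: "local_coeffs \<A> (U, \<phi>) r D a"
    unfolding a_def using a0 by (rule someI[of "local_coeffs \<A> (U, \<phi>) r D"])
  show ?thesis
    using differential_in_cotangent_space[OF h, of x] local_symbol_eq[OF a ch h]
    by (simp add: principal_symbol_def cotangent_bundle_def c Let_def differential_coord_vector[OF ch h]
        flip: a_def)
qed

lemma principal_symbol_outside:
  "\<omega> \<notin> cotangent_bundle \<A> \<Longrightarrow> principal_symbol \<A> r D \<omega> = 0"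
  by (auto simp: principal_symbol_def split: prod.splits)

lemma ex_differential:
  assumes ch: "(U, \<phi>) \<in> \<A>" "x \<in> U" and p: "p \<in> cotangent_space \<A> x"
  obtains h W \<xi> where "h \<in> smooth_functions \<A>" "p = differential \<A> h x"
    "open W" "\<phi> x \<in> W" "W \<subseteq> \<phi> ` U" "\<And>z. z \<in> W \<Longrightarrow> h (inv_into U \<phi> z) = z \<bullet> \<xi>"
    "\<And>b. b \<in> Basis \<Longrightarrow> p (coord_vector \<A> (U, \<phi>) x b) = \<xi> \<bullet> b"
proof -
  define \<xi> where "\<xi> = (\<Sum>b\<in>Basis. p (coord_vector \<A> (U, \<phi>) x b) *\<^sub>R b)"
  have \<xi>: "p (coord_vector \<A> (U, \<phi>) x b) = \<xi> \<bullet> b" if "b \<in> Basis" for b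
    unfolding \<xi>_def using that by simp
  obtain h W where h: "h \<in> smooth_functions \<A>" and
    W: "open W" "\<phi> x \<in> W" "W \<subseteq> \<phi> ` U" "\<And>z. z \<in> W \<Longrightarrow> h (inv_into U \<phi> z) = z \<bullet> \<xi>"
    using ex_linear_extension[OF ch, of \<xi>] by metis
  show thesis
    using that[OF h cotangent_eq_differential[OF ch p h W(1,2,4) \<xi>] W \<xi>] .
qed

text \<open>\<open>principal_symbol\<close> uses a separately chosen chart at each point, but
  differentiating a symbol requires one chart on a whole neighbourhood. The two expressions agree
  because both are the value of \<open>D\<close> on the same power.\<close>

lemma principal_symbol_chart:
  assumes D: "diff_op r D" and a: "local_coeffs \<A> (U, \<phi>) r D a" and ch: "(U, \<phi>) \<in> \<A>" "x \<in> U"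
    and p: "p \<in> cotangent_space \<A> x"
  shows "principal_symbol \<A> r D (x, p) =
    (\<Sum>w | w \<in> words r \<and> length w = r. a w (\<phi> x) * (\<Prod>b\<leftarrow>w. p (coord_vector \<A> (U, \<phi>) x b)))"
proof -
  obtain h where h: "h \<in> smooth_functions \<A>" "p = differential \<A> h x"
    using ex_differential[OF ch p] by metis
  show ?thesis
    using principal_symbol_eq[OF D h(1), of x] local_symbol_eq[OF a ch h(1)]
    by (simp add: h(2) differential_coord_vector[OF ch h(1)])
qed

lemma diff_op_diff:
  assumes D: "diff_op r D" and E: "diff_op r E"
  shows "diff_op r (\<lambda>f x. D f x - E f x)"
  unfolding diff_op_def
proof (intro conjI ballI)
  fix f assume "f \<in> smooth_functions \<A>"
  then show "(\<lambda>x. D f x - E f x) \<in> smooth_functions \<A>"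
    by (intro smooth_functions_diff diff_op_smooth[OF D] diff_op_smooth[OF E])
next
  fix c assume c: "c \<in> \<A>"
  obtain U \<phi> where U: "c = (U, \<phi>)" by fastforce
  obtain a where a: "local_coeffs \<A> (U, \<phi>) r D a" using diff_op_coeffs[OF D c] U by blast
  obtain e where e: "local_coeffs \<A> (U, \<phi>) r E e" using diff_op_coeffs[OF E c] U by blast
  have S: "open (\<phi> ` U)" using chart_homeomorphism(2) c U by blast
  have "smooth_on (\<phi> ` U) (\<lambda>z. a w z + (-1) * e w z)" if "w \<in> words r" for w
    using a e that S unfolding local_coeffs_def by (intro smooth_on_add smooth_on_cmult) auto
  then have "local_coeffs \<A> (U, \<phi>) r (\<lambda>f x. D f x - E f x) (\<lambda>w z. a w z - e w z)"
    unfolding local_coeffs_def using a e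
    by (auto simp: local_coeffs_def sum_subtractf left_diff_distrib)
  then show "\<exists>a. local_coeffs \<A> c r (\<lambda>f x. D f x - E f x) a"
    using U by blast
qed

lemma words_Suc: "words (Suc r) = words r \<union> {w \<in> words (Suc r). length w = Suc r}"
  by (auto simp: words_def)

text \<open>The coefficients of top degree need not vanish individually, because derivatives are
  indexed by words; only their symmetrization does.\<close>

lemma diff_op_order_reduction:
  assumes D: "diff_op (Suc r) D"
    and zero: "\<And>x p. p \<in> cotangent_space \<A> x \<Longrightarrow> principal_symbol \<A> (Suc r) D (x, p) = 0"
  shows "diff_op r D"
  unfolding diff_op_def
proof (intro conjI ballI)
  fix f assume "f \<in> smooth_functions \<A>"
  then show "D f \<in> smooth_functions \<A>" by (rule diff_op_smooth[OF D])
next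
  fix c assume c: "c \<in> \<A>"
  obtain U \<phi> where U: "c = (U, \<phi>)" by fastforce
  then have ch: "(U, \<phi>) \<in> \<A>" using c by simp
  obtain a where a: "local_coeffs \<A> (U, \<phi>) (Suc r) D a" using diff_op_coeffs[OF D ch] by blast
  define V :: "'e list set" where "V = {w \<in> words (Suc r). length w = Suc r}"
  have "D f x = (\<Sum>w\<in>words r. a w (\<phi> x) * partial_deriv w (\<lambda>z. f (inv_into U \<phi> z)) (\<phi> x))"
    if f: "f \<in> smooth_functions \<A>" and x: "x \<in> U" for f x
  proof -
    \<comment> \<open>The zero symbol gives a zero polynomial in \<open>\<xi>\<close>, since every
      \<open>\<xi>\<close> is the component vector of a covector. The derivatives of
      \<open>f\<close> depend only on the multiset of the word, so the contraction with them
      vanishes too.\<close>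
    have "(\<Sum>w\<in>V. a w (\<phi> x) * partial_deriv w (\<lambda>z. f (inv_into U \<phi> z)) (\<phi> x)) = 0"
    proof (rule symmetric_contraction_eq_0)
      show "finite V" by (simp add: V_def)
      show B: "set w \<subseteq> Basis" if "w \<in> V" for w
        using that by (simp add: V_def words_def)
      show "(\<Sum>w\<in>V. a w (\<phi> x) * (\<Prod>b\<leftarrow>w. \<xi> \<bullet> b)) = 0" for \<xi>
      proof -
        obtain p where p: "p \<in> cotangent_space \<A> x"
          "\<And>b. b \<in> Basis \<Longrightarrow> p (coord_vector \<A> (U, \<phi>) x b) = \<xi> \<bullet> b"
          using ex_cotangent[OF ch x] by blast
        have "(\<Prod>b\<leftarrow>w. p (coord_vector \<A> (U, \<phi>) x b)) = (\<Prod>b\<leftarrow>w. \<xi> \<bullet> b)" if "w \<in> V" for w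
          using B[OF that] p(2) by (intro arg_cong[where f = prod_list] map_cong) auto
        then show ?thesis
          using principal_symbol_chart[OF D a ch x p(1)] zero[OF p(1)] by (simp add: V_def)
      qed
      show "partial_deriv w (\<lambda>z. f (inv_into U \<phi> z)) (\<phi> x) = partial_deriv w' (\<lambda>z. f (inv_into U \<phi> z)) (\<phi> x)"
        if "w \<in> V" "w' \<in> V" "mset w = mset w'" for w w'
        using x by (intro partial_deriv_mset_cong[OF chart_homeomorphism(2)[OF ch] smooth_rep[OF f ch] that(3) B[OF that(1)]]) auto
    qed
    moreover have "(\<Sum>w\<in>words (Suc r). F w) = (\<Sum>w\<in>words r. F w) + (\<Sum>w\<in>V. F w)" for F :: "'e list \<Rightarrow> real"
      unfolding V_def by (subst words_Suc, subst sum.union_disjoint) (auto simp: words_def intro: finite_subset[OF _ finite_words[of "Suc r"]] finite_lists_length_le)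
    ultimately show ?thesis
      using local_coeffs_apply[OF a f x] by simp
  qed
  moreover have "smooth_on (\<phi> ` U) (a w)" if "w \<in> words r" for w
    using a that unfolding local_coeffs_def by (auto simp: words_def)
  ultimately have "local_coeffs \<A> (U, \<phi>) r D a"
    unfolding local_coeffs_def by (simp add: o_def)
  then show "\<exists>a. local_coeffs \<A> c r D a"
    using U by blast
qed

section \<open>Composition and commutators of differential operators\<close>

text \<open>This is \<open>j!\<close> times the coefficient of \<open>t^j\<close> in the formal
  series \<open>exp(-t k) D (exp(t k))\<close>. For an operator of order at most \<open>r\<close> it
  vanishes for \<open>j > r\<close>, and for \<open>j = r\<close> it is \<open>r!\<close> times the
  symbol along \<open>dk\<close>.\<close>

definition lower_coeff :: "'m operator \<Rightarrow> ('m \<Rightarrow> real) \<Rightarrow> nat \<Rightarrow> 'm \<Rightarrow> real" where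
  "lower_coeff D k j y = D (\<lambda>z. (k z - k y) ^ j) y"

text \<open>The function to which \<open>D\<close> is applied changes with the point
  \<open>y\<close>. Binomial expansion of \<open>(k - k y)^j\<close> moves this dependence into
  smooth factors and leaves \<open>D\<close> acting on fixed powers of \<open>k\<close>.\<close>

lemma lower_coeff_smooth:
  assumes D: "diff_op r D" and k: "k \<in> smooth_functions \<A>"
  shows "lower_coeff D k j \<in> smooth_functions \<A>"
proof -
  have "lower_coeff D k j = (\<lambda>y. \<Sum>i\<le>j. (real (j choose i) * (- k y) ^ (j - i)) * D (\<lambda>z. k z ^ i) y)"
  proof
    fix y
    have "(\<lambda>z. (k z - k y) ^ j) = (\<lambda>z. \<Sum>i\<le>j. (real (j choose i) * (- k y) ^ (j - i)) * k z ^ i)"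
      using binomial_ring[of "k z" "- k y" j for z] by (auto simp: mult_ac)
    then show "lower_coeff D k j y = (\<Sum>i\<le>j. (real (j choose i) * (- k y) ^ (j - i)) * D (\<lambda>z. k z ^ i) y)"
      unfolding lower_coeff_def using smooth_functions_power[OF k] by (simp add: diff_op_sum[OF D])
  qed
  also have "(\<lambda>y. \<Sum>i\<le>j. (real (j choose i) * (- k y) ^ (j - i)) * D (\<lambda>z. k z ^ i) y) =
      (\<lambda>y. \<Sum>i\<le>j. (real (j choose i) * (-1 * k y) ^ (j - i)) * D (\<lambda>z. k z ^ i) y)"
    by simp
  also have "\<dots> \<in> smooth_functions \<A>"
    by (intro smooth_functions_sum smooth_functions_mult smooth_functions_cmult smooth_functions_const
        smooth_functions_power diff_op_smooth[OF D] k)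
  finally show ?thesis .
qed

lemma lower_coeff_eq_0:
  assumes "diff_op r D" "k \<in> smooth_functions \<A>" "r < j"
  shows "lower_coeff D k j y = 0"
  using diff_op_vanish[OF assms(1), of "\<lambda>z. k z - k y" y "\<lambda>_. 1" j] assms(2,3)
  by (simp add: lower_coeff_def smooth_functions_intros)

lemma lower_coeff_zero: "k x = 0 \<Longrightarrow> lower_coeff D k j x = D (\<lambda>z. k z ^ j) x"
  by (simp add: lower_coeff_def)

lemma diff_op_power_expand:
  assumes D: "diff_op r D" and k: "k \<in> smooth_functions \<A>"
  shows "D (\<lambda>z. k z ^ n) = (\<lambda>y. \<Sum>j\<le>n. real (n choose j) * (k y ^ (n - j) * lower_coeff D k j y))"
proof
  fix y
  have "(\<lambda>z. k z ^ n) = (\<lambda>z. \<Sum>j\<le>n. (real (n choose j) * k y ^ (n - j)) * (k z - k y) ^ j)"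
    using binomial_ring[of "k z - k y" "k y" n for z] by (auto simp: mult_ac)
  then have "D (\<lambda>z. k z ^ n) y = (\<Sum>j\<le>n. (real (n choose j) * k y ^ (n - j)) * D (\<lambda>z. (k z - k y) ^ j) y)"
    using k by (simp add: diff_op_sum[OF D] smooth_functions_intros)
  then show "D (\<lambda>z. k z ^ n) y = (\<Sum>j\<le>n. real (n choose j) * (k y ^ (n - j) * lower_coeff D k j y))"
    by (simp add: lower_coeff_def mult.assoc)
qed

lemma diff_op_compose_expand:
  assumes A: "diff_op r A" and B: "diff_op s B" and k: "k \<in> smooth_functions \<A>"
  shows "A (B (\<lambda>z. k z ^ n)) x =
    (\<Sum>j\<le>n. real (n choose j) * A (\<lambda>y. k y ^ (n - j) * lower_coeff B k j y) x)"
  unfolding diff_op_power_expand[OF B k]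
  by (intro diff_op_sum[OF A] smooth_functions_mult smooth_functions_power k lower_coeff_smooth[OF B])

text \<open>Either more than \<open>r\<close> factors \<open>k\<close> remain and \<open>A\<close>
  annihilates the product at \<open>x\<close>, or \<open>j\<close> exceeds the order of
  \<open>B\<close> and the coefficient is identically 0.\<close>

lemma diff_op_compose_zero:
  assumes A: "diff_op r A" and B: "diff_op s B" and k: "k \<in> smooth_functions \<A>" "k x = 0"
    and "j \<le> n" "r + j < n \<or> s < j"
  shows "A (\<lambda>y. k y ^ (n - j) * lower_coeff B k j y) x = 0"
  using assms(6)
proof
  assume "r + j < n"
  then show ?thesis
    by (intro diff_op_vanish[OF A k lower_coeff_smooth[OF B k(1)]]) simp
next
  assume "s < j"
  then show ?thesis
    by (simp add: lower_coeff_eq_0[OF B k(1)] diff_op_zero[OF A])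
qed

text \<open>Terms with \<open>j < s\<close> leave more than \<open>r\<close> factors
  \<open>k\<close> for \<open>A\<close>, and those with \<open>j > s\<close> have coefficient 0. The
  binomial coefficient of the remaining term \<open>j = s\<close> converts \<open>(r + s)!\<close>
  into \<open>r! s!\<close>.\<close>

lemma symbol_compose:
  assumes A: "diff_op r A" and B: "diff_op s B" and k: "k \<in> smooth_functions \<A>" "k x = 0"
  shows "A (B (\<lambda>z. k z ^ (r + s))) x / fact (r + s) =
    (A (\<lambda>z. k z ^ r) x / fact r) * (B (\<lambda>z. k z ^ s) x / fact s)"
proof -
  let ?n = "r + s"
  have "A (B (\<lambda>z. k z ^ ?n)) x =
      (\<Sum>j\<in>{s}. real (?n choose j) * A (\<lambda>y. k y ^ (?n - j) * lower_coeff B k j y) x)"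
    unfolding diff_op_compose_expand[OF A B k(1)]
  proof (rule sum.mono_neutral_right)
    show "\<forall>j\<in>{..?n} - {s}. real (?n choose j) * A (\<lambda>y. k y ^ (?n - j) * lower_coeff B k j y) x = 0"
    proof
      fix j assume "j \<in> {..?n} - {s}"
      then show "real (?n choose j) * A (\<lambda>y. k y ^ (?n - j) * lower_coeff B k j y) x = 0"
        using diff_op_compose_zero[OF A B k, of j ?n] by (cases j s rule: linorder_cases) auto
    qed
  qed auto
  also have "\<dots> = real (?n choose s) * (A (\<lambda>z. k z ^ r) x * B (\<lambda>z. k z ^ s) x)"
    using diff_op_top[OF A k lower_coeff_smooth[OF B k(1)], of s] lower_coeff_zero[of k x B s] k(2) by simp
  finally show ?thesis
    by (simp add: binomial_fact)
qed

text \<open>With \<open>p = dk\<close> at \<open>x\<close>, this is the derivative of the symbol of \<open>D\<close> at \<open>(x, p)\<close> in the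
  fibre direction \<open>dl\<close>.\<close>

definition fibre_deriv :: "nat \<Rightarrow> 'm operator \<Rightarrow> ('m \<Rightarrow> real) \<Rightarrow> 'm \<Rightarrow> ('m \<Rightarrow> real) \<Rightarrow> real" where
  "fibre_deriv r D k x l =
     (if r = 0 then 0 else D (\<lambda>y. k y ^ (r - 1) * (l y - l x)) x / fact (r - 1))"

text \<open>The value on one power less than the order. Unlike a symbol it may involve second
  derivatives of \<open>k\<close> at \<open>x\<close>; it drops out of commutators.\<close>

definition low_symbol :: "nat \<Rightarrow> 'm operator \<Rightarrow> ('m \<Rightarrow> real) \<Rightarrow> 'm \<Rightarrow> real" where
  "low_symbol r D k x = (if r = 0 then 0 else D (\<lambda>y. k y ^ (r - 1)) x / fact (r - 1))"

text \<open>The symbol of \<open>D\<close> pulled back along the section \<open>dk\<close> of the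
  cotangent bundle.\<close>

definition symbol_along :: "nat \<Rightarrow> 'm operator \<Rightarrow> ('m \<Rightarrow> real) \<Rightarrow> 'm \<Rightarrow> real" where
  "symbol_along r D k y = lower_coeff D k r y / fact r"

text \<open>With one factor \<open>k\<close> less than in \<open>symbol_compose\<close>, the indices
  \<open>j = s - 1\<close> and \<open>j = s\<close> survive. The first leaves \<open>r\<close>
  factors \<open>k\<close> for \<open>A\<close> and gives the symbol of \<open>A\<close> times the
  lower value of \<open>B\<close>. The second leaves only \<open>r - 1\<close>, so \<open>A\<close>
  also sees the variation of the symbol of \<open>B\<close>: splitting that function into its value
  at \<open>x\<close> and the difference gives the lower value of \<open>A\<close> and the fibre
  derivative.\<close>

lemma symbol_compose_subleading:
  assumes A: "diff_op r A" and B: "diff_op s B" and k: "k \<in> smooth_functions \<A>" "k x = 0"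
    and n: "r + s = Suc n"
  shows "A (B (\<lambda>z. k z ^ n)) x / fact n = fibre_deriv r A k x (symbol_along s B k) +
    low_symbol r A k x * symbol_along s B k x + symbol_along r A k x * low_symbol s B k x"
proof -
  define g where "g j = real (n choose j) * A (\<lambda>y. k y ^ (n - j) * lower_coeff B k j y) x" for j
  have AB: "A (B (\<lambda>z. k z ^ n)) x = (\<Sum>j\<le>n. g j)"
    unfolding g_def diff_op_compose_expand[OF A B k(1)] ..
  have g0: "g j = 0" if "j \<le> n" "r + j < n \<or> s < j" for j
    unfolding g_def using diff_op_compose_zero[OF A B k that] by simp
  note sm = lower_coeff_smooth[OF B k(1)]
  have g_low: "g m / fact n = symbol_along r A k x * low_symbol s B k x" if s: "s = Suc m" for m
  proof -
    have nm: "n = r + m" using n s by simp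
    have "g m = real (n choose m) * (A (\<lambda>z. k z ^ r) x * B (\<lambda>z. k z ^ m) x)"
      unfolding g_def using diff_op_top[OF A k sm, of m] lower_coeff_zero[of k x B m] k(2) nm by simp
    moreover have "real (n choose m) / fact n = 1 / (fact m * fact r)"
      by (simp add: nm binomial_fact)
    ultimately have "g m / fact n = 1 / (fact m * fact r) * (A (\<lambda>z. k z ^ r) x * B (\<lambda>z. k z ^ m) x)"
      by (metis times_divide_eq_left)
    then show ?thesis
      using s lower_coeff_zero[of k x A r] k(2)
      by (simp add: symbol_along_def low_symbol_def)
  qed
  have g_top: "g s / fact n = fibre_deriv r A k x (symbol_along s B k) + low_symbol r A k x * symbol_along s B k x"
    if r: "r = Suc m" for m
  proof -
    have nm: "n = m + s" using n r by simp
    define l where "l = symbol_along s B k"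
    have l: "l \<in> smooth_functions \<A>"
      unfolding l_def symbol_along_def[abs_def]
      using smooth_functions_cmult[OF sm, of "1 / fact s" s] by simp
    have bl: "lower_coeff B k s y = fact s * l y" for y
      by (simp add: l_def symbol_along_def)
    have "A (\<lambda>y. k y ^ m * lower_coeff B k s y) x =
        A (\<lambda>y. fact s * (k y ^ m * (l y - l x)) + (fact s * l x) * k y ^ m) x"
      by (simp add: bl algebra_simps)
    also have "\<dots> = fact s * A (\<lambda>y. k y ^ m * (l y - l x)) x + A (\<lambda>y. (fact s * l x) * k y ^ m) x"
      by (intro diff_op_linear[OF A] smooth_functions_intros k l)
    also have "A (\<lambda>y. (fact s * l x) * k y ^ m) x = (fact s * l x) * A (\<lambda>y. k y ^ m) x"
      by (intro diff_op_cmult[OF A] smooth_functions_intros k)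
    finally have "g s = real (n choose s) * fact s * (A (\<lambda>y. k y ^ m * (l y - l x)) x + l x * A (\<lambda>y. k y ^ m) x)"
      unfolding g_def nm by (simp add: algebra_simps)
    moreover have "real (n choose s) * fact s / fact n = 1 / fact m"
      by (simp add: nm binomial_fact)
    ultimately have "g s / fact n = 1 / fact m * (A (\<lambda>y. k y ^ m * (l y - l x)) x + l x * A (\<lambda>y. k y ^ m) x)"
      by (metis times_divide_eq_left)
    then show ?thesis
      unfolding fibre_deriv_def low_symbol_def l_def[symmetric] by (simp add: r add_divide_distrib mult.commute)
  qed
  \<comment> \<open>If \<open>r\<close> or \<open>s\<close> is 0, one of the two indices is out of
    range. The value 0 of \<open>fibre_deriv\<close> and \<open>low_symbol\<close> in degree 0
    accounts for the missing terms.\<close>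
  show ?thesis
  proof (cases r)
    case 0
    then have s: "s = Suc n" using n by simp
    have "(\<Sum>j\<le>n. g j) = (\<Sum>j\<in>{n}. g j)"
      using g0 0 by (intro sum.mono_neutral_right) auto
    then show ?thesis
      using AB g_low[OF s] 0 by (simp add: fibre_deriv_def low_symbol_def)
  next
    case (Suc m)
    have nm: "n = m + s" using n Suc by simp
    show ?thesis
    proof (cases s)
      case 0
      have "(\<Sum>j\<le>n. g j) = (\<Sum>j\<in>{s}. g j)"
        using g0 0 by (intro sum.mono_neutral_right) auto
      then show ?thesis
        using AB g_top[OF Suc] 0 by (simp add: low_symbol_def[of 0])
    next
      case s: (Suc t)
      have "(\<Sum>j\<le>n. g j) = (\<Sum>j\<in>{s, t}. g j)"
      proof (rule sum.mono_neutral_right)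
        show "\<forall>j\<in>{..n} - {s, t}. g j = 0"
        proof
          fix j assume "j \<in> {..n} - {s, t}"
          then show "g j = 0"
            using nm s Suc by (intro g0) auto
        qed
      qed (use nm s in auto)
      then have "(\<Sum>j\<le>n. g j) = g s + g t"
        using s by simp
      then show ?thesis
        using AB g_top[OF Suc] g_low[OF s] by (simp add: add_divide_distrib)
    qed
  qed
qed

text \<open>Exchanging the operators exchanges the last two products of
  \<open>symbol_compose_subleading\<close>, so only the fibre derivatives are left in the
  difference.\<close>

corollary symbol_commutator:
  assumes "diff_op r A" "diff_op s B" "k \<in> smooth_functions \<A>" "k x = 0" "r + s = Suc n"
  shows "(A (B (\<lambda>z. k z ^ n)) x - B (A (\<lambda>z. k z ^ n)) x) / fact n =
    fibre_deriv r A k x (symbol_along s B k) - fibre_deriv s B k x (symbol_along r A k)"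
  using symbol_compose_subleading[OF assms] symbol_compose_subleading[OF assms(2,1,3,4), of n] assms(5)
  by (simp add: diff_divide_distrib)

section \<open>The Poisson bracket of symbols\<close>

text \<open>In the base direction, \<open>dh\<close> has constant components \<open>\<xi>\<close> on
  \<open>W\<close>, so the symbol at \<open>(z, \<xi>)\<close> is the symbol along
  \<open>dk\<close>. In the fibre direction, the points \<open>\<xi> + t \<eta>\<close>, with
  \<open>\<eta>\<close> the components of \<open>dl\<close>, belong to the differentials of
  \<open>h + t l\<close>. Evaluation of \<open>A\<close> on the \<open>r\<close>-th power of this
  function minus its value at \<open>x\<close> is a polynomial in \<open>t\<close>, and the linear
  coefficient gives \<open>fibre_deriv\<close>.\<close>

lemma symbol_derivative:
  assumes A: "diff_op r A" and ch: "(U, \<phi>) \<in> \<A>" "x \<in> U" and h: "h \<in> smooth_functions \<A>"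
    and W: "open W" "\<phi> x \<in> W" "W \<subseteq> \<phi> ` U" "\<And>z. z \<in> W \<Longrightarrow> h (inv_into U \<phi> z) = z \<bullet> \<xi>"
  defines "k \<equiv> \<lambda>y. h y - h x"
  obtains D where "linear D"
    "frechet_derivative (principal_symbol \<A> r A \<circ> cot_chart_inv \<A> (U, \<phi>)) (at (\<phi> x, \<xi>)) = D"
    "\<And>v. D (v, 0) = frechet_derivative (\<lambda>z. symbol_along r A k (inv_into U \<phi> z)) (at (\<phi> x)) v"
    "\<And>l. l \<in> smooth_functions \<A> \<Longrightarrow>
      D (0, \<Sum>b\<in>Basis. frechet_derivative (\<lambda>z. l (inv_into U \<phi> z)) (at (\<phi> x)) b *\<^sub>R b) =
      fibre_deriv r A k x l"
proof -
  obtain a where a: "local_coeffs \<A> (U, \<phi>) r A a" using diff_op_coeffs[OF A ch(1)] .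
  have S: "open (\<phi> ` U)" using chart_homeomorphism(2)[OF ch(1)] .
  define V :: "'e list set" where "V = {w. w \<in> words r \<and> length w = r}"
  have VB: "set w \<subseteq> Basis" "w \<in> words r" if "w \<in> V" for w
    using that by (auto simp: V_def words_def)
  define P where "P q = (\<Sum>w\<in>V. a w (fst q) * (\<Prod>b\<leftarrow>w. snd q \<bullet> b))" for q :: "'e \<times> 'e"
  have "\<exists>D. ((\<lambda>q. a w (fst q) * (\<Prod>b\<leftarrow>w. snd q \<bullet> b)) has_derivative D) (at (\<phi> x, \<xi>))" if "w \<in> V" for w
  proof -
    have "smooth_on (\<phi> ` U) (a w)"
      using a VB(2)[OF that] unfolding local_coeffs_def by auto
    then have "(a w has_derivative frechet_derivative (a w) (at (\<phi> x))) (at (fst (\<phi> x, \<xi>)))"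
      using smooth_on_has_derivative[OF S] ch(2) by auto
    from has_derivative_compose[OF has_derivative_fst[OF has_derivative_ident] this]
    show ?thesis
      using prod_list_has_derivative[of w "(\<phi> x, \<xi>)"] has_derivative_mult by fast
  qed
  then obtain E where "\<And>w. w \<in> V \<Longrightarrow>
      ((\<lambda>q. a w (fst q) * (\<Prod>b\<leftarrow>w. snd q \<bullet> b)) has_derivative E w) (at (\<phi> x, \<xi>))"
    by metis
  then have "(P has_derivative (\<lambda>v. \<Sum>w\<in>V. E w v)) (at (\<phi> x, \<xi>))"
    unfolding P_def by (rule has_derivative_sum)
  then obtain D where D: "(P has_derivative D) (at (\<phi> x, \<xi>))" by blast
  have P_eq: "(principal_symbol \<A> r A \<circ> cot_chart_inv \<A> (U, \<phi>)) q = P q" if q: "q \<in> (\<phi> ` U) \<times> UNIV" for q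
  proof -
    obtain z \<eta> where z: "q = (z, \<eta>)" "z \<in> \<phi> ` U" using q by blast
    then have iz: "inv_into U \<phi> z \<in> U" "\<phi> (inv_into U \<phi> z) = z"
      using ch(1) by auto
    obtain p where p: "cot_chart_inv \<A> (U, \<phi>) (z, \<eta>) = (inv_into U \<phi> z, p)"
      "p \<in> cotangent_space \<A> (inv_into U \<phi> z)"
      "\<And>b. b \<in> Basis \<Longrightarrow> p (coord_vector \<A> (U, \<phi>) (inv_into U \<phi> z) b) = \<eta> \<bullet> b"
      using cot_chart_inv[OF ch(1) z(2)] by blast
    have "(\<Prod>b\<leftarrow>w. p (coord_vector \<A> (U, \<phi>) (inv_into U \<phi> z) b)) = (\<Prod>b\<leftarrow>w. \<eta> \<bullet> b)" if "w \<in> V" for w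
      using VB(1)[OF that] p(3) by (intro arg_cong[where f = prod_list] map_cong) auto
    then show ?thesis
      using principal_symbol_chart[OF A a ch(1) iz(1) p(2)] iz(2)
      by (simp add: z(1) p(1) P_def flip: V_def)
  qed
  have "open ((\<phi> ` U) \<times> (UNIV :: 'e set))"
    using S by (intro open_Times) auto
  then have FD: "frechet_derivative (principal_symbol \<A> r A \<circ> cot_chart_inv \<A> (U, \<phi>)) (at (\<phi> x, \<xi>)) = D"
    using frechet_derivative_cong_open[of "(\<phi> ` U) \<times> UNIV" "(\<phi> x, \<xi>)"
        "principal_symbol \<A> r A \<circ> cot_chart_inv \<A> (U, \<phi>)" P] P_eq ch(2)
      frechet_derivative_at[OF D] by auto
  have D1: "D (v, 0) = frechet_derivative (\<lambda>z. symbol_along r A k (inv_into U \<phi> z)) (at (\<phi> x)) v" for v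
  proof -
    have "((\<lambda>z. (z, \<xi>)) has_derivative (\<lambda>v. (v, 0))) (at (\<phi> x))"
      by (auto intro!: derivative_eq_intros)
    from has_derivative_compose[OF this D]
    have "((\<lambda>z. P (z, \<xi>)) has_derivative (\<lambda>v. D (v, 0))) (at (\<phi> x))" .
    then have "((\<lambda>z. symbol_along r A k (inv_into U \<phi> z)) has_derivative (\<lambda>v. D (v, 0))) (at (\<phi> x))"
    proof (rule has_derivative_transform_within_open[OF _ W(1,2)])
      fix z assume z: "z \<in> W"
      then have iz: "inv_into U \<phi> z \<in> U" "\<phi> (inv_into U \<phi> z) = z"
        using ch(1) W(3) by auto
      show "P (z, \<xi>) = symbol_along r A k (inv_into U \<phi> z)"
        using local_symbol_eq[OF a ch(1) iz(1) h] frechet_derivative_linear_on[OF W(1) z W(4)]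
        by (simp add: iz(2) P_def symbol_along_def lower_coeff_def k_def inner_commute flip: V_def)
    qed
    from frechet_derivative_eqI[OF this] show ?thesis by simp
  qed
  have D2: "D (0, \<Sum>b\<in>Basis. frechet_derivative (\<lambda>z. l (inv_into U \<phi> z)) (at (\<phi> x)) b *\<^sub>R b) =
      fibre_deriv r A k x l" if l: "l \<in> smooth_functions \<A>" for l
  proof -
    define \<eta> where "\<eta> = (\<Sum>b\<in>Basis. frechet_derivative (\<lambda>z. l (inv_into U \<phi> z)) (at (\<phi> x)) b *\<^sub>R b)"
    have \<eta>: "\<eta> \<bullet> b = frechet_derivative (\<lambda>z. l (inv_into U \<phi> z)) (at (\<phi> x)) b" if "b \<in> Basis" for b
      unfolding \<eta>_def using that by simp
    \<comment> \<open>The coefficient of \<open>t^i\<close> in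
      \<open>A ((t (l - l x) + k)^r) x / r!\<close>. For \<open>i = 1\<close> the factor
      \<open>r / r!\<close> becomes \<open>1 / (r - 1)!\<close>.\<close>
    define c where "c i = real (r choose i) * A (\<lambda>y. (l y - l x) ^ i * k y ^ (r - i)) x / fact r" for i
    have P_line: "P (\<phi> x, \<xi> + t *\<^sub>R \<eta>) = (\<Sum>i\<le>r. c i * t ^ i)" for t
    proof -
      define h' where "h' y = t * l y + h y" for y
      have h': "h' \<in> smooth_functions \<A>"
        unfolding h'_def by (intro smooth_functions_intros h l)
      have fd: "frechet_derivative (\<lambda>z. h' (inv_into U \<phi> z)) (at (\<phi> x)) b = (\<xi> + t *\<^sub>R \<eta>) \<bullet> b"
        if "b \<in> Basis" for b
      proof -
        have "((\<lambda>z. t * l (inv_into U \<phi> z) + h (inv_into U \<phi> z)) has_derivative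
            (\<lambda>v. t * frechet_derivative (\<lambda>z. l (inv_into U \<phi> z)) (at (\<phi> x)) v +
               frechet_derivative (\<lambda>z. h (inv_into U \<phi> z)) (at (\<phi> x)) v)) (at (\<phi> x))"
          using rep_differentiable[OF ch l] rep_differentiable[OF ch h]
          unfolding frechet_derivative_works
          by (intro has_derivative_add has_derivative_mult_right)
        from frechet_derivative_eqI[OF this, of b] show ?thesis
          using \<eta>[OF that] frechet_derivative_linear_on[OF W(1,2,4), of b]
          by (simp add: h'_def inner_left_distrib inner_commute[of b \<xi>])
      qed
      have "(\<Prod>b\<leftarrow>w. frechet_derivative (\<lambda>z. h' (inv_into U \<phi> z)) (at (\<phi> x)) b) =
          (\<Prod>b\<leftarrow>w. (\<xi> + t *\<^sub>R \<eta>) \<bullet> b)" if "w \<in> V" for w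
        using VB(1)[OF that] fd by (intro arg_cong[where f = prod_list] map_cong) auto
      then have "P (\<phi> x, \<xi> + t *\<^sub>R \<eta>) = A (\<lambda>y. (h' y - h' x) ^ r) x / fact r"
        using local_symbol_eq[OF a ch h'] by (simp add: P_def flip: V_def)
      also have "(\<lambda>y. (h' y - h' x) ^ r) =
          (\<lambda>y. \<Sum>i\<le>r. (real (r choose i) * t ^ i) * ((l y - l x) ^ i * k y ^ (r - i)))"
      proof
        fix y
        have "h' y - h' x = t * (l y - l x) + k y"
          by (simp add: h'_def k_def algebra_simps)
        then show "(h' y - h' x) ^ r = (\<Sum>i\<le>r. (real (r choose i) * t ^ i) * ((l y - l x) ^ i * k y ^ (r - i)))"
          by (simp only: binomial_ring power_mult_distrib mult.assoc)
      qed
      also have "A (\<lambda>y. \<Sum>i\<le>r. (real (r choose i) * t ^ i) * ((l y - l x) ^ i * k y ^ (r - i))) x =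
          (\<Sum>i\<le>r. (real (r choose i) * t ^ i) * A (\<lambda>y. (l y - l x) ^ i * k y ^ (r - i)) x)"
        unfolding k_def by (intro diff_op_sum[OF A] smooth_functions_intros h l)
      finally show ?thesis
        by (simp add: c_def sum_divide_distrib mult_ac)
    qed
    have "((\<lambda>t. (\<phi> x, \<xi> + t *\<^sub>R \<eta>)) has_derivative (\<lambda>t. (0, t *\<^sub>R \<eta>))) (at 0)"
      by (auto intro!: derivative_eq_intros)
    moreover have "(P has_derivative D) (at (\<phi> x, \<xi> + 0 *\<^sub>R \<eta>))" using D by simp
    ultimately have "((\<lambda>t. P (\<phi> x, \<xi> + t *\<^sub>R \<eta>)) has_derivative (\<lambda>t. D (0, t *\<^sub>R \<eta>))) (at 0)"
      by (rule has_derivative_compose)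
    moreover have "D (0, t *\<^sub>R \<eta>) = D (0, \<eta>) * t" for t
      using linear_cmul[OF has_derivative_linear[OF D], of t "(0, \<eta>)"] by simp
    ultimately have "((\<lambda>t. P (\<phi> x, \<xi> + t *\<^sub>R \<eta>)) has_real_derivative D (0, \<eta>)) (at 0)"
      by (simp add: has_field_derivative_def)
    then have "D (0, \<eta>) = (if r = 0 then 0 else c 1)"
      unfolding P_line using DERIV_unique polynomial_has_derivative_at_0 by blast
    also have "\<dots> = fibre_deriv r A k x l"
      by (cases r) (auto simp: c_def fibre_deriv_def mult.commute simp del: of_nat_Suc)
    finally show ?thesis unfolding \<eta>_def .
  qed
  show thesis
    using that[OF has_derivative_linear[OF D] FD D1 D2] .
qed

lemma symbol_along_smooth:
  assumes "diff_op r A" "k \<in> smooth_functions \<A>"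
  shows "symbol_along r A k \<in> smooth_functions \<A>"
  unfolding symbol_along_def[abs_def]
  using smooth_functions_cmult[OF lower_coeff_smooth[OF assms], of "1 / fact r" r] by simp

lemma cot_bracket_principal_symbol:
  assumes A: "diff_op r A" and B: "diff_op s B" and n: "r + s = Suc n"
    and c: "chart_at \<A> x = (U, \<phi>)" and ch: "(U, \<phi>) \<in> \<A>" "x \<in> U" and h: "h \<in> smooth_functions \<A>"
    and W: "open W" "\<phi> x \<in> W" "W \<subseteq> \<phi> ` U" "\<And>z. z \<in> W \<Longrightarrow> h (inv_into U \<phi> z) = z \<bullet> \<xi>"
  shows "cot_bracket \<A> (principal_symbol \<A> r A) (principal_symbol \<A> s B) (x, differential \<A> h x) =
    (A (B (\<lambda>y. (h y - h x) ^ n)) x - B (A (\<lambda>y. (h y - h x) ^ n)) x) / fact n"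
proof -
  define k where "k = (\<lambda>y. h y - h x)"
  have k: "k \<in> smooth_functions \<A>" "k x = 0"
    unfolding k_def using h by (auto intro!: smooth_functions_intros)
  obtain DA where DA: "linear DA"
    "frechet_derivative (principal_symbol \<A> r A \<circ> cot_chart_inv \<A> (U, \<phi>)) (at (\<phi> x, \<xi>)) = DA"
    "\<And>v. DA (v, 0) = frechet_derivative (\<lambda>z. symbol_along r A k (inv_into U \<phi> z)) (at (\<phi> x)) v"
    "\<And>l. l \<in> smooth_functions \<A> \<Longrightarrow>
      DA (0, \<Sum>b\<in>Basis. frechet_derivative (\<lambda>z. l (inv_into U \<phi> z)) (at (\<phi> x)) b *\<^sub>R b) =
      fibre_deriv r A k x l"
    by (rule symbol_derivative[OF A ch h W, folded k_def], assumption, rule that)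
  obtain DB where DB: "linear DB"
    "frechet_derivative (principal_symbol \<A> s B \<circ> cot_chart_inv \<A> (U, \<phi>)) (at (\<phi> x, \<xi>)) = DB"
    "\<And>v. DB (v, 0) = frechet_derivative (\<lambda>z. symbol_along s B k (inv_into U \<phi> z)) (at (\<phi> x)) v"
    "\<And>l. l \<in> smooth_functions \<A> \<Longrightarrow>
      DB (0, \<Sum>b\<in>Basis. frechet_derivative (\<lambda>z. l (inv_into U \<phi> z)) (at (\<phi> x)) b *\<^sub>R b) =
      fibre_deriv s B k x l"
    by (rule symbol_derivative[OF B ch h W, folded k_def], assumption, rule that)
  \<comment> \<open>With \<open>u b = DB (b, 0)\<close>, the first half of the coordinate sum in the
    bracket becomes a single value of \<open>DA\<close>, in the fibre direction given by the
    differential of the symbol of \<open>B\<close> along \<open>dk\<close>. The second half is the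
    same with \<open>A\<close> and \<open>B\<close> exchanged.\<close>
  have expand: "E (0, \<Sum>b\<in>Basis. u b *\<^sub>R b) = (\<Sum>b\<in>Basis. E (0, b) * u b)"
    if E: "linear E" for E :: "'e \<times> 'e \<Rightarrow> real" and u :: "'e \<Rightarrow> real"
  proof -
    have "(0, \<Sum>b\<in>Basis. u b *\<^sub>R b) = (\<Sum>b\<in>Basis. u b *\<^sub>R (0 :: 'e, b))"
      by (simp add: prod_eq_iff fst_sum snd_sum)
    moreover have "E (0, u b *\<^sub>R b) = E (0, b) * u b" for b
      using linear_cmul[OF E, of "u b" "(0, b)"] by simp
    ultimately show ?thesis
      using linear_sum[OF E, of "\<lambda>b. u b *\<^sub>R (0, b)" Basis] by simp
  qed
  have "(\<Sum>b\<in>Basis. differential \<A> h x (coord_vector \<A> (U, \<phi>) x b) *\<^sub>R b) = (\<Sum>b\<in>Basis. (\<xi> \<bullet> b) *\<^sub>R b)"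
    by (intro sum.cong refl)
      (simp add: differential_coord_vector[OF ch h] frechet_derivative_linear_on[OF W(1,2,4)] inner_commute)
  then have cc: "cot_chart \<A> (U, \<phi>) (x, differential \<A> h x) = (\<phi> x, \<xi>)"
    by (simp add: cot_chart_def euclidean_representation)
  have "(x, differential \<A> h x) \<in> cotangent_bundle \<A>"
    using differential_in_cotangent_space[OF h] by (simp add: cotangent_bundle_def)
  then have "cot_bracket \<A> (principal_symbol \<A> r A) (principal_symbol \<A> s B) (x, differential \<A> h x) =
      (\<Sum>b\<in>Basis. DA (0, b) * DB (b, 0) - DA (b, 0) * DB (0, b))"
    by (simp add: cot_bracket_def c cc DA(2) DB(2))
  also have "\<dots> = (\<Sum>b\<in>Basis. DA (0, b) * DB (b, 0)) - (\<Sum>b\<in>Basis. DB (0, b) * DA (b, 0))"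
    by (simp add: sum_subtractf mult.commute)
  also have "(\<Sum>b\<in>Basis. DA (0, b) * DB (b, 0)) = fibre_deriv r A k x (symbol_along s B k)"
    unfolding DB(3) using DA(4)[OF symbol_along_smooth[OF B k(1)]] expand[OF DA(1)] by simp
  also have "(\<Sum>b\<in>Basis. DB (0, b) * DA (b, 0)) = fibre_deriv s B k x (symbol_along r A k)"
    unfolding DA(3) using DB(4)[OF symbol_along_smooth[OF A k(1)]] expand[OF DB(1)] by simp
  finally show ?thesis
    using symbol_commutator[OF A B k n] by (simp add: k_def)
qed

section \<open>Formal operators with equal symbols\<close>

lemma principal_symbol_eq_iff_power:
  assumes "diff_op r D" "diff_op r E" "h \<in> smooth_functions \<A>"
    and "principal_symbol \<A> r D = principal_symbol \<A> r E"
  shows "D (\<lambda>y. (h y - h x) ^ r) x = E (\<lambda>y. (h y - h x) ^ r) x"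
  using principal_symbol_eq[OF assms(1,3), of x] principal_symbol_eq[OF assms(2,3), of x] assms(4) by simp

lemma principal_symbol_product:
  assumes A: "diff_op r A" and B: "diff_op s B" and h: "h \<in> smooth_functions \<A>"
  shows "A (B (\<lambda>y. (h y - h x) ^ (r + s))) x / fact (r + s) =
    principal_symbol \<A> r A (x, differential \<A> h x) * principal_symbol \<A> s B (x, differential \<A> h x)"
  using symbol_compose[OF A B, of "\<lambda>y. h y - h x" x] h
  by (simp add: smooth_functions_intros principal_symbol_eq[OF A h] principal_symbol_eq[OF B h])

text \<open>Formal differential operators with the same symbol, whose difference is
  therefore \<open>\<nu>\<close> times a natural operator.\<close>

definition deformation_pair :: "(nat \<Rightarrow> 'm operator) \<Rightarrow> (nat \<Rightarrow> 'm operator) \<Rightarrow> bool" where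
  "deformation_pair P P' \<longleftrightarrow> (\<forall>i. diff_op i (P i) \<and> diff_op i (P' i)) \<and>
     (\<forall>u\<in>smooth_functions \<A>. P 0 u = P' 0 u) \<and>
     (\<forall>i. principal_symbol \<A> i (P i) = principal_symbol \<A> i (P' i))"

lemma deformation_pairD:
  assumes "deformation_pair P P'"
  shows "diff_op i (P i)" "diff_op i (P' i)" "u \<in> smooth_functions \<A> \<Longrightarrow> P 0 u = P' 0 u"
    "principal_symbol \<A> i (P i) = principal_symbol \<A> i (P' i)"
  using assms unfolding deformation_pair_def by auto

lemma div_nu_apply: "div_nu (P - P') i = (\<lambda>u x. P (Suc i) u x - P' (Suc i) u x)"
  by (simp add: div_nu_def fun_eq_iff)

text \<open>Additivity of \<open>principal_symbol\<close> is not visible from its definition by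
  choice. The symbol of the difference is therefore computed from the values on powers, which agree
  for the two operators.\<close>

lemma deformation_pair_order:
  assumes P: "deformation_pair P P'"
  shows "diff_op i (div_nu (P - P') i)"
proof (rule diff_op_order_reduction)
  note D = deformation_pairD[OF P]
  show d: "diff_op (Suc i) (div_nu (P - P') i)"
    unfolding div_nu_apply by (intro diff_op_diff D)
  fix x p assume p: "p \<in> cotangent_space \<A> x"
  obtain U \<phi> where ch: "(U, \<phi>) \<in> \<A>" "x \<in> U" using ex_chart .
  obtain h where h: "h \<in> smooth_functions \<A>" "p = differential \<A> h x"
    using ex_differential[OF ch p] by metis
  show "principal_symbol \<A> (Suc i) (div_nu (P - P') i) (x, p) = 0"
    unfolding h(2) principal_symbol_eq[OF d h(1)]
    using principal_symbol_eq_iff_power[OF D(1,2) h(1) D(4), of "Suc i" x]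
    by (simp add: div_nu_apply)
qed

text \<open>This is \<open>P Q - P' Q' = P (Q - Q') + (P - P') Q'\<close>. Both differences start in
  degree 1, because the degree 0 terms agree on smooth functions, so division by
  \<open>\<nu>\<close> lowers the total degree from \<open>n + 1\<close> to
  \<open>n\<close>.\<close>

lemma composition_difference:
  assumes P: "deformation_pair P P'" and Q: "deformation_pair Q Q'" and K: "K \<in> smooth_functions \<A>"
  shows "(\<Sum>i\<le>Suc n. P i (Q (Suc n - i) K) x - P' i (Q' (Suc n - i) K) x) =
    (\<Sum>i\<le>n. P i (div_nu (Q - Q') (n - i) K) x + div_nu (P - P') i (Q' (n - i) K) x)"
proof -
  note DP = deformation_pairD[OF P] and DQ = deformation_pairD[OF Q]
  have K': "Q i K \<in> smooth_functions \<A>" "Q' i K \<in> smooth_functions \<A>" for i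
    using diff_op_smooth[OF DQ(1) K] diff_op_smooth[OF DQ(2) K] by auto
  define F where "F i j = P i (\<lambda>y. Q j K y - Q' j K y) x" for i j
  define G where "G i j = P i (Q' j K) x - P' i (Q' j K) x" for i j
  have F: "F i j = P i (Q j K) x - P i (Q' j K) x" for i j
    using diff_op_linear[OF DP(1) K'(2) K'(1), of i "-1" j j x] unfolding F_def by simp
  have F0: "F i 0 = 0" for i
    by (simp add: F DQ(3)[OF K])
  have G0: "G 0 j = 0" for j
    by (simp add: G_def DP(3)[OF K'(2)])
  have "(\<Sum>i\<le>Suc n. P i (Q (Suc n - i) K) x - P' i (Q' (Suc n - i) K) x) =
      (\<Sum>i\<le>Suc n. F i (Suc n - i)) + (\<Sum>i\<le>Suc n. G i (Suc n - i))"
    by (simp only: F G_def flip: sum.distrib) simp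
  also have "(\<Sum>i\<le>Suc n. F i (Suc n - i)) = (\<Sum>i\<le>n. F i (Suc (n - i)))"
    using F0 by (simp add: Suc_diff_le cong: sum.cong_simp)
  also have "(\<Sum>i\<le>Suc n. G i (Suc n - i)) = (\<Sum>i\<le>n. G (Suc i) (n - i))"
    using G0 by (subst sum_atMost_Suc_shift0) auto
  finally show ?thesis
    by (simp add: F_def G_def div_nu_apply sum.distrib)
qed

lemma deformation_pair_sym: "deformation_pair P P' \<Longrightarrow> deformation_pair P' P"
  unfolding deformation_pair_def by metis

text \<open>The other splitting, \<open>P' (Q - Q') + (P - P') Q\<close>, comes from exchanging
  primed and unprimed operators. Used for \<open>Q P - Q' P'\<close> and subtracted from the first
  splitting of \<open>P Q - P' Q'\<close>, it matches every product with its reverse: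
  \<open>[P, Q - Q'] + [P - P', Q']\<close>.\<close>

lemma composition_difference':
  assumes P: "deformation_pair P P'" and Q: "deformation_pair Q Q'" and K: "K \<in> smooth_functions \<A>"
  shows "(\<Sum>i\<le>Suc n. P i (Q (Suc n - i) K) x - P' i (Q' (Suc n - i) K) x) =
    (\<Sum>i\<le>n. P' i (div_nu (Q - Q') (n - i) K) x + div_nu (P - P') i (Q (n - i) K) x)"
proof -
  have "P' i (div_nu (Q' - Q) j K) x = - P' i (div_nu (Q - Q') j K) x" for i j
    using diff_op_cmult[OF deformation_pairD(2)[OF P] diff_op_smooth[OF deformation_pair_order[OF Q] K], of i "-1" j x]
    by (simp add: div_nu_apply)
  moreover have "div_nu (P' - P) i u x = - div_nu (P - P') i u x" for i u
    by (simp add: div_nu_apply)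
  ultimately show ?thesis
    using composition_difference[OF deformation_pair_sym[OF P] deformation_pair_sym[OF Q] K, of n x]
    by (simp add: sum_subtractf sum.distrib sum_negf algebra_simps)
qed

text \<open>In degree \<open>n + 1\<close> the split products have orders \<open>i\<close> and
  \<open>n - i\<close>, so evaluation on \<open>k^n\<close> multiplies symbols. The factor
  \<open>Q'\<close> of the splitting becomes \<open>Q\<close> because their symbols agree.\<close>

lemma deformation_product:
  assumes P: "deformation_pair P P'" and Q: "deformation_pair Q Q'" and h: "h \<in> smooth_functions \<A>"
  shows "(\<Sum>i\<le>Suc n. P i (Q (Suc n - i) (\<lambda>y. (h y - h x) ^ n)) x -
      P' i (Q' (Suc n - i) (\<lambda>y. (h y - h x) ^ n)) x) / fact n =
    fps_nth (sigma_symbol \<A> P * sigma_symbol \<A> (div_nu (Q - Q')) +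
      sigma_symbol \<A> (div_nu (P - P')) * sigma_symbol \<A> Q) n (x, differential \<A> h x)"
proof -
  note DP = deformation_pairD[OF P] deformation_pair_order[OF P]
  note DQ = deformation_pairD[OF Q] deformation_pair_order[OF Q]
  let ?K = "\<lambda>n y. (h y - h x) ^ n"
  let ?\<omega> = "(x, differential \<A> h x)"
  have K: "?K n \<in> smooth_functions \<A>"
    by (intro smooth_functions_intros h)
  have prod: "A (B (?K n)) x / fact n = principal_symbol \<A> i A ?\<omega> * principal_symbol \<A> (n - i) B ?\<omega>"
    if "diff_op i A" "diff_op (n - i) B" "i \<le> n" for A B i
    using principal_symbol_product[OF that(1,2) h, of x] that(3) by simp
  show ?thesis
    unfolding composition_difference[OF P Q K] sum_divide_distrib add_divide_distrib
    by (simp add: fps_mult_nth sigma_symbol_def sum_fun_apply sum.distrib DQ(4)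
        prod[OF DP(1) DQ(5)] prod[OF DP(5) DQ(2)] atMost_atLeast0)
qed

text \<open>Two factors \<open>\<nu>\<close> are lost, one to the deformation and one to the
  commutator. In degree \<open>n + 2\<close> the paired operators thus have orders \<open>i\<close>
  and \<open>n + 1 - i\<close>, exactly the case in which their commutator on \<open>k^n\<close> is
  a bracket of symbols.\<close>

lemma deformation_commutator:
  fixes n :: nat
  assumes P: "deformation_pair P P'" and Q: "deformation_pair Q Q'"
    and c: "chart_at \<A> x = (U, \<phi>)" and ch: "(U, \<phi>) \<in> \<A>" "x \<in> U" and h: "h \<in> smooth_functions \<A>"
    and W: "open W" "\<phi> x \<in> W" "W \<subseteq> \<phi> ` U" "\<forall>z\<in>W. h (inv_into U \<phi> z) = z \<bullet> \<xi>"
  defines "K \<equiv> \<lambda>y. (h y - h x) ^ n"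
  shows "((\<Sum>i\<le>Suc (Suc n). P i (Q (Suc (Suc n) - i) K) x - P' i (Q' (Suc (Suc n) - i) K) x) -
      (\<Sum>i\<le>Suc (Suc n). Q i (P (Suc (Suc n) - i) K) x - Q' i (P' (Suc (Suc n) - i) K) x)) / fact n =
    fps_nth (formal_bracket \<A> (sigma_symbol \<A> P) (sigma_symbol \<A> (div_nu (Q - Q'))) +
      formal_bracket \<A> (sigma_symbol \<A> (div_nu (P - P'))) (sigma_symbol \<A> Q)) n (x, differential \<A> h x)"
    (is "?lhs = _")
proof -
  note DP = deformation_pairD[OF P] deformation_pair_order[OF P]
  note DQ = deformation_pairD[OF Q] deformation_pair_order[OF Q]
  let ?\<omega> = "(x, differential \<A> h x)"
  have K: "K \<in> smooth_functions \<A>"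
    unfolding K_def by (intro smooth_functions_intros h)
  have br: "(A (B K) x - B (A K) x) / fact n =
      cot_bracket \<A> (principal_symbol \<A> i A) (principal_symbol \<A> (Suc n - i) B) ?\<omega>"
    if "diff_op i A" "diff_op (Suc n - i) B" "i \<le> Suc n" for A B i
    unfolding K_def using that(3)
    by (intro cot_bracket_principal_symbol[OF that(1,2) _ c ch h W(1-3) bspec[OF W(4)], symmetric]) auto
  \<comment> \<open>Reversing the sum gives each product the same index as its reverse in the other
    sum.\<close>
  have "(\<Sum>i\<le>Suc n. Q' i (div_nu (P - P') (Suc n - i) K) x + div_nu (Q - Q') i (P (Suc n - i) K) x) =
      (\<Sum>i\<le>Suc n. Q' (Suc n - i) (div_nu (P - P') i K) x + div_nu (Q - Q') (Suc n - i) (P i K) x)"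
    by (rule sum_atMost_rev[of "\<lambda>i j. Q' i (div_nu (P - P') j K) x + div_nu (Q - Q') i (P j K) x"])
  then have diff: "(\<Sum>i\<le>Suc (Suc n). P i (Q (Suc (Suc n) - i) K) x - P' i (Q' (Suc (Suc n) - i) K) x) -
      (\<Sum>i\<le>Suc (Suc n). Q i (P (Suc (Suc n) - i) K) x - Q' i (P' (Suc (Suc n) - i) K) x) =
    (\<Sum>i\<le>Suc n. (P i (div_nu (Q - Q') (Suc n - i) K) x - div_nu (Q - Q') (Suc n - i) (P i K) x) +
      (div_nu (P - P') i (Q' (Suc n - i) K) x - Q' (Suc n - i) (div_nu (P - P') i K) x))"
    unfolding composition_difference[OF P Q K] composition_difference'[OF Q P K]
    by (simp only: flip: sum_subtractf) (simp only: algebra_simps)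
  have "?lhs = (\<Sum>i\<le>Suc n.
      cot_bracket \<A> (principal_symbol \<A> i (P i)) (principal_symbol \<A> (Suc n - i) (div_nu (Q - Q') (Suc n - i))) ?\<omega> +
      cot_bracket \<A> (principal_symbol \<A> i (div_nu (P - P') i)) (principal_symbol \<A> (Suc n - i) (Q (Suc n - i))) ?\<omega>)"
    unfolding diff sum_divide_distrib add_divide_distrib DQ(4)
    by (intro sum.cong refl) (simp only: br[OF DP(1) DQ(5)] br[OF DP(5) DQ(2)] atMost_iff)
  also have "\<dots> = fps_nth (formal_bracket \<A> (sigma_symbol \<A> P) (sigma_symbol \<A> (div_nu (Q - Q'))) +
      formal_bracket \<A> (sigma_symbol \<A> (div_nu (P - P'))) (sigma_symbol \<A> Q)) n ?\<omega>"
    by (simp add: formal_bracket_def sigma_symbol_def sum_fun_apply sum.distrib del: sum.atMost_Suc)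
  finally show ?thesis .
qed


section \<open>Star products\<close>

lemma bidiff_op_swap:
  assumes "bidiff_op \<A> r B"
  shows "bidiff_op \<A> r (\<lambda>f g. B g f)"
  unfolding bidiff_op_def
proof (intro conjI ballI)
  fix c assume c: "c \<in> \<A>"
  obtain U \<phi> where U: "c = (U, \<phi>)" by fastforce
  then obtain a where a: "\<forall>v\<in>words r. \<forall>w\<in>words r. smooth_on (\<phi> ` U) (a v w)"
    "\<And>f g x. f \<in> smooth_functions \<A> \<Longrightarrow> g \<in> smooth_functions \<A> \<Longrightarrow> x \<in> U \<Longrightarrow>
      B f g x = (\<Sum>v\<in>words r. \<Sum>w\<in>words r.
        a v w (\<phi> x) * partial_deriv v (f \<circ> inv_into U \<phi>) (\<phi> x)
                    * partial_deriv w (g \<circ> inv_into U \<phi>) (\<phi> x))"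
    using assms c unfolding bidiff_op_def by fastforce
  have "B g f x = (\<Sum>v\<in>words r. \<Sum>w\<in>words r.
        a w v (\<phi> x) * partial_deriv v (f \<circ> inv_into U \<phi>) (\<phi> x)
                    * partial_deriv w (g \<circ> inv_into U \<phi>) (\<phi> x))"
    if "f \<in> smooth_functions \<A>" "g \<in> smooth_functions \<A>" "x \<in> U" for f g x
    unfolding a(2)[OF that(2,1,3)] by (subst sum.swap) (simp only: mult_ac)
  then show "case c of (U, \<phi>) \<Rightarrow> \<exists>a. (\<forall>v\<in>words r. \<forall>w\<in>words r. smooth_on (\<phi> ` U) (a v w)) \<and>
    (\<forall>f\<in>smooth_functions \<A>. \<forall>g\<in>smooth_functions \<A>. \<forall>x\<in>U.
       B g f x = (\<Sum>v\<in>words r. \<Sum>w\<in>words r.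
         a v w (\<phi> x) * partial_deriv v (f \<circ> inv_into U \<phi>) (\<phi> x)
                     * partial_deriv w (g \<circ> inv_into U \<phi>) (\<phi> x)))"
    unfolding U prod.case using a(1) by (intro exI[of _ "\<lambda>v w. a w v"]) auto
qed (use assms in \<open>auto simp: bidiff_op_def\<close>)

lemma bidiff_op_diff_op:
  assumes B: "bidiff_op \<A> r B" and f: "f \<in> smooth_functions \<A>"
  shows "diff_op r (B f)"
  unfolding diff_op_def
proof (intro conjI ballI)
  fix c assume c: "c \<in> \<A>"
  obtain U \<phi> where U: "c = (U, \<phi>)" by fastforce
  then have ch: "(U, \<phi>) \<in> \<A>" using c by simp
  obtain a where a: "\<forall>v\<in>words r. \<forall>w\<in>words r. smooth_on (\<phi> ` U) (a v w)"
    "\<And>f g x. f \<in> smooth_functions \<A> \<Longrightarrow> g \<in> smooth_functions \<A> \<Longrightarrow> x \<in> U \<Longrightarrow>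
      B f g x = (\<Sum>v\<in>words r. \<Sum>w\<in>words r.
        a v w (\<phi> x) * partial_deriv v (f \<circ> inv_into U \<phi>) (\<phi> x)
                    * partial_deriv w (g \<circ> inv_into U \<phi>) (\<phi> x))"
    using B ch unfolding bidiff_op_def by fastforce
  define e where "e w z = (\<Sum>v\<in>words r. a v w z * partial_deriv v (f \<circ> inv_into U \<phi>) z)" for w z
  have S: "open (\<phi> ` U)" using chart_homeomorphism(2)[OF ch] .
  have "smooth_on (\<phi> ` U) (\<lambda>z. \<Sum>v\<in>words r. a v w z * partial_deriv v (f \<circ> inv_into U \<phi>) z)"
    if "w \<in> words r" for w
  proof (rule smooth_on_sum[OF S])
    fix v :: "'e list" assume v: "v \<in> words r"
    have "smooth_on (\<phi> ` U) (partial_deriv v (f \<circ> inv_into U \<phi>))"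
      using smooth_on_partial_deriv[OF smooth_rep[OF f ch], of v] v by (simp add: words_def o_def)
    then show "smooth_on (\<phi> ` U) (\<lambda>z. a v w z * partial_deriv v (f \<circ> inv_into U \<phi>) z)"
      using a(1) v that by (intro smooth_on_mult[OF S]) auto
  qed
  moreover have "B f g x = (\<Sum>w\<in>words r. e w (\<phi> x) * partial_deriv w (g \<circ> inv_into U \<phi>) (\<phi> x))"
    if "g \<in> smooth_functions \<A>" "x \<in> U" for g x
    unfolding a(2)[OF f that] e_def by (subst sum.swap) (simp only: sum_distrib_right)
  ultimately have "local_coeffs \<A> (U, \<phi>) r (B f) e"
    unfolding local_coeffs_def by (simp add: e_def[abs_def])
  then show "\<exists>a. local_coeffs \<A> c r (B f) a"
    unfolding U by blast
qed (use B f in \<open>auto simp: bidiff_op_def\<close>)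

text \<open>Unlike \<open>natural_star_product\<close>, this is inherited by the opposite product, which exchanges source and
  target: statements about \<open>T\<close> follow from those about \<open>S\<close>.\<close>

definition natural_deformation :: "(nat \<Rightarrow> 'm bioperator) \<Rightarrow> bool" where
  "natural_deformation C \<longleftrightarrow>
     (\<forall>r. \<forall>f\<in>smooth_functions \<A>. diff_op r (C r f) \<and> diff_op r (\<lambda>g. C r g f)) \<and>
     (\<forall>f\<in>smooth_functions \<A>. \<forall>g\<in>smooth_functions \<A>. C 0 f g = (\<lambda>x. f x * g x)) \<and>
     (\<forall>n x. \<forall>f\<in>smooth_functions \<A>. \<forall>g\<in>smooth_functions \<A>. \<forall>h\<in>smooth_functions \<A>.
        (\<Sum>i\<le>n. C i (C (n - i) f g) h x) = (\<Sum>i\<le>n. C i f (C (n - i) g h) x)) \<and>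
     (\<forall>n x. \<forall>f\<in>smooth_functions \<A>. C (Suc n) f (\<lambda>_. 1) x = 0 \<and> C (Suc n) (\<lambda>_. 1) f x = 0)"

lemma natural_deformation_opposite:
  "natural_deformation C \<Longrightarrow> natural_deformation (\<lambda>r f g. C r g f)"
  unfolding natural_deformation_def by (simp add: mult.commute)

lemma natural_star_product_deformation:
  assumes "natural_star_product \<A> \<pi> C"
  shows "natural_deformation C"
proof -
  have bid: "bidiff_op \<A> r (C r)" for r
    using assms unfolding natural_star_product_def by blast
  have star: "star_product \<A> \<pi> C"
    using assms unfolding natural_star_product_def by blast
  have left: "diff_op r (C r f)" and right: "diff_op r (\<lambda>g. C r g f)" if "f \<in> smooth_functions \<A>" for r f
    using bidiff_op_diff_op[OF bid that] bidiff_op_diff_op[OF bidiff_op_swap[OF bid] that] by auto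
  \<comment> \<open>The coefficients of a constant series in positive degree are 0; their
    contributions to \<open>star_mult\<close> vanish because the operators are linear.\<close>
  have zero: "C r f 0 = 0" "C r 0 f = 0" if "f \<in> smooth_functions \<A>" for r f
    using diff_op_zero[OF left[OF that]] diff_op_zero[OF right[OF that]]
    by (auto simp: zero_fun_def fun_eq_iff)
  have z: "(0 :: 'm \<Rightarrow> real) \<in> smooth_functions \<A>"
    using smooth_functions_const[of 0] by (simp add: zero_fun_def)
  have const: "fps_const f \<in> formal_smooth \<A>" if "f \<in> smooth_functions \<A>" for f
    using that z by (simp add: formal_smooth_def)
  \<comment> \<open>One factor is a general series, since \<open>f \<star> g\<close> is in general
    no longer constant when it is multiplied by \<open>h\<close>.\<close>
  have right_const: "fps_nth (star_mult C P (fps_const h)) n = (\<Sum>r\<le>n. C r (fps_nth P (n - r)) h)"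
    if P: "P \<in> formal_smooth \<A>" and h: "h \<in> smooth_functions \<A>" for P h n
  proof -
    have "(\<Sum>i\<le>m. C r (fps_nth P i) (fps_nth (fps_const h) (m - i))) = C r (fps_nth P m) h" for r m
      by (subst sum_atMost_last) (use P in \<open>auto simp: zero formal_smooth_def\<close>)
    then show ?thesis by (simp only: star_mult_def fps_nth_Abs_fps)
  qed
  have left_const: "fps_nth (star_mult C (fps_const h) P) n = (\<Sum>r\<le>n. C r h (fps_nth P (n - r)))"
    if P: "P \<in> formal_smooth \<A>" and h: "h \<in> smooth_functions \<A>" for P h n
  proof -
    have "(\<Sum>i\<le>m. C r (fps_nth (fps_const h) i) (fps_nth P (m - i))) = C r h (fps_nth P m)" for r m
      by (subst sum_atMost_first) (use P in \<open>auto simp: zero formal_smooth_def\<close>)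
    then show ?thesis by (simp only: star_mult_def fps_nth_Abs_fps)
  qed
  have const_const: "fps_nth (star_mult C (fps_const f) (fps_const g)) n = C n f g"
    if "f \<in> smooth_functions \<A>" "g \<in> smooth_functions \<A>" for f g n
    unfolding right_const[OF const[OF that(1)] that(2)]
    by (subst sum_atMost_last) (use that in \<open>auto simp: zero\<close>)
  have smooth: "star_mult C (fps_const f) (fps_const g) \<in> formal_smooth \<A>"
    if "f \<in> smooth_functions \<A>" "g \<in> smooth_functions \<A>" for f g
    using that diff_op_smooth[OF left] by (simp add: formal_smooth_def const_const)
  have "(\<Sum>i\<le>n. C i (C (n - i) f g) h x) = (\<Sum>i\<le>n. C i f (C (n - i) g h) x)"
    if "f \<in> smooth_functions \<A>" "g \<in> smooth_functions \<A>" "h \<in> smooth_functions \<A>" for n x f g h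
  proof -
    have "star_mult C (star_mult C (fps_const f) (fps_const g)) (fps_const h) =
        star_mult C (fps_const f) (star_mult C (fps_const g) (fps_const h))"
      using star const that unfolding star_product_def by blast
    then have "fps_nth (star_mult C (star_mult C (fps_const f) (fps_const g)) (fps_const h)) n x =
        fps_nth (star_mult C (fps_const f) (star_mult C (fps_const g) (fps_const h))) n x"
      by simp
    then show ?thesis
      using that by (simp add: right_const[OF smooth] left_const[OF smooth] const_const sum_fun_apply)
  qed
  moreover have "C (Suc n) f (\<lambda>_. 1) x = 0 \<and> C (Suc n) (\<lambda>_. 1) f x = 0"
    if "f \<in> smooth_functions \<A>" for f n x
  proof -
    have "star_mult C 1 (fps_const f) = fps_const f \<and> star_mult C (fps_const f) 1 = fps_const f"
      using star const[OF that] unfolding star_product_def by blast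
    moreover have "(1 :: ('m \<Rightarrow> real) fps) = fps_const (\<lambda>_. 1)"
      by (simp add: one_fun_def flip: fps_const_1_eq_1)
    ultimately have "C (Suc n) (\<lambda>_. 1) f = 0" "C (Suc n) f (\<lambda>_. 1) = 0"
      using const_const[OF smooth_functions_const[of 1] that, of "Suc n"]
        const_const[OF that smooth_functions_const[of 1], of "Suc n"] by simp_all
    then show ?thesis by simp
  qed
  moreover have "C 0 f g = (\<lambda>x. f x * g x)"
    if "f \<in> smooth_functions \<A>" "g \<in> smooth_functions \<A>" for f g
    using star that unfolding star_product_def by (simp add: times_fun_def)
  ultimately show ?thesis
    unfolding natural_deformation_def using left right by blast
qed

lemma sigma_symbol_outside:
  "\<omega> \<notin> cotangent_bundle \<A> \<Longrightarrow> fps_nth (sigma_symbol \<A> P) n \<omega> = 0"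
  by (simp add: sigma_symbol_def principal_symbol_outside)

lemma sigma_symbol_mult_outside:
  "\<omega> \<notin> cotangent_bundle \<A> \<Longrightarrow> fps_nth (sigma_symbol \<A> P * sigma_symbol \<A> Q) n \<omega> = 0"
  by (simp add: fps_mult_nth sum_fun_apply sigma_symbol_outside)

lemma formal_bracket_outside:
  "\<omega> \<notin> cotangent_bundle \<A> \<Longrightarrow> fps_nth (formal_bracket \<A> P Q) n \<omega> = 0"
  by (simp add: formal_bracket_def sum_fun_apply cot_bracket_def del: sum.atMost_Suc)

text \<open>Outside the cotangent bundle symbols and brackets are 0 by convention, and each of its
  points is \<open>(x, dh)\<close> with \<open>h\<close> linear near \<open>x\<close> in the chosen
  chart. Identities of formal functions thus become identities between values on powers.\<close>

lemma formal_function_eqI: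
  fixes F G :: "'m formal_function"
  assumes "\<And>n \<omega>. \<omega> \<notin> cotangent_bundle \<A> \<Longrightarrow> fps_nth F n \<omega> = fps_nth G n \<omega>"
    and "\<And>n x U \<phi> h W \<xi>. chart_at \<A> x = (U, \<phi>) \<Longrightarrow> (U, \<phi>) \<in> \<A> \<Longrightarrow> x \<in> U \<Longrightarrow> h \<in> smooth_functions \<A> \<Longrightarrow>
      open W \<Longrightarrow> \<phi> x \<in> W \<Longrightarrow> W \<subseteq> \<phi> ` U \<Longrightarrow> (\<forall>z\<in>W. h (inv_into U \<phi> z) = z \<bullet> \<xi>) \<Longrightarrow>
      fps_nth F n (x, differential \<A> h x) = fps_nth G n (x, differential \<A> h x)"
  shows "F = G"
proof (rule fps_ext, rule ext)
  fix n \<omega>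
  show "fps_nth F n \<omega> = fps_nth G n \<omega>"
  proof (cases "\<omega> \<in> cotangent_bundle \<A>")
    case True
    then obtain x p where \<omega>: "\<omega> = (x, p)" "p \<in> cotangent_space \<A> x"
      by (auto simp: cotangent_bundle_def)
    obtain U \<phi> where c: "chart_at \<A> x = (U, \<phi>)" and ch: "(U, \<phi>) \<in> \<A>" "x \<in> U" using chart_at .
    obtain h W \<xi> where h: "h \<in> smooth_functions \<A>" "p = differential \<A> h x"
      and W: "open W" "\<phi> x \<in> W" "W \<subseteq> \<phi> ` U" "\<forall>z\<in>W. h (inv_into U \<phi> z) = z \<bullet> \<xi>"
      using ex_differential[OF ch \<omega>(2)] by metis
    show ?thesis
      unfolding \<omega>(1) h(2) by (rule assms(2)[OF c ch h(1) W])
  qed (rule assms(1))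
qed

end

section \<open>The identities for two star products\<close>

locale star_pair = smooth_manifold \<A>
  for \<A> :: "('m::{t2_space,second_countable_topology}, 'e::euclidean_space) chart set" +
  fixes C C' :: "nat \<Rightarrow> 'm bioperator"
  assumes C: "natural_deformation C" and C': "natural_deformation C'"
    and same_left: "f \<in> smooth_functions \<A> \<Longrightarrow> principal_symbol \<A> i (C i f) = principal_symbol \<A> i (C' i f)"
    and same_right: "f \<in> smooth_functions \<A> \<Longrightarrow>
      principal_symbol \<A> i (\<lambda>g. C i g f) = principal_symbol \<A> i (\<lambda>g. C' i g f)"
begin

lemma opposite: "star_pair \<A> (\<lambda>r f g. C r g f) (\<lambda>r f g. C' r g f)"
  by unfold_locales (use natural_deformation_opposite[OF C] natural_deformation_opposite[OF C']
      same_left same_right in auto)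

lemma diff_op_C:
  assumes "f \<in> smooth_functions \<A>"
  shows "diff_op r (C r f)" "diff_op r (\<lambda>g. C r g f)" "diff_op r (C' r f)" "diff_op r (\<lambda>g. C' r g f)"
  using C C' assms unfolding natural_deformation_def by auto

lemma C_smooth:
  assumes "f \<in> smooth_functions \<A>" "g \<in> smooth_functions \<A>"
  shows "C r f g \<in> smooth_functions \<A>" "C' r f g \<in> smooth_functions \<A>"
  using diff_op_smooth[OF diff_op_C(1)] diff_op_smooth[OF diff_op_C(3)] assms by auto

lemma C_0:
  assumes "f \<in> smooth_functions \<A>" "g \<in> smooth_functions \<A>"
  shows "C 0 f g = (\<lambda>x. f x * g x)" "C' 0 f g = (\<lambda>x. f x * g x)"
  using C C' assms unfolding natural_deformation_def by auto

lemma C_assoc: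
  assumes "f \<in> smooth_functions \<A>" "g \<in> smooth_functions \<A>" "h \<in> smooth_functions \<A>"
  shows "(\<Sum>i\<le>n. C i (C (n - i) f g) h x) = (\<Sum>i\<le>n. C i f (C (n - i) g h) x)"
    "(\<Sum>i\<le>n. C' i (C' (n - i) f g) h x) = (\<Sum>i\<le>n. C' i f (C' (n - i) g h) x)"
  using C C' assms unfolding natural_deformation_def by blast+

lemma C_unit:
  assumes "f \<in> smooth_functions \<A>"
  shows "C (Suc n) f (\<lambda>_. 1) x = 0" "C' (Suc n) f (\<lambda>_. 1) x = 0"
  using C C' assms unfolding natural_deformation_def by auto

lemma left_pair:
  assumes "f \<in> smooth_functions \<A>"
  shows "deformation_pair (left_mult C f) (left_mult C' f)"
  unfolding deformation_pair_def left_mult_def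
  using diff_op_C[OF assms] same_left[OF assms] C_0[OF assms] by auto

lemma right_pair:
  assumes "f \<in> smooth_functions \<A>"
  shows "deformation_pair (right_mult C f) (right_mult C' f)"
  unfolding deformation_pair_def right_mult_def
  using diff_op_C[OF assms] same_right[OF assms] C_0[OF _ assms] by auto

abbreviation S\<^sub>0 where "S\<^sub>0 f \<equiv> sigma_symbol \<A> (left_mult C f)"
abbreviation T\<^sub>0 where "T\<^sub>0 f \<equiv> sigma_symbol \<A> (right_mult C f)"
abbreviation S\<^sub>1 where "S\<^sub>1 f \<equiv> sigma_symbol \<A> (div_nu (left_mult C f - left_mult C' f))"
abbreviation T\<^sub>1 where "T\<^sub>1 f \<equiv> sigma_symbol \<A> (div_nu (right_mult C f - right_mult C' f))"

lemma S0_apply: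
  assumes "f \<in> smooth_functions \<A>" "h \<in> smooth_functions \<A>"
  shows "fps_nth (S\<^sub>0 f) n (x, differential \<A> h x) = C n f (\<lambda>y. (h y - h x) ^ n) x / fact n"
  using principal_symbol_eq[OF diff_op_C(1)[OF assms(1)] assms(2)]
  by (simp add: sigma_symbol_def left_mult_def)

lemma S1_apply:
  assumes "f \<in> smooth_functions \<A>" "h \<in> smooth_functions \<A>"
  shows "fps_nth (S\<^sub>1 f) n (x, differential \<A> h x) =
    (C (Suc n) f (\<lambda>y. (h y - h x) ^ n) x - C' (Suc n) f (\<lambda>y. (h y - h x) ^ n) x) / fact n"
  using principal_symbol_eq[OF deformation_pair_order[OF left_pair[OF assms(1)]] assms(2)]
  by (simp add: sigma_symbol_def div_nu_apply) (simp add: left_mult_def)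

lemma C_1_eq:
  assumes f: "f \<in> smooth_functions \<A>" and g: "g \<in> smooth_functions \<A>"
  shows "C (Suc 0) f g = C' (Suc 0) f g"
proof
  fix x
  have "diff_op 0 (\<lambda>u x. C (Suc 0) f u x - C' (Suc 0) f u x)"
    using deformation_pair_order[OF left_pair[OF f], of 0] by (simp add: div_nu_apply left_mult_def)
  \<comment> \<open>With \<open>r = 0\<close> and \<open>k = 0\<close> the factor
    \<open>k ^ r\<close> is the constant 1, so an operator of order 0 is multiplication by its value
    on 1. The unit axiom makes that value 0.\<close>
  from diff_op_top[OF this smooth_functions_const[of 0] _ g, of x]
  show "C (Suc 0) f g x = C' (Suc 0) f g x"
    by (simp add: C_unit[OF f])
qed

text \<open>Since \<open>k^0 = 1\<close>, the component of fibre degree 0 at \<open>x\<close> is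
  \<open>C 1 f 1 - C' 1 f 1\<close>, and both terms vanish by the unit axiom.\<close>

lemma S1_restrict:
  assumes "f \<in> smooth_functions \<A>"
  shows "restrict_zero_section (S\<^sub>1 f) = 0"
proof
  fix x
  show "restrict_zero_section (S\<^sub>1 f) x = 0 x"
  proof (cases "(x, \<lambda>_. 0) \<in> cotangent_bundle \<A>")
    case True
    then have p: "(\<lambda>_. 0) \<in> cotangent_space \<A> x"
      by (simp add: cotangent_bundle_def)
    obtain U \<phi> where ch: "(U, \<phi>) \<in> \<A>" "x \<in> U" using ex_chart .
    obtain h where h: "h \<in> smooth_functions \<A>" "(\<lambda>_. 0) = differential \<A> h x"
      using ex_differential[OF ch p] by metis
    show ?thesis
      unfolding restrict_zero_section_def h(2) S1_apply[OF assms h(1)]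
      by (simp add: C_unit[OF assms])
  qed (simp add: restrict_zero_section_def sigma_symbol_outside)
qed

lemma C_power_zero:
  assumes "u \<in> smooth_functions \<A>" "h \<in> smooth_functions \<A>" "i < n"
  shows "C i u (\<lambda>y. (h y - h x) ^ n) x = 0" "C' i u (\<lambda>y. (h y - h x) ^ n) x = 0"
  using diff_op_vanish[OF diff_op_C(1)[OF assms(1)] smooth_functions_diff[OF assms(2) smooth_functions_const[of "h x"]]
      _ smooth_functions_const[of 1] assms(3), of x]
    diff_op_vanish[OF diff_op_C(3)[OF assms(1)] smooth_functions_diff[OF assms(2) smooth_functions_const[of "h x"]]
      _ smooth_functions_const[of 1] assms(3), of x] by simp_all

lemma C_power_eq:
  assumes "u \<in> smooth_functions \<A>" "h \<in> smooth_functions \<A>"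
  shows "C n u (\<lambda>y. (h y - h x) ^ n) x = C' n u (\<lambda>y. (h y - h x) ^ n) x"
  using principal_symbol_eq_iff_power[OF diff_op_C(1,3)[OF assms(1)] assms(2) same_left[OF assms(1)]] .

text \<open>Associativity at \<open>\<nu>^(n+1)\<close>, applied to \<open>K = k^n\<close>, leaves
  \<open>C n (C 1 f g) K\<close> and \<open>C (n+1) (f g) K\<close> on the side of
  \<open>f \<star> g\<close>. The first takes the same value at \<open>x\<close> for both star
  products, because \<open>C 1 = C' 1\<close> and the symbols of degree \<open>n\<close> agree; the
  difference of the second terms is \<open>n!\<close> times the component of
  \<open>S\<^sub>1 (f g)\<close>.\<close>

lemma S1_mult:
  assumes f: "f \<in> smooth_functions \<A>" and g: "g \<in> smooth_functions \<A>"
  shows "S\<^sub>1 (\<lambda>x. f x * g x) = S\<^sub>0 f * S\<^sub>1 g + S\<^sub>1 f * S\<^sub>0 g"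
proof (rule formal_function_eqI)
  fix n x h
  assume h: "h \<in> smooth_functions \<A>"
  define K where "K y = (h y - h x) ^ n" for y
  have K: "K \<in> smooth_functions \<A>"
    unfolding K_def by (intro smooth_functions_intros h)
  have fg: "(\<lambda>x. f x * g x) \<in> smooth_functions \<A>"
    using smooth_functions_mult[OF f g] .
  have "(\<Sum>i\<le>Suc n. C i (C (Suc n - i) f g) K x) = C n (C (Suc 0) f g) K x + C (Suc n) (\<lambda>x. f x * g x) K x"
    using sum_atMost_last[of n "\<lambda>i. C i (C (Suc n - i) f g) K x"] C_power_zero(1)[OF C_smooth(1)[OF f g] h]
    by (simp add: K_def[abs_def] C_0[OF f g])
  moreover have "(\<Sum>i\<le>Suc n. C' i (C' (Suc n - i) f g) K x) =
      C' n (C' (Suc 0) f g) K x + C' (Suc n) (\<lambda>x. f x * g x) K x"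
    using sum_atMost_last[of n "\<lambda>i. C' i (C' (Suc n - i) f g) K x"] C_power_zero(2)[OF C_smooth(2)[OF f g] h]
    by (simp add: K_def[abs_def] C_0[OF f g])
  moreover have "C n (C (Suc 0) f g) K x = C' n (C' (Suc 0) f g) K x"
    unfolding C_1_eq[OF f g, symmetric] K_def[abs_def] by (rule C_power_eq[OF C_smooth(1)[OF f g] h])
  ultimately have "(\<Sum>i\<le>Suc n. C i f (C (Suc n - i) g K) x) - (\<Sum>i\<le>Suc n. C' i f (C' (Suc n - i) g K) x) =
      C (Suc n) (\<lambda>x. f x * g x) K x - C' (Suc n) (\<lambda>x. f x * g x) K x"
    unfolding C_assoc[OF f g K] by linarith
  then show "fps_nth (S\<^sub>1 (\<lambda>x. f x * g x)) n (x, differential \<A> h x) =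
      fps_nth (S\<^sub>0 f * S\<^sub>1 g + S\<^sub>1 f * S\<^sub>0 g) n (x, differential \<A> h x)"
    unfolding deformation_product[OF left_pair[OF f] left_pair[OF g] h, symmetric] S1_apply[OF fg h]
      sum_subtractf by (simp only: left_mult_def K_def[abs_def])
qed (simp add: sigma_symbol_outside sigma_symbol_mult_outside)

text \<open>At \<open>\<nu>^(n+2)\<close> three terms survive. The one with \<open>f g\<close>
  cancels under antisymmetrization, the one with \<open>C 1\<close> gives \<open>S\<^sub>1\<close>
  of the Poisson bracket, and \<open>C n c K - C' n c' K\<close> becomes
  \<open>C n (c - c') K\<close> because \<open>C n\<close> and \<open>C' n\<close> agree on
  \<open>k^n\<close> at \<open>x\<close>; this is the contribution of
  \<open>{f, g}_1\<close>.\<close>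

lemma S1_bracket:
  assumes f: "f \<in> smooth_functions \<A>" and g: "g \<in> smooth_functions \<A>"
  shows "S\<^sub>1 (\<lambda>x. C (Suc 0) f g x - C (Suc 0) g f x) + S\<^sub>0 (bracket_deformation C C' f g) =
    formal_bracket \<A> (S\<^sub>0 f) (S\<^sub>1 g) + formal_bracket \<A> (S\<^sub>1 f) (S\<^sub>0 g)"
proof (rule formal_function_eqI)
  fix n x U \<phi> h W \<xi>
  assume chart: "chart_at \<A> x = (U, \<phi>)" "(U, \<phi>) \<in> \<A>" "x \<in> U" and h: "h \<in> smooth_functions \<A>"
    and W: "open W" "\<phi> x \<in> W" "W \<subseteq> \<phi> ` U" "\<forall>z\<in>W. h (inv_into U \<phi> z) = z \<bullet> \<xi>"
  define K where "K y = (h y - h x) ^ n" for y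
  have K: "K \<in> smooth_functions \<A>"
    unfolding K_def by (intro smooth_functions_intros h)
  define b where "b x = C (Suc 0) f g x - C (Suc 0) g f x" for x
  define c where "c x = C 2 f g x - C 2 g f x" for x
  define c' where "c' x = C' 2 f g x - C' 2 g f x" for x
  have sm: "b \<in> smooth_functions \<A>" "c \<in> smooth_functions \<A>" "c' \<in> smooth_functions \<A>"
    unfolding b_def[abs_def] c_def[abs_def] c'_def[abs_def]
    by (intro smooth_functions_diff C_smooth f g)+
  have br1: "bracket_deformation C C' f g = (\<lambda>x. c x - c' x)"
    by (simp add: bracket_deformation_def c_def c'_def fun_eq_iff)
  \<comment> \<open>Linearity in the first argument: with \<open>K\<close> fixed,
    \<open>u \<mapsto> C i u K\<close> is a differential operator.\<close>
  have diff: "C i (\<lambda>x. u x - v x) K x = C i u K x - C i v K x"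
    "C' i (\<lambda>x. u x - v x) K x = C' i u K x - C' i v K x"
    if "u \<in> smooth_functions \<A>" "v \<in> smooth_functions \<A>" for i u v
    using diff_op_linear[OF diff_op_C(2)[OF K] that(2,1), of i "-1" x]
      diff_op_linear[OF diff_op_C(4)[OF K] that(2,1), of i "-1" x] by simp_all
  have top: "(\<Sum>i\<le>Suc (Suc n). C i f (C (Suc (Suc n) - i) g K) x) =
      C n (C 2 f g) K x + C (Suc n) (C (Suc 0) f g) K x + C (Suc (Suc n)) (\<lambda>x. f x * g x) K x"
    "(\<Sum>i\<le>Suc (Suc n). C' i f (C' (Suc (Suc n) - i) g K) x) =
      C' n (C' 2 f g) K x + C' (Suc n) (C' (Suc 0) f g) K x + C' (Suc (Suc n)) (\<lambda>x. f x * g x) K x"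
    if f: "f \<in> smooth_functions \<A>" and g: "g \<in> smooth_functions \<A>" for f g
    unfolding C_assoc[OF f g K, symmetric]
    using sum_atMost_last[of n "\<lambda>i. C i (C (Suc (Suc n) - i) f g) K x"]
      sum_atMost_last[of n "\<lambda>i. C' i (C' (Suc (Suc n) - i) f g) K x"]
      C_power_zero(1)[OF C_smooth(1)[OF f g] h] C_power_zero(2)[OF C_smooth(2)[OF f g] h]
    by (simp_all add: K_def[abs_def] C_0[OF f g] Suc_diff_le numeral_2_eq_2)
  have comm: "(\<lambda>x. g x * f x) = (\<lambda>x. f x * g x)" by (simp add: mult.commute)
  have b': "b = (\<lambda>x. C' (Suc 0) f g x - C' (Suc 0) g f x)"
    using C_1_eq[OF f g] C_1_eq[OF g f] by (simp add: b_def[abs_def])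
  have "(\<Sum>i\<le>Suc (Suc n). C i f (C (Suc (Suc n) - i) g K) x) -
      (\<Sum>i\<le>Suc (Suc n). C i g (C (Suc (Suc n) - i) f K) x) = C n c K x + C (Suc n) b K x"
    unfolding top(1)[OF f g] top(1)[OF g f] comm b_def[abs_def] c_def[abs_def]
      diff(1)[OF C_smooth(1)[OF f g] C_smooth(1)[OF g f]] by simp
  moreover have "(\<Sum>i\<le>Suc (Suc n). C' i f (C' (Suc (Suc n) - i) g K) x) -
      (\<Sum>i\<le>Suc (Suc n). C' i g (C' (Suc (Suc n) - i) f K) x) = C' n c' K x + C' (Suc n) b K x"
    unfolding top(2)[OF f g] top(2)[OF g f] comm b' c'_def[abs_def]
      diff(2)[OF C_smooth(2)[OF f g] C_smooth(2)[OF g f]] by simp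
  moreover have "C' n c' K x = C n c' K x"
    using C_power_eq[OF sm(3) h] by (simp add: K_def[abs_def])
  ultimately have "(\<Sum>i\<le>Suc (Suc n). C i f (C (Suc (Suc n) - i) g K) x) -
      (\<Sum>i\<le>Suc (Suc n). C' i f (C' (Suc (Suc n) - i) g K) x) -
      ((\<Sum>i\<le>Suc (Suc n). C i g (C (Suc (Suc n) - i) f K) x) -
       (\<Sum>i\<le>Suc (Suc n). C' i g (C' (Suc (Suc n) - i) f K) x)) =
      (C (Suc n) b K x - C' (Suc n) b K x) + C n (\<lambda>x. c x - c' x) K x"
    unfolding diff(1)[OF sm(2,3)] by linarith
  then have "(C (Suc n) b K x - C' (Suc n) b K x) / fact n + C n (\<lambda>x. c x - c' x) K x / fact n =
      fps_nth (formal_bracket \<A> (S\<^sub>0 f) (S\<^sub>1 g) + formal_bracket \<A> (S\<^sub>1 f) (S\<^sub>0 g)) n (x, differential \<A> h x)"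
    unfolding deformation_commutator[OF left_pair[OF f] left_pair[OF g] chart h W, symmetric] sum_subtractf
    by (simp only: left_mult_def K_def[abs_def] add_divide_distrib)
  then show "fps_nth (S\<^sub>1 (\<lambda>x. C (Suc 0) f g x - C (Suc 0) g f x) + S\<^sub>0 (bracket_deformation C C' f g)) n
        (x, differential \<A> h x) =
      fps_nth (formal_bracket \<A> (S\<^sub>0 f) (S\<^sub>1 g) + formal_bracket \<A> (S\<^sub>1 f) (S\<^sub>0 g)) n (x, differential \<A> h x)"
    unfolding br1 using S1_apply[OF sm(1) h, of n x] S0_apply[OF smooth_functions_diff[OF sm(2,3)] h, of n x]
    by (simp add: K_def[abs_def] b_def[abs_def])
qed (simp add: sigma_symbol_outside formal_bracket_outside)

text \<open>Since \<open>f \<star> (K \<star> g) = (f \<star> K) \<star> g\<close>, the two double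
  sums coincide for each star product separately, so the commutator is 0 in every degree.\<close>

lemma S_T_bracket:
  assumes f: "f \<in> smooth_functions \<A>" and g: "g \<in> smooth_functions \<A>"
  shows "formal_bracket \<A> (S\<^sub>0 f) (T\<^sub>1 g) + formal_bracket \<A> (S\<^sub>1 f) (T\<^sub>0 g) = 0"
proof (rule formal_function_eqI)
  fix n x U \<phi> h W \<xi>
  assume chart: "chart_at \<A> x = (U, \<phi>)" "(U, \<phi>) \<in> \<A>" "x \<in> U" and h: "h \<in> smooth_functions \<A>"
    and W: "open W" "\<phi> x \<in> W" "W \<subseteq> \<phi> ` U" "\<forall>z\<in>W. h (inv_into U \<phi> z) = z \<bullet> \<xi>"
  have K: "(\<lambda>y. (h y - h x) ^ n) \<in> smooth_functions \<A>"
    by (intro smooth_functions_intros h)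
  show "fps_nth (formal_bracket \<A> (S\<^sub>0 f) (T\<^sub>1 g) + formal_bracket \<A> (S\<^sub>1 f) (T\<^sub>0 g)) n
      (x, differential \<A> h x) = fps_nth 0 n (x, differential \<A> h x)"
    unfolding deformation_commutator[OF left_pair[OF f] right_pair[OF g] chart h W, symmetric] sum_subtractf
    by (simp only: left_mult_def right_mult_def C_assoc[OF f K g]) simp
qed (simp add: formal_bracket_outside)

text \<open>In the opposite product the antisymmetrized \<open>C 1\<close> and \<open>C 2\<close>
  change sign. This lemma and \<open>S1_minus\<close> pull that sign out when the identity for
  \<open>T\<close> is derived.\<close>

lemma S0_minus:
  assumes u: "u \<in> smooth_functions \<A>"
  shows "S\<^sub>0 (\<lambda>x. - u x) = - S\<^sub>0 u"
proof (rule formal_function_eqI)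
  fix n x h assume h: "h \<in> smooth_functions \<A>"
  have K: "(\<lambda>y. (h y - h x) ^ n) \<in> smooth_functions \<A>"
    by (intro smooth_functions_intros h)
  have mu: "(\<lambda>x. - u x) \<in> smooth_functions \<A>"
    using smooth_functions_cmult[OF u, of "-1"] by simp
  show "fps_nth (S\<^sub>0 (\<lambda>x. - u x)) n (x, differential \<A> h x) = fps_nth (- S\<^sub>0 u) n (x, differential \<A> h x)"
    using diff_op_cmult[OF diff_op_C(2)[OF K] u, of n "-1" x]
    by (simp add: S0_apply[OF mu h] S0_apply[OF u h])
qed (simp add: sigma_symbol_outside)

lemma S1_minus:
  assumes u: "u \<in> smooth_functions \<A>"
  shows "S\<^sub>1 (\<lambda>x. - u x) = - S\<^sub>1 u"
proof (rule formal_function_eqI)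
  fix n x h assume h: "h \<in> smooth_functions \<A>"
  have K: "(\<lambda>y. (h y - h x) ^ n) \<in> smooth_functions \<A>"
    by (intro smooth_functions_intros h)
  have mu: "(\<lambda>x. - u x) \<in> smooth_functions \<A>"
    using smooth_functions_cmult[OF u, of "-1"] by simp
  show "fps_nth (S\<^sub>1 (\<lambda>x. - u x)) n (x, differential \<A> h x) = fps_nth (- S\<^sub>1 u) n (x, differential \<A> h x)"
    using diff_op_cmult[OF diff_op_C(2)[OF K] u, of "Suc n" "-1" x]
      diff_op_cmult[OF diff_op_C(4)[OF K] u, of "Suc n" "-1" x]
    by (simp add: S1_apply[OF mu h] S1_apply[OF u h] field_simps)
qed (simp add: sigma_symbol_outside)

end

theorem proposition1:
  fixes \<A> :: "('m::{t2_space,second_countable_topology}, 'e::euclidean_space) chart set"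
    and \<pi> :: "'m bivector"
    and C C' :: "nat \<Rightarrow> 'm bioperator"
    and f g :: "'m \<Rightarrow> real"
  assumes "poisson_manifold \<A> \<pi>"
    and "natural_star_product \<A> \<pi> C"
    and "natural_star_product \<A> \<pi> C'"
    and "same_formal_groupoid \<A> C C'"
    and "f \<in> smooth_functions \<A>"
    and "g \<in> smooth_functions \<A>"
  shows
    "let S0 = source_map \<A> C; T0 = target_map \<A> C;
         S1 = source_deformation \<A> C C'; T1 = target_deformation \<A> C C';
         br0 = poisson_bracket \<A> \<pi>; br1 = bracket_deformation C C';
         br = formal_bracket \<A>
     in
       (restrict_zero_section (S1 f) = 0 \<and> restrict_zero_section (T1 f) = 0) \<and>
       (S1 (f * g) = S0 f * S1 g + S1 f * S0 g \<and>
        T1 (f * g) = T0 f * T1 g + T1 f * T0 g) \<and>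
       (S1 (br0 f g) + S0 (br1 f g) = br (S0 f) (S1 g) + br (S1 f) (S0 g) \<and>
        T1 (br0 f g) + T0 (br1 f g) = - br (T0 f) (T1 g) - br (T1 f) (T0 g) \<and>
        br (S0 f) (T1 g) + br (S1 f) (T0 g) = 0)"
proof -
  note f = assms(5) and g = assms(6)
  interpret smooth_manifold \<A>
    using assms(1) by unfold_locales (simp add: poisson_manifold_def)
  have sym: "principal_symbol \<A> i (C i u) = principal_symbol \<A> i (C' i u)"
    "principal_symbol \<A> i (\<lambda>v. C i v u) = principal_symbol \<A> i (\<lambda>v. C' i v u)"
    if "u \<in> smooth_functions \<A>" for i u
  proof -
    have "fps_nth (source_map \<A> C u) i = fps_nth (source_map \<A> C' u) i"
      "fps_nth (target_map \<A> C u) i = fps_nth (target_map \<A> C' u) i"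
      using assms(4) that unfolding same_formal_groupoid_def by simp_all
    then show "principal_symbol \<A> i (C i u) = principal_symbol \<A> i (C' i u)"
      "principal_symbol \<A> i (\<lambda>v. C i v u) = principal_symbol \<A> i (\<lambda>v. C' i v u)"
      by (simp_all add: source_map_def target_map_def sigma_symbol_def left_mult_def right_mult_def)
  qed
  interpret star_pair \<A> C C'
    using natural_star_product_deformation[OF assms(2)] natural_star_product_deformation[OF assms(3)] sym
    by unfold_locales
  \<comment> \<open>Left multiplication in this instance is right multiplication in the original
    one, so its lemmas on \<open>S\<close> are statements on \<open>T\<close>.\<close>
  interpret op: star_pair \<A> "\<lambda>r f g. C r g f" "\<lambda>r f g. C' r g f"
    by (rule opposite)
  have op: "left_mult (\<lambda>r f g. D r g f) u = right_mult D u" for D :: "nat \<Rightarrow> 'm bioperator" and u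
    by (simp add: left_mult_def right_mult_def)
  have fg: "f * g = (\<lambda>x. f x * g x)" by (simp add: times_fun_def)
  define b where "b x = C (Suc 0) f g x - C (Suc 0) g f x" for x
  have b: "b \<in> smooth_functions \<A>"
    unfolding b_def[abs_def] by (intro smooth_functions_diff C_smooth f g)
  have br0: "poisson_bracket \<A> \<pi> f g = b"
    using assms(2) f g unfolding natural_star_product_def star_product_def
    by (auto simp: b_def fun_eq_iff)
  define d where "d = bracket_deformation C C' f g"
  have d: "d \<in> smooth_functions \<A>"
    unfolding d_def bracket_deformation_def fun_diff_def
    by (intro smooth_functions_diff C_smooth f g)
  have "bracket_deformation (\<lambda>r f g. C r g f) (\<lambda>r f g. C' r g f) f g = (\<lambda>x. - d x)"
    by (simp add: d_def bracket_deformation_def fun_eq_iff)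
  moreover have "(\<lambda>x. C (Suc 0) g f x - C (Suc 0) f g x) = (\<lambda>x. - b x)"
    by (simp add: b_def)
  \<comment> \<open>The bracket identity of the opposite product with the signs of \<open>b\<close>
    and \<open>d\<close> pulled out; they become the minus signs in the identity for
    \<open>T\<close>.\<close>
  ultimately have T: "- T\<^sub>1 b - T\<^sub>0 d = formal_bracket \<A> (T\<^sub>0 f) (T\<^sub>1 g) + formal_bracket \<A> (T\<^sub>1 f) (T\<^sub>0 g)"
    using op.S1_bracket[OF f g] op.S1_minus[OF b] op.S0_minus[OF d] by (simp add: op)
  have "T\<^sub>1 b + T\<^sub>0 d = - (- T\<^sub>1 b - T\<^sub>0 d)"
    by simp
  also have "\<dots> = - formal_bracket \<A> (T\<^sub>0 f) (T\<^sub>1 g) - formal_bracket \<A> (T\<^sub>1 f) (T\<^sub>0 g)"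
    unfolding T by simp
  finally have T': "T\<^sub>1 b + T\<^sub>0 d = - formal_bracket \<A> (T\<^sub>0 f) (T\<^sub>1 g) - formal_bracket \<A> (T\<^sub>1 f) (T\<^sub>0 g)" .
  show ?thesis
    unfolding Let_def source_map_def target_map_def source_deformation_def target_deformation_def fg br0
    using S1_restrict[OF f] op.S1_restrict[OF f] S1_mult[OF f g] op.S1_mult[OF f g]
      S1_bracket[OF f g] T' S_T_bracket[OF f g]
    by (simp add: op mult.commute flip: b_def d_def)
qed

end
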